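(* Let $\tau\in\{0,1\}$, let $d\ge 1$ be an integer, and let ${\rm D}_{i,d}^{\tau}(n)$ and $C_{i,N}^k(n)$ be as defined in the context. Then, for any integer $i$ with $2-\tau\le i\le d+\tau$ and all integers $k\ge 1$, the numbers $$C_{i,2d+2+\tau}^k(n)=(-1)^{k-1}\sum_{-k<\ell\le k}(-1)^\ell\, {\rm D}_{i,d}^{\tau}\!\left(n-\frac{\ell(3\ell-1)}{2}\right)+(-1)^k\,{\bf 1}_{n\in\mathscr{P}_{2d+2+\tau,i}}$$ are all zero for $0\le n<k(3k+1)/2$. For $n\ge k(3k+1)/2$ they are positive except for the cases \begin{align*} &C_{2,5}^1(5)=C_{2,5}^1(7)=C_{2,5}^1(9)=C_{2,5}^1(11)=0,\\ &C_{1,5}^1(7)=C_{1,5}^1(13)=-1,\\ &C_{1,5}^1(9)=C_{1,5}^1(11)=C_{1,5}^2(12)=0,\\ &C_{1,7}^1(9)=C_{1,2d+3}^1(5)=C_{1,2d+3}^1(7)=C_{1,2d+3}^k\left(k(3k+1)/2+1\right)=0, \end{align*} where in the last line $C_{1,2d+3}^1(7)=0$ is meant for $d\ge 2$.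
   Context: Notation: $(a;q)_\infty=\prod_{j\ge 0}(1-aq^j)$ and $(a_1,\ldots,a_m;q)_\infty=\prod_{1\le j\le m}(a_j;q)_\infty$; all series are formal power series in $q$. For $\tau\in\{0,1\}$ and integers $d\ge 1$, $1\le i\le d+1$, the numbers ${\rm D}_{i,d}^{\tau}(n)$ are defined by $$\sum_{n\ge 0}{\rm D}_{i,d}^{\tau}(n)q^n=\frac{(q^i,q^{2d+2+\tau-i},q^{2d+2+\tau};q^{2d+2+\tau})_\infty}{(q;q)_\infty},$$ with ${\rm D}_{i,d}^{\tau}(n)=0$ for $n<0$. For integers $N\ge 4$, $1\le i\le N/2$ and $k\ge 1$, the numbers $C_{i,N}^k(n)$ are defined by $$\sum_{n\ge 0}C_{i,N}^k(n)q^n=(-1)^{k-1}\left(\frac{1}{(q;q)_\infty}\sum_{-k< n\le k}(-1)^nq^{n(3n-1)/2}-1\right)(q^i,q^{N-i},q^{N};q^{N})_\infty .$$ Further, $\mathscr{P}_{a,b}=\left\{a\binom{n}{2}+bn: n\in\mathbb Z\right\}$ with $\binom{n}{2}=n(n-1)/2$, and ${\bf 1}_{event}$ denotes the indicator function, equal to $1$ if the event holds and $0$ otherwise.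
   Formalization: In the displayed identity the indicator of n ∈ P_{2d+2+τ,i} is replaced by a signed one, +1 if n comes from an even index m and −1 if from an odd m; as printed the identity fails, e.g. τ=d=k=1, i=n=2 gives −1 instead of 1. *)

theory Defs
  imports "HOL-Analysis.Infinite_Products" "HOL-Computational_Algebra.Formal_Power_Series"
begin

text \<open>The infinite product is taken in the topology of formal power series
  (coefficientwise stabilisation). Rational coefficients serve only to make
  division by \<open>(q;q)\<^sub>\<infinity>\<close> available.\<close>

definition qpoch_inf :: "rat fps list \<Rightarrow> rat fps \<Rightarrow> rat fps" where
  "qpoch_inf as q = (\<Prod>a\<leftarrow>as. \<Prod>j. 1 - a * q ^ j)"

definition D_gf :: "nat \<Rightarrow> nat \<Rightarrow> nat \<Rightarrow> rat fps" where
  "D_gf \<tau> d i =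
     qpoch_inf [fps_X ^ i, fps_X ^ (2*d + 2 + \<tau> - i), fps_X ^ (2*d + 2 + \<tau>)] (fps_X ^ (2*d + 2 + \<tau>))
       / qpoch_inf [fps_X] fps_X"

definition D :: "nat \<Rightarrow> nat \<Rightarrow> nat \<Rightarrow> int \<Rightarrow> rat" where
  "D \<tau> d i n = (if n < 0 then 0 else fps_nth (D_gf \<tau> d i) (nat n))"

definition C_gf :: "nat \<Rightarrow> nat \<Rightarrow> nat \<Rightarrow> rat fps" where
  "C_gf k i N =
     (- 1) ^ (k - 1)
     * (1 / qpoch_inf [fps_X] fps_X
          * (\<Sum>l\<in>{- int k<..int k}. fps_const ((- 1) powi l) * fps_X ^ nat (l * (3*l - 1) div 2))
        - 1)
     * qpoch_inf [fps_X ^ i, fps_X ^ (N - i), fps_X ^ N] (fps_X ^ N)"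

definition C :: "nat \<Rightarrow> nat \<Rightarrow> nat \<Rightarrow> nat \<Rightarrow> rat" where
  "C k i N n = fps_nth (C_gf k i N) n"

text \<open>\<open>P_even a b \<union> P_odd a b\<close> is the set of all \<open>a * binom m 2 + b * m\<close> with \<open>m\<close> an
  integer. It is split by the parity of \<open>m\<close> because \<open>m\<close> contributes the sign \<open>(-1)^m\<close> to the
  Jacobi triple product expansion of \<open>(q\<^sup>b, q\<^sup>a\<^sup>-\<^sup>b, q\<^sup>a; q\<^sup>a)\<^sub>\<infinity>\<close>. For \<open>0 < 2b < a\<close> the
  exponents are pairwise distinct, so the two parts are disjoint.\<close>

definition P_even :: "int \<Rightarrow> int \<Rightarrow> int set" where
  "P_even a b = {a * (m * (m - 1) div 2) + b * m | m. even m}"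

definition P_odd :: "int \<Rightarrow> int \<Rightarrow> int set" where
  "P_odd a b = {a * (m * (m - 1) div 2) + b * m | m. odd m}"

text \<open>Quadruples \<open>(k, i, N, n)\<close> of exceptional arguments of \<open>C k i N n\<close>.\<close>

definition exc_minus_one :: "(nat \<times> nat \<times> nat \<times> nat) set" where
  "exc_minus_one = {(1,1,5,7), (1,1,5,13)}"

definition exc_zero :: "(nat \<times> nat \<times> nat \<times> nat) set" where
  "exc_zero =
     {(1,2,5,5), (1,2,5,7), (1,2,5,9), (1,2,5,11)}
     \<union> {(1,1,5,9), (1,1,5,11), (2,1,5,12)}
     \<union> {(1,1,7,9)}
     \<union> {(1, 1, 2*d + 3, 5) | d. d \<ge> 1}
     \<union> {(1, 1, 2*d + 3, 7) | d. d \<ge> 2}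
     \<union> {(k, 1, 2*d + 3, k * (3*k + 1) div 2 + 1) | k d. k \<ge> 1 \<and> d \<ge> 1}"

end

(*
  The pentagonal number theorem rewrites the generating function of C^k as S_k * D, where D is the
  generating function of the partitions into parts that are not 0, i or -i modulo N, and S_k is the
  alternating sum over m >= k of q^(m(3m+1)/2) (1 - q^(2m+1)). The first two claims follow at once.

  For the sign, positivity of the coefficients of S_k / prod_{a in A} (1 - q^a) is inherited by every
  larger set of parts. For k >= 2 it is enough to take for A one of eight triples of pairwise coprime
  parts (with a fourth part when k = 2). The number of partitions into three such parts is a quadratic
  polynomial plus a bounded periodic term, so the alternating sum is a main term of size
  k (n - 3k^2/2) up to an error bounded linearly in the number of its terms plus a quadratic in the
  last index. This settles all but finitely many (k, n) with k <= 6, which are computed.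

  For k = 1 one compares (1 - q) D with the Jacobi theta series, whose coefficients are 0, 1 or -1:
  the coefficients of (1 - q) D are at least 2 (for i >= 2) or at least 3 up to a loss of 1
  (for i = 1) from a small exponent on.
*)
theory Submission
  imports Defs
begin

section \<open>Agreement of power series up to an exponent\<close>


text \<open>Pairwise coprimality of a, b, c leaves only simple poles at the roots of unity other
  than 1. So 8 L times the number of partitions of z differs from (2 z + s)^2 by a bounded periodic
  term, where s = a + b + c and L = a b c. This already holds for z > -s, although the number is 0
  for z < 0. Each pentagonal difference of such squares is a sum of two consecutive values of one
  function of the index. The alternating sum therefore telescopes to its first value. Only the last
  term, whose second argument may leave the range of the approximation, costs an error quadratic in
  the index.

  The obstacle at k = 1 is that negative values do occur, so positivity cannot always be inherited
  from a small set of parts. For i >= 2 the factor 1 - q cancels against the part 1, and what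
  remains counts partitions. For i = 1 there is no part 1, the coefficient of q is -1, and every new
  part b copies this loss to the exponent b + 1. Monotonicity then holds only up to that loss, which
  together with a theta coefficient of at most 1 explains the bound 3.\<close>

definition eq_upto :: "nat \<Rightarrow> 'a::zero fps \<Rightarrow> 'a fps \<Rightarrow> bool" where
  "eq_upto n f g \<longleftrightarrow> (\<forall>m\<le>n. fps_nth f m = fps_nth g m)"

lemma eq_uptoD: "eq_upto n f g \<Longrightarrow> m \<le> n \<Longrightarrow> fps_nth f m = fps_nth g m"
  by (simp add: eq_upto_def)

lemma eq_upto_refl [simp]: "eq_upto n f f"
  by (simp add: eq_upto_def)

lemma eq_upto_sym: "eq_upto n f g \<Longrightarrow> eq_upto n g f"
  by (simp add: eq_upto_def)

lemma eq_upto_trans [trans]: "eq_upto n f g \<Longrightarrow> eq_upto n g h \<Longrightarrow> eq_upto n f h"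
  by (simp add: eq_upto_def)

lemma eq_upto_mono: "eq_upto n f g \<Longrightarrow> m \<le> n \<Longrightarrow> eq_upto m f g"
  by (simp add: eq_upto_def)

lemma eq_upto_add: "eq_upto n f g \<Longrightarrow> eq_upto n f' g' \<Longrightarrow> eq_upto n (f + f') (g + g')"
  for f :: "'a::comm_ring_1 fps"
  by (simp add: eq_upto_def)

lemma eq_upto_diff: "eq_upto n f g \<Longrightarrow> eq_upto n f' g' \<Longrightarrow> eq_upto n (f - f') (g - g')"
  for f :: "'a::comm_ring_1 fps"
  by (simp add: eq_upto_def)

lemma eq_upto_mult: "eq_upto n f g \<Longrightarrow> eq_upto n f' g' \<Longrightarrow> eq_upto n (f * f') (g * g')"
  for f :: "'a::comm_ring_1 fps"
  by (auto simp add: eq_upto_def fps_mult_nth intro!: sum.cong)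

lemma eq_upto_sum: "(\<And>x. x \<in> A \<Longrightarrow> eq_upto n (f x) (g x)) \<Longrightarrow> eq_upto n (sum f A) (sum g A)"
  for f :: "'b \<Rightarrow> 'a::comm_ring_1 fps"
  by (induction A rule: infinite_finite_induct) (auto intro!: eq_upto_add)

lemma eq_upto_prod: "(\<And>x. x \<in> A \<Longrightarrow> eq_upto n (f x) (g x)) \<Longrightarrow> eq_upto n (prod f A) (prod g A)"
  for f :: "'b \<Rightarrow> 'a::comm_ring_1 fps"
  by (induction A rule: infinite_finite_induct) (auto intro!: eq_upto_mult)

lemma eq_upto_cancel:
  fixes f :: "'a::field fps"
  assumes "eq_upto n (u * f) (u * g)" "fps_nth u 0 \<noteq> 0"
  shows "eq_upto n f g"
proof -
  have "eq_upto n (inverse u * (u * f)) (inverse u * (u * g))"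
    by (rule eq_upto_mult) (use assms in auto)
  then show ?thesis
    using inverse_mult_eq_1[OF assms(2)] by (simp flip: mult.assoc)
qed

lemma eq_upto_inverse:
  fixes f :: "'a::field fps"
  assumes "eq_upto n f g" "fps_nth f 0 \<noteq> 0"
  shows "eq_upto n (inverse f) (inverse g)"
proof -
  have g0: "fps_nth g 0 \<noteq> 0" using assms by (auto simp: eq_upto_def)
  have "eq_upto n (f * inverse g) (g * inverse g)" by (rule eq_upto_mult) (use assms in auto)
  also have "g * inverse g = f * inverse f"
    using inverse_mult_eq_1[OF assms(2)] inverse_mult_eq_1[OF g0] by (simp add: mult.commute)
  finally show ?thesis using assms(2) eq_upto_cancel eq_upto_sym by metis
qed

lemma eq_upto_X_power_mult:
  fixes f :: "'a::comm_ring_1 fps"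
  assumes "eq_upto m f g" "n \<le> m + e"
  shows "eq_upto n (fps_X ^ e * f) (fps_X ^ e * g)"
  using assms by (auto simp: eq_upto_def fps_X_power_mult_nth)

lemma eq_upto_one_minus_X_power: "n < a \<Longrightarrow> eq_upto n (1 - fps_X ^ a) (1 :: 'a::comm_ring_1 fps)"
  by (auto simp: eq_upto_def fps_X_power_nth)


section \<open>Finite and infinite products of factors 1 - q^j\<close>

definition X_prod :: "nat set \<Rightarrow> rat fps" where
  "X_prod A = (\<Prod>j\<in>A. 1 - fps_X ^ j)"

lemma X_prod_Un: "finite A \<Longrightarrow> finite B \<Longrightarrow> A \<inter> B = {} \<Longrightarrow> X_prod (A \<union> B) = X_prod A * X_prod B"
  by (simp add: X_prod_def prod.union_disjoint)

lemma X_prod_0: "0 \<notin> A \<Longrightarrow> fps_nth (X_prod A) 0 = 1"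
  unfolding X_prod_def
proof (induction A rule: infinite_finite_induct)
  case (insert a A)
  then show ?case by (auto simp: fps_mult_nth_0 fps_X_power_nth)
qed auto

lemma X_prod_eq_upto:
  assumes "finite A" "finite B" "A \<inter> {..n} = B \<inter> {..n}"
  shows "eq_upto n (X_prod A) (X_prod B)"
proof -
  have *: "eq_upto n (X_prod A) (X_prod (A \<inter> {..n}))" if "finite A" for A
  proof -
    have "X_prod A = X_prod (A \<inter> {..n}) * X_prod (A - {..n})"
      using that by (subst X_prod_Un[symmetric]) (auto intro: arg_cong[of _ _ X_prod])
    also have "eq_upto n (X_prod (A - {..n})) (\<Prod>j\<in>A - {..n}. 1)"
      unfolding X_prod_def by (rule eq_upto_prod) (auto intro: eq_upto_one_minus_X_power)
    then have "eq_upto n (X_prod (A \<inter> {..n}) * X_prod (A - {..n})) (X_prod (A \<inter> {..n}) * 1)"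
      by (intro eq_upto_mult) auto
    finally show ?thesis by simp
  qed
  from *[OF assms(1)] *[OF assms(2)] assms(3) show ?thesis
    by (metis eq_upto_sym eq_upto_trans)
qed

definition progression :: "nat \<Rightarrow> nat \<Rightarrow> nat \<Rightarrow> nat set" where
  "progression a s n = (\<lambda>j. a + s * j) ` {..<n}"

lemma finite_progression [simp]: "finite (progression a s n)"
  by (simp add: progression_def)

lemma X_prod_progression:
  assumes "s > 0"
  shows "X_prod (progression a s n) = (\<Prod>j<n. 1 - fps_X ^ (a + s * j))"
  unfolding X_prod_def progression_def using assms by (subst prod.reindex) (auto simp: inj_on_def)

definition X_poch :: "nat \<Rightarrow> nat \<Rightarrow> rat fps" where
  "X_poch a s = (\<Prod>j. 1 - fps_X ^ a * (fps_X ^ s) ^ j)"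

text \<open>The coefficient of q^n no longer changes once more than n factors are present, so the
  diagonal series \<open>L\<close> is the limit of the partial products. Its constant term is 1,
  which supplies the nonzero limit that \<open>has_prod\<close> demands.\<close>

lemma X_poch_eq_upto:
  assumes "a > 0" "s > 0" "n < M"
  shows "eq_upto n (X_poch a s) (X_prod (progression a s M))"
proof -
  define p where "p M = X_prod (progression a s M)" for M
  define L where "L = Abs_fps (\<lambda>n. fps_nth (p (Suc n)) n)"
  have pp: "eq_upto n (p M) (p M')" if "n < M" "n < M'" for n M M'
  proof -
    have *: "j < K" if "a + s * j \<le> n" "n < K" for j K
    proof -
      have "j \<le> s * j" using assms by simp
      with that assms(1) show ?thesis by linarith
    qed
    show ?thesis
      unfolding p_def using that * by (intro X_prod_eq_upto) (auto simp: progression_def)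
  qed
  have L: "eq_upto n (p M) L" if "n < M" for n M
  proof -
    have "fps_nth (p M) m = fps_nth L m" if "m \<le> n" for m
    proof -
      have "eq_upto m (p M) (p (Suc m))" by (rule pp) (use that \<open>n < M\<close> in auto)
      then show ?thesis by (simp add: L_def eq_uptoD)
    qed
    then show ?thesis by (simp add: eq_upto_def)
  qed
  have "(\<lambda>M. p (Suc M)) \<longlonglongrightarrow> L"
  proof (rule tendsto_fpsI)
    fix n
    show "eventually (\<lambda>M. fps_nth (p (Suc M)) n = fps_nth L n) sequentially"
      using L[of n] by (intro eventually_sequentiallyI[of n]) (auto simp: eq_upto_def)
  qed
  moreover have "L \<noteq> 0"
  proof -
    have "fps_nth L 0 = 1"
      using assms by (auto simp: L_def p_def progression_def intro!: X_prod_0)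
    then show ?thesis by auto
  qed
  moreover have "p (Suc M) = (\<Prod>j\<le>M. 1 - fps_X ^ a * (fps_X ^ s) ^ j)" for M
    unfolding p_def using assms
    by (simp add: X_prod_progression lessThan_Suc_atMost power_add flip: power_mult)
  ultimately have "(\<lambda>j. 1 - fps_X ^ a * (fps_X ^ s) ^ j) has_prod L"
    by (simp add: has_prod_def raw_has_prod_def)
  then have "X_poch a s = L"
    unfolding X_poch_def by (rule has_prod_unique[symmetric])
  with L[OF assms(3)] show ?thesis
    by (simp add: p_def eq_upto_sym)
qed

section \<open>The q-binomial theorem\<close>

fun qbinom :: "'a::comm_ring_1 \<Rightarrow> nat \<Rightarrow> nat \<Rightarrow> 'a" where
  "qbinom q n 0 = 1"
| "qbinom q 0 (Suc k) = 0"
| "qbinom q (Suc n) (Suc k) = qbinom q n k + q ^ Suc k * qbinom q n (Suc k)"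

lemma qbinom_eq_0: "n < k \<Longrightarrow> qbinom q n k = 0"
  by (induction q n k rule: qbinom.induct) auto

lemma Suc_choose_two: "Suc k choose 2 = (k choose 2) + k"
  by (simp add: numeral_2_eq_2)

text \<open>Splitting off the factor a + b leaves the same product with b replaced by b q, hence the
  induction over arbitrary b. The form homogeneous in a and b allows a to be a power of X later on,
  without negative exponents.\<close>

theorem q_binomial_theorem:
  fixes a b q :: "'a::comm_ring_1"
  shows "(\<Prod>j<n. a + b * q ^ j) = (\<Sum>k\<le>n. q ^ (k choose 2) * qbinom q n k * b ^ k * a ^ (n - k))"
proof (induction n arbitrary: b)
  case 0
  then show ?case by (simp add: numeral_2_eq_2)
next
  case (Suc n)
  define t where "t k = q ^ (k choose 2) * qbinom q n k * (b * q) ^ k * a ^ (n - k)" for k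
  define s where "s k = q ^ (k choose 2) * qbinom q (Suc n) k * b ^ k * a ^ (Suc n - k)" for k
  have step: "s (Suc k) = b * t k + (if k < n then a * t (Suc k) else 0)" if "k \<le> n" for k
  proof (cases "k < n")
    case True
    then have "a ^ (n - k) = a * a ^ (n - Suc k)"
      by (metis Suc_diff_Suc power_Suc)
    with True show ?thesis
      by (simp add: s_def t_def Suc_choose_two power_add power_mult_distrib algebra_simps)
  next
    case False
    with that show ?thesis
      by (simp add: s_def t_def Suc_choose_two qbinom_eq_0 power_add power_mult_distrib algebra_simps)
  qed
  have "(\<Prod>j<Suc n. a + b * q ^ j) = (a + b) * (\<Prod>j<n. a + (b * q) * q ^ j)"
    by (subst prod.lessThan_Suc_shift) (simp add: mult.assoc)
  also have "\<dots> = (a + b) * (\<Sum>k\<le>n. t k)"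
    by (simp add: Suc.IH t_def)
  also have "\<dots> = a * (\<Sum>k\<le>n. t k) + (\<Sum>k\<le>n. b * t k)"
    by (simp add: algebra_simps sum_distrib_left sum.distrib)
  also have "(\<Sum>k\<le>n. t k) = t 0 + (\<Sum>k<n. t (Suc k))"
    by (simp only: sum.lessThan_Suc_shift lessThan_Suc_atMost[symmetric])
  also have "a * \<dots> = s 0 + (\<Sum>k\<le>n. if k < n then a * t (Suc k) else 0)"
  proof -
    have "(\<Sum>k\<le>n. if k < n then a * t (Suc k) else 0) = (\<Sum>k<n. a * t (Suc k))"
      by (simp flip: lessThan_Suc_atMost)
    then show ?thesis by (simp add: s_def t_def algebra_simps sum_distrib_left)
  qed
  also have "s 0 + (\<Sum>k\<le>n. if k < n then a * t (Suc k) else 0) + (\<Sum>k\<le>n. b * t k) = s 0 + (\<Sum>k\<le>n. s (Suc k))"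
    by (simp add: step sum.distrib)
  also have "\<dots> = (\<Sum>k\<le>Suc n. s k)"
    by (simp only: sum.atMost_Suc_shift)
  finally show ?case by (simp only: s_def)
qed

text \<open>This is the quotient formula for Gaussian binomials, multiplied out so that it makes
  sense in any commutative ring.\<close>

lemma qbinom_mult_prod:
  fixes q :: "'a::comm_ring_1"
  assumes "k \<le> n"
  shows "qbinom q n k * (\<Prod>j<k. 1 - q ^ Suc j) * (\<Prod>j<n - k. 1 - q ^ Suc j) = (\<Prod>j<n. 1 - q ^ Suc j)"
  using assms
proof (induction q n k rule: qbinom.induct)
  case (3 q n k)
  let ?p = "\<lambda>n. \<Prod>j<n. 1 - q ^ Suc j"
  show ?case
  proof (cases "k = n")
    case True
    with 3(1) have "qbinom q n n * (\<Prod>j<n. 1 - q ^ Suc j) = (\<Prod>j<n. 1 - q ^ Suc j)"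
      by simp
    then show ?thesis using True by (simp add: qbinom_eq_0 del: power_Suc flip: mult.assoc)
  next
    case False
    with 3 have "Suc k \<le> n" by simp
    then obtain m where m: "n = Suc k + m" using le_Suc_ex by blast
    have *: "qbinom q n k * ?p k * ?p (Suc m) = ?p n"
      "qbinom q n (Suc k) * ?p (Suc k) * ?p m = ?p n"
      using 3 m by (simp_all del: power_Suc)
    have "qbinom q (Suc n) (Suc k) * ?p (Suc k) * ?p (Suc m)
       = (qbinom q n k * ?p k * ?p (Suc m)) * (1 - q ^ Suc k)
         + q ^ Suc k * (qbinom q n (Suc k) * ?p (Suc k) * ?p m) * (1 - q ^ Suc m)"
      by (simp add: algebra_simps del: power_Suc)
    also have "\<dots> = ?p n * (1 - q ^ Suc k * q ^ Suc m)"
      unfolding * by (simp add: algebra_simps del: power_Suc)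
    also have "\<dots> = ?p (Suc n)"
      by (simp add: m flip: power_add del: power_Suc)
    finally show ?thesis using m by (simp del: power_Suc qbinom.simps)
  qed
qed auto

section \<open>The Jacobi triple product\<close>


definition triple_exp :: "nat \<Rightarrow> nat \<Rightarrow> int \<Rightarrow> int" where
  "triple_exp N i m = int N * (m * (m - 1) div 2) + int i * m"

lemma two_triple_exp: "2 * triple_exp N i m = int N * (m * (m - 1)) + 2 * int i * m"
proof -
  have "even (m * (m - 1))" by auto
  then have "2 * (m * (m - 1) div 2) = m * (m - 1)" by simp
  then show ?thesis unfolding triple_exp_def by (metis distrib_left mult.assoc mult.left_commute)
qed

text \<open>A linear bound suffices: it limits the indices that reach a given exponent, and in the
  triple product it compensates exactly for the precision that the q-binomials lose away from the
  centre. It comes from (m - 1)(m - 2) >= 0 for m >= 0, and from (m + 1)(m + 2) >= 0 together with i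
  <= N for m < 0.\<close>

lemma triple_exp_ge:
  assumes "i \<le> N"
  shows "triple_exp N i m \<ge> int N * (\<bar>m\<bar> - 1)"
proof -
  have "2 * (int N * (\<bar>m\<bar> - 1)) \<le> int N * (m * (m - 1)) + 2 * int i * m"
  proof (cases "m \<ge> 0")
    case True
    have "0 \<le> (m - 1) * (m - 2)"
      by (cases "m \<le> 1") (auto intro: mult_nonpos_nonpos)
    then have "0 \<le> int N * ((m - 1) * (m - 2))" by simp
    moreover have "0 \<le> 2 * int i * m" using True by simp
    moreover have "2 * (int N * (m - 1)) = int N * (m * (m - 1)) - int N * ((m - 1) * (m - 2))"
      by (simp add: algebra_simps)
    ultimately show ?thesis using True by (simp only: abs_of_nonneg)
  next
    case False
    have "int i * (- m) \<le> int N * (- m)" using False assms by (intro mult_right_mono) auto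
    moreover have "0 \<le> (m + 1) * (m + 2)"
      unfolding zero_le_mult_iff using False by presburger
    then have "0 \<le> int N * ((m + 1) * (m + 2))" by simp
    moreover have "2 * (int N * (- m - 1)) = int N * (m * (m - 1)) - int N * ((m + 1) * (m + 2)) - 2 * (int N * (- m))"
      by (simp add: algebra_simps)
    ultimately show ?thesis using False by (simp only: abs_of_neg not_le)
  qed
  then show ?thesis unfolding two_triple_exp[symmetric] by linarith
qed

lemma triple_exp_nonneg:
  assumes "i \<le> N"
  shows "triple_exp N i m \<ge> 0"
proof (cases "m = 0")
  case False
  then have "0 \<le> int N * (\<bar>m\<bar> - 1)" by simp
  then show ?thesis using triple_exp_ge[OF assms, of m] by linarith
qed (simp add: triple_exp_def)

lemma prod_lessThan_add: "(\<Prod>j<n + m. f j) = (\<Prod>j<n. f j) * (\<Prod>j<m. f (n + j))"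
  for f :: "nat \<Rightarrow> 'a::comm_monoid_mult"
  by (induction m) (simp_all add: mult.assoc)

lemma two_choose_two: "2 * int (k choose 2) = int k * (int k - 1)"
  by (induction k) (simp_all add: Suc_choose_two algebra_simps numeral_2_eq_2[symmetric])

text \<open>The \<open>q\<close>-binomial theorem for \<open>\<Prod>j<2n. q\<^sup>N\<^sup>n - q\<^sup>i\<^sup>+\<^sup>N\<^sup>j\<close>, from which the
  monomial common to both sides is cancelled.\<close>

lemma finite_triple_product:
  assumes "0 < i" "i \<le> N"
  shows "X_prod (progression i N n) * X_prod (progression (N - i) N n) =
    (\<Sum>k\<le>2 * n. (- 1) ^ (n + k) * fps_X ^ nat (triple_exp N i (int k - int n)) *
        qbinom (fps_X ^ N) (2 * n) k)" (is "_ = ?R")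
proof -
  let ?X = "fps_X :: rat fps"
  \<comment> \<open>The exponent of the common monomial: the lower n factors yield q^(i + N j), the
    upper n factors yield q^(N n) each.\<close>
  define E where "E = (\<Sum>j<n. i + N * j) + N * n * n"
  have N: "N > 0" using assms by simp
  have E2: "2 * int E = 2 * int i * int n + int N * (int n * (int n - 1)) + 2 * (int N * int n * int n)"
    unfolding E_def by (induction n) (simp_all add: algebra_simps)
  have exp_eq: "N * (k choose 2) + i * k + N * n * (2 * n - k)
      = E + nat (triple_exp N i (int k - int n))" if "k \<le> 2 * n" for k
  proof -
    have "2 * int (N * (k choose 2) + i * k + N * n * (2 * n - k))
        = int N * (2 * int (k choose 2)) + 2 * int i * int k + 2 * (int N * int n * int (2 * n - k))"
      unfolding of_nat_add of_nat_mult by (simp add: algebra_simps)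
    also have "int (2 * n - k) = 2 * int n - int k"
      using that by simp
    also have "int N * (2 * int (k choose 2)) + 2 * int i * int k + 2 * (int N * int n * (2 * int n - int k))
        = 2 * int E + 2 * triple_exp N i (int k - int n)"
      unfolding two_choose_two two_triple_exp E2 by (simp add: algebra_simps)
    finally have "2 * int (N * (k choose 2) + i * k + N * n * (2 * n - k))
        = 2 * int E + 2 * triple_exp N i (int k - int n)" .
    moreover have "a = E + nat t" if "2 * int a = 2 * int E + 2 * t" "0 \<le> t" for a t
      using that by linarith
    ultimately show ?thesis using triple_exp_nonneg[OF assms(2)] by blast
  qed
  \<comment> \<open>In the upper half q^(N n) is the smaller power and the factors give the
    progression from i; in the lower half q^(i + N j) is, and they give the progression from N - i
    in reverse order.\<close>
  have "(\<Prod>j<n + n. ?X ^ (N * n) + (- (?X ^ i)) * (?X ^ N) ^ j)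
      = (\<Prod>j<n. ?X ^ (N * n) + (- (?X ^ i)) * (?X ^ N) ^ j)
        * (\<Prod>j<n. ?X ^ (N * n) + (- (?X ^ i)) * (?X ^ N) ^ (n + j))"
    by (rule prod_lessThan_add)
  also have "(\<Prod>j<n. ?X ^ (N * n) + (- (?X ^ i)) * (?X ^ N) ^ j)
      = (\<Prod>j<n. - (?X ^ (i + N * j)) * (1 - ?X ^ (N - i + N * (n - Suc j))))"
  proof (rule prod.cong)
    fix j assume "j \<in> {..<n}"
    then obtain l where l: "n = Suc j + l" using less_iff_Suc_add by auto
    have "N * n = (i + N * j) + (N - i + N * (n - Suc j))"
      using assms by (simp add: l algebra_simps)
    then have "?X ^ (N * n) = ?X ^ (i + N * j) * ?X ^ (N - i + N * (n - Suc j))"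
      by (simp only: power_add)
    moreover have "?X ^ i * (?X ^ N) ^ j = ?X ^ (i + N * j)"
      by (simp add: power_add power_mult)
    ultimately show "?X ^ (N * n) + (- (?X ^ i)) * (?X ^ N) ^ j
        = - (?X ^ (i + N * j)) * (1 - ?X ^ (N - i + N * (n - Suc j)))"
      by (simp add: algebra_simps del: power_mult)
  qed simp
  also have "\<dots> = (\<Prod>j<n. - (?X ^ (i + N * j))) * X_prod (progression (N - i) N n)"
    unfolding X_prod_progression[OF N] prod.distrib
      prod.nat_diff_reindex[of "\<lambda>j. 1 - ?X ^ (N - i + N * j)"] ..
  also have "(\<Prod>j<n. ?X ^ (N * n) + (- (?X ^ i)) * (?X ^ N) ^ (n + j))
     = (\<Prod>j<n. ?X ^ (N * n) * (1 - ?X ^ (i + N * j)))"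
    by (rule prod.cong) (simp_all add: algebra_simps power_add flip: power_mult)
  also have "\<dots> = ?X ^ (N * n * n) * X_prod (progression i N n)"
    by (simp add: X_prod_progression[OF N] prod.distrib power_mult)
  also have "(\<Prod>j<n. - (?X ^ (i + N * j))) = (- 1) ^ n * ?X ^ (\<Sum>j<n. i + N * j)"
    by (simp only: prod_uminus power_sum card_lessThan)
  finally have lhs: "(\<Prod>j<n + n. ?X ^ (N * n) + (- (?X ^ i)) * (?X ^ N) ^ j)
     = ?X ^ E * ((- 1) ^ n * (X_prod (progression i N n) * X_prod (progression (N - i) N n)))"
    by (simp add: E_def power_add mult_ac)
  have "(\<Prod>j<n + n. ?X ^ (N * n) + (- (?X ^ i)) * (?X ^ N) ^ j)
     = (\<Sum>k\<le>n + n. (?X ^ N) ^ (k choose 2) * qbinom (?X ^ N) (n + n) k * (- (?X ^ i)) ^ k *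
          (?X ^ (N * n)) ^ (n + n - k))"
    by (rule q_binomial_theorem)
  also have "\<dots> = (\<Sum>k\<le>2 * n. ?X ^ E * ((- 1) ^ k * ?X ^ nat (triple_exp N i (int k - int n)) *
        qbinom (?X ^ N) (2 * n) k))"
  proof (rule sum.cong)
    fix k assume "k \<in> {..2 * n}"
    then have k: "k \<le> 2 * n" by simp
    have "(?X ^ N) ^ (k choose 2) * qbinom (?X ^ N) (n + n) k * (- (?X ^ i)) ^ k *
          (?X ^ (N * n)) ^ (n + n - k)
       = (- 1) ^ k * ?X ^ (N * (k choose 2) + i * k + N * n * (2 * n - k)) * qbinom (?X ^ N) (2 * n) k"
      unfolding mult_2 by (subst power_minus) (simp only: power_add power_mult mult_ac)
    also have "\<dots> = ?X ^ E * ((- 1) ^ k * ?X ^ nat (triple_exp N i (int k - int n)) *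
        qbinom (?X ^ N) (2 * n) k)"
      unfolding exp_eq[OF k] by (simp only: power_add mult_ac)
    finally show "(?X ^ N) ^ (k choose 2) * qbinom (?X ^ N) (n + n) k * (- (?X ^ i)) ^ k *
          (?X ^ (N * n)) ^ (n + n - k) = \<dots>" .
  qed (simp add: mult_2)
  finally have "?X ^ E * ((- 1) ^ n * (X_prod (progression i N n) * X_prod (progression (N - i) N n)))
     = ?X ^ E * (\<Sum>k\<le>2 * n. (- 1) ^ k * ?X ^ nat (triple_exp N i (int k - int n)) *
        qbinom (?X ^ N) (2 * n) k)"
    unfolding lhs by (simp add: sum_distrib_left)
  then have *: "(- 1) ^ n * (X_prod (progression i N n) * X_prod (progression (N - i) N n))
     = (\<Sum>k\<le>2 * n. (- 1) ^ k * ?X ^ nat (triple_exp N i (int k - int n)) *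
        qbinom (?X ^ N) (2 * n) k)"
    by simp
  have "X_prod (progression i N n) * X_prod (progression (N - i) N n)
     = (- 1) ^ n * ((- 1) ^ n * (X_prod (progression i N n) * X_prod (progression (N - i) N n)))"
    by (simp flip: mult.assoc power_add)
  also have "\<dots> = ?R"
    unfolding * by (simp add: sum_distrib_left power_add mult.assoc)
  finally show ?thesis .
qed

text \<open>The q-binomial is (q)_2M / ((q)_k (q)_(2M-k)) in the variable q^N, and a product of m
  factors agrees with the infinite one below the exponent N (m + 1). So up to the stated exponent it
  is the inverse of the infinite product, and one more factor
  \<open>X_prod (progression N N M)\<close> turns it into 1.\<close>

lemma qbinom_X_eq_upto:
  assumes "N > 0" "k \<le> 2 * M" "n < N * (min k (2 * M - k) + 1)" "n < N * (M + 1)"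
  shows "eq_upto n (X_prod (progression N N M) * qbinom (fps_X ^ N) (2 * M) k) 1"
proof -
  let ?P = "\<lambda>M. X_prod (progression N N M)"
  let ?B = "qbinom (fps_X ^ N) (2 * M) k :: rat fps"
  have P: "?P m = (\<Prod>j<m. 1 - (fps_X ^ N) ^ Suc j)" for m
    using assms(1) by (simp add: X_prod_progression power_add power_mult)
  have eq: "eq_upto n (?P a) (?P b)" if "n < N * (a + 1)" "n < N * (b + 1)" for a b
  proof -
    have *: "j < b" if "N + N * j \<le> n" "n < N * (b + 1)" for j b
    proof -
      have "N * (j + 1) = N + N * j" by simp
      with that have "N * (j + 1) < N * (b + 1)" by linarith
      then have "j + 1 < b + 1" by (simp only: mult_less_cancel1)
      then show ?thesis by simp
    qed
    show ?thesis
      by (intro X_prod_eq_upto) (use that * in \<open>auto simp: progression_def\<close>)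
  qed
  have le: "n < N * (k + 1)" "n < N * (2 * M - k + 1)" "n < N * (2 * M + 1)"
    by (rule less_le_trans[OF assms(3)], simp) (rule less_le_trans[OF assms(3)], simp,
        rule less_le_trans[OF assms(4)], simp)
  have p0: "fps_nth (?P M) 0 \<noteq> 0"
    using assms(1) by (subst X_prod_0) (auto simp: progression_def)
  have "eq_upto n (?B * ?P M * ?P M) (?B * ?P k * ?P (2 * M - k))"
    by (intro eq_upto_mult eq eq_upto_refl le assms(4))
  also have "\<dots> = ?P (2 * M)"
    unfolding P by (rule qbinom_mult_prod[OF assms(2)])
  also have "eq_upto n (?P (2 * M)) (?P M)"
    by (intro eq le assms(4))
  finally have "eq_upto n (?P M * (?P M * ?B)) (?P M * 1)"
    by (simp add: mult_ac)
  then show ?thesis by (rule eq_upto_cancel) (rule p0)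
qed

definition triple_prod :: "nat \<Rightarrow> nat \<Rightarrow> rat fps" where
  "triple_prod i N = X_poch i N * X_poch (N - i) N * X_poch N N"

lemma triple_prod_eq_upto_X_prod:
  assumes "0 < i" "i < N" "n < M"
  shows "eq_upto n (triple_prod i N)
    (X_prod (progression i N M) * X_prod (progression (N - i) N M) * X_prod (progression N N M))"
  unfolding triple_prod_def by (intro eq_upto_mult X_poch_eq_upto) (use assms in auto)

text \<open>With m = k - M and l = M - |m|, the q-binomial at index k is replaced correctly up to N
  (l + 1) - 1. Its monomial has exponent at least N (|m| - 1), and the two numbers add up to N M - 1
  >= n.\<close>

theorem jacobi_triple_product:
  assumes "0 < i" "i < N" "n < M"
  shows "eq_upto n (triple_prod i N)
    (\<Sum>k\<le>2 * M. (- 1) ^ (M + k) * fps_X ^ nat (triple_exp N i (int k - int M)))"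
proof -
  let ?B = "qbinom (fps_X ^ N) (2 * M) :: nat \<Rightarrow> rat fps"
  let ?P = "X_prod (progression N N M)"
  let ?t = "\<lambda>k. triple_exp N i (int k - int M)"
  have N: "N > 0" using assms by simp
  have NM: "N * M \<ge> M" using N by simp
  have "eq_upto n (triple_prod i N)
    (X_prod (progression i N M) * X_prod (progression (N - i) N M) * ?P)"
    by (rule triple_prod_eq_upto_X_prod[OF assms])
  also have "\<dots> = (\<Sum>k\<le>2 * M. (- 1) ^ (M + k) * (fps_X ^ nat (?t k) * (?P * ?B k)))"
    unfolding finite_triple_product[OF assms(1) less_imp_le[OF assms(2)]] sum_distrib_right
    by (rule sum.cong) (simp_all only: mult_ac)
  also have "eq_upto n \<dots> (\<Sum>k\<le>2 * M. (- 1) ^ (M + k) * (fps_X ^ nat (?t k) * 1))"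
  proof (rule eq_upto_sum, rule eq_upto_mult[OF eq_upto_refl])
    fix k assume "k \<in> {..2 * M}"
    then have k: "k \<le> 2 * M" by simp
    define l where "l = min k (2 * M - k)"
    have l: "int l = int M - \<bar>int k - int M\<bar>"
      unfolding l_def using k by auto
    have "l \<le> M" unfolding l_def by auto
    have "N * (l + 1) \<le> N * (M + 1)" using \<open>l \<le> M\<close> by (intro mult_left_mono) auto
    moreover have "N * (l + 1) \<ge> 1" using N by simp
    ultimately have "eq_upto (N * (l + 1) - 1) (?P * ?B k) 1"
      unfolding l_def by (intro qbinom_X_eq_upto N k) linarith+
    moreover have "n \<le> N * (l + 1) - 1 + nat (?t k)"
    proof -
      have "?t k \<ge> int N * (\<bar>int k - int M\<bar> - 1)"
        using assms by (intro triple_exp_ge) auto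
      also have "int N * (\<bar>int k - int M\<bar> - 1) = int N * int M - int N * (int l + 1)"
        unfolding l by (simp add: algebra_simps)
      finally have "int (N * M) \<le> int (N * (l + 1)) + ?t k"
        by (simp add: algebra_simps)
      with NM assms(3) \<open>N * (l + 1) \<ge> 1\<close> show ?thesis by linarith
    qed
    ultimately show "eq_upto n (fps_X ^ nat (?t k) * (?P * ?B k)) (fps_X ^ nat (?t k) * 1)"
      by (rule eq_upto_X_power_mult)
  qed
  finally show ?thesis by simp
qed

section \<open>The pentagonal number theorem and truncation\<close>


text \<open>The doubled difference factors as (m - m')(N (m + m' - 1) + 2 i). The second factor
  cannot vanish, since -2 i lies strictly between -N and 0 and so is no multiple of N.\<close>

lemma triple_exp_inj:
  assumes "0 < i" "2 * i < N" "triple_exp N i m = triple_exp N i m'"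
  shows "m = m'"
proof (rule ccontr)
  assume "m \<noteq> m'"
  have "2 * triple_exp N i m - 2 * triple_exp N i m' = (m - m') * (int N * (m + m' - 1) + 2 * int i)"
    unfolding two_triple_exp by (simp add: algebra_simps)
  with assms(3) \<open>m \<noteq> m'\<close> have *: "int N * (m + m' - 1) = - 2 * int i" by auto
  have "m + m' - 1 < 0"
  proof (rule ccontr)
    assume "\<not> m + m' - 1 < 0"
    then have "0 \<le> int N * (m + m' - 1)" by simp
    with * assms(1) show False by simp
  qed
  moreover have "m + m' - 1 > - 1"
  proof (rule ccontr)
    assume "\<not> m + m' - 1 > - 1"
    then have "int N * (m + m' - 1) \<le> int N * (- 1)" by (intro mult_left_mono) auto
    with * assms(2) show False by simp
  qed
  ultimately show False by simp
qed

lemma P_even_triple_exp: "P_even (int N) (int i) = {triple_exp N i m |m. even m}"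
  and P_odd_triple_exp: "P_odd (int N) (int i) = {triple_exp N i m |m. odd m}"
  by (simp_all add: P_even_def P_odd_def triple_exp_def)

lemma triple_prod_nth:
  assumes "0 < i" "2 * i < N"
  shows "fps_nth (triple_prod i N) n
    = of_bool (int n \<in> P_even (int N) (int i)) - of_bool (int n \<in> P_odd (int N) (int i))"
proof -
  define M where "M = n + 1"
  let ?t = "\<lambda>k. triple_exp N i (int k - int M)"
  have N: "i < N" using assms by simp
  have term_nth: "fps_nth ((- 1) ^ a * fps_X ^ nat e) n = ((- 1) ^ a * of_bool (e = int n) :: rat)" if "0 \<le> e" for a e
    using that by (cases "even a") (auto simp: fps_X_power_nth)
  have "fps_nth (triple_prod i N) n
      = fps_nth (\<Sum>k\<le>2 * M. (- 1) ^ (M + k) * fps_X ^ nat (?t k)) n"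
    by (rule eq_uptoD[OF jacobi_triple_product[OF assms(1) N, of n M]]) (simp_all add: M_def)
  also have "\<dots> = (\<Sum>k\<le>2 * M. (- 1) ^ (M + k) * of_bool (?t k = int n))"
    unfolding fps_sum_nth using triple_exp_nonneg[OF less_imp_le[OF N]]
    by (intro sum.cong refl term_nth)
  also have "\<dots> = of_bool (int n \<in> P_even (int N) (int i)) - of_bool (int n \<in> P_odd (int N) (int i))"
  proof (cases "\<exists>m. triple_exp N i m = int n")
    case True
    then obtain m where m: "triple_exp N i m = int n" by blast
    have uniq: "m' = m" if "triple_exp N i m' = int n" for m'
      using triple_exp_inj[OF assms] that m by simp
    have "\<bar>m\<bar> \<le> int M"
    proof (cases "m = 0")
      case False
      then have "1 * (\<bar>m\<bar> - 1) \<le> int N * (\<bar>m\<bar> - 1)" using N by (intro mult_right_mono) auto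
      also have "\<dots> \<le> int n" using triple_exp_ge[OF less_imp_le[OF N], of m] m by simp
      finally show ?thesis by (simp add: M_def)
    qed simp
    then obtain k where k: "m = int k - int M" "k \<le> 2 * M"
      by (intro that[of "nat (m + int M)"]) auto
    have "(\<Sum>l\<le>2 * M. (- 1) ^ (M + l) * of_bool (?t l = int n))
        = (\<Sum>l\<in>{k}. (- 1) ^ (M + l) * of_bool (?t l = int n) :: rat)"
      using k by (intro sum.mono_neutral_right) (auto dest!: uniq)
    also have "\<dots> = (- 1) ^ (M + k)" using m k by simp
    also have "\<dots> = (if even m then 1 else - 1)"
    proof -
      have "even m \<longleftrightarrow> even (M + k)" using k(1) by presburger
      then show ?thesis by (simp only: minus_one_power_iff)
    qed
    also have "\<dots> = of_bool (int n \<in> P_even (int N) (int i)) - of_bool (int n \<in> P_odd (int N) (int i))"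
    proof -
      have "int n \<in> P_even (int N) (int i) \<longleftrightarrow> even m" "int n \<in> P_odd (int N) (int i) \<longleftrightarrow> odd m"
        unfolding P_even_triple_exp P_odd_triple_exp mem_Collect_eq using m uniq by metis+
      then show ?thesis by simp
    qed
    finally show ?thesis .
  next
    case False
    then have "int n \<notin> P_even (int N) (int i)" "int n \<notin> P_odd (int N) (int i)"
      unfolding P_even_triple_exp P_odd_triple_exp mem_Collect_eq by metis+
    with False show ?thesis by simp
  qed
  finally show ?thesis .
qed

section \<open>Euler's product and the pentagonal series\<close>

definition euler_prod :: "rat fps" where
  "euler_prod = X_poch 1 1"

definition pentagonal_sum :: "nat \<Rightarrow> rat fps" where
  "pentagonal_sum k
    = (\<Sum>l\<in>{- int k<..int k}. fps_const ((- 1) powi l) * fps_X ^ nat (l * (3*l - 1) div 2))"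

definition pent :: "nat \<Rightarrow> nat" where
  "pent m = m * (3 * m + 1) div 2"

lemma two_pent: "2 * pent m = m * (3 * m + 1)"
proof -
  have "even (m * (3 * m + 1))" by auto
  then show ?thesis by (simp add: pent_def)
qed

lemma pent_Suc: "pent (Suc m) = pent m + 3 * m + 2"
  using two_pent[of m] two_pent[of "Suc m"] by (simp add: algebra_simps)

lemma pent_0 [simp]: "pent 0 = 0"
  by (simp add: pent_def)

lemma pent_mono: "m \<le> n \<Longrightarrow> pent m \<le> pent n"
  by (induction n rule: dec_induct) (auto simp: pent_Suc)

lemma pent_ge: "m \<le> pent m"
  by (induction m) (auto simp: pent_Suc)

lemma minus_one_powi: "(- 1 :: rat) powi l = (if even l then 1 else - 1)"
  by (simp add: power_int_minus_left)

text \<open>The range grows by l = -k and l = k + 1, whose exponents are \<open>pent k\<close> and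
  \<open>pent k + (2 * k + 1)\<close> and whose signs are opposite.\<close>

lemma pentagonal_sum_Suc:
  "pentagonal_sum (Suc k) = pentagonal_sum k + (- 1) ^ k * fps_X ^ pent k * (1 - fps_X ^ (2 * k + 1))"
proof -
  have "nat (int (Suc k) * (3 * int (Suc k) - 1) div 2) = pent k + (2 * k + 1)"
  proof -
    have "int (Suc k) * (3 * int (Suc k) - 1) = 2 * int (pent k + (2 * k + 1))"
      using arg_cong[OF two_pent[of k], of int] by (simp add: algebra_simps)
    then show ?thesis by simp
  qed
  moreover have "nat (- int k * (3 * (- int k) - 1) div 2) = pent k"
  proof -
    have "- int k * (3 * (- int k) - 1) = 2 * int (pent k)"
      using arg_cong[OF two_pent[of k], of int] by (simp add: algebra_simps)
    then show ?thesis by simp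
  qed
  moreover have "{- int (Suc k)<..int (Suc k)} = insert (int (Suc k)) (insert (- int k) {- int k<..int k})"
    by auto
  moreover have "fps_const ((- 1) powi (- int k)) = ((- 1) ^ k :: rat fps)"
      "fps_const ((- 1) powi int (Suc k)) = (- ((- 1) ^ k) :: rat fps)"
    by (auto simp: minus_one_powi minus_one_power_iff simp flip: fps_const_neg)
  ultimately show ?thesis
    unfolding pentagonal_sum_def by (simp add: algebra_simps power_add)
qed

lemma pentagonal_sum_diff:
  "k \<le> K \<Longrightarrow> pentagonal_sum K - pentagonal_sum k
    = (\<Sum>m=k..<K. (- 1) ^ m * fps_X ^ pent m * (1 - fps_X ^ (2 * m + 1)))"
  by (induction K rule: dec_induct) (simp_all add: pentagonal_sum_Suc algebra_simps)

lemma euler_prod_eq_upto: "eq_upto n euler_prod (X_prod {1..n})"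
proof -
  have "eq_upto n euler_prod (X_prod (progression 1 1 (Suc n)))"
    unfolding euler_prod_def by (rule X_poch_eq_upto) auto
  also have "eq_upto n (X_prod (progression 1 1 (Suc n))) (X_prod {1..n})"
  proof (rule X_prod_eq_upto)
    have "x \<in> (\<lambda>j. 1 + 1 * j) ` {..<Suc n}" if "1 \<le> x" "x \<le> n" for x
      using that by (intro image_eqI[of _ _ "x - 1"]) auto
    then show "progression 1 1 (Suc n) \<inter> {..n} = {1..n} \<inter> {..n}"
      by (auto simp: progression_def)
  qed auto
  finally show ?thesis .
qed

lemma euler_prod_nth_0 [simp]: "fps_nth euler_prod 0 = 1"
  using eq_uptoD[OF euler_prod_eq_upto, of 0 0] by (simp add: X_prod_def)

text \<open>By 2 i < N the residues i, N - i, 0 are distinct, so the three progressions are disjoint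
  and the product runs over one set of numbers. In this form it cancels against Euler's
  product.\<close>

lemma triple_prod_eq_upto:
  assumes "0 < i" "2 * i < N"
  shows "eq_upto n (triple_prod i N) (X_prod {j\<in>{1..n}. j mod N \<in> {0, i, N - i}})"
proof -
  let ?A = "progression i N (n + 1)" and ?B = "progression (N - i) N (n + 1)"
    and ?C = "progression N N (n + 1)"
  have modA: "j mod N = i" if "j \<in> ?A" for j using that assms by (auto simp: progression_def)
  have modB: "j mod N = N - i" if "j \<in> ?B" for j
    using that assms by (auto simp: progression_def simp del: Nat.add_diff_assoc2)
  have modC: "j mod N = 0" if "j \<in> ?C" for j using that by (auto simp: progression_def)
  have "eq_upto n (triple_prod i N) (X_prod ?A * X_prod ?B * X_prod ?C)"
    using assms by (intro triple_prod_eq_upto_X_prod) auto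
  also have "\<dots> = X_prod (?A \<union> ?B \<union> ?C)"
  proof -
    have ne: "i \<noteq> N - i" "i \<noteq> 0" "N - i \<noteq> 0" using assms by auto
    have disj: "S \<inter> T = {}" if "\<And>j. j \<in> S \<Longrightarrow> j mod N = a" "\<And>j. j \<in> T \<Longrightarrow> j mod N = b" "a \<noteq> b"
      for S T :: "nat set" and a b
      using that by blast
    have "?A \<inter> ?B = {}" "?A \<inter> ?C = {}" "?B \<inter> ?C = {}"
      by (rule disj[OF modA modB ne(1)] disj[OF modA modC ne(2)] disj[OF modB modC ne(3)]; assumption)+
    then show ?thesis by (simp only: X_prod_Un finite_progression finite_Un Int_Un_distrib2 Un_empty simp_thms)
  qed
  also have "eq_upto n \<dots> (X_prod {j\<in>{1..n}. j mod N \<in> {0, i, N - i}})"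
  proof (rule X_prod_eq_upto)
    have pos: "1 \<le> j" if "j \<in> ?A \<union> ?B \<union> ?C" for j
      using that assms by (auto simp: progression_def)
    have le: "a \<le> n" if "b + N * a \<le> n" for a b
    proof -
      have "a \<le> N * a" using assms by simp
      with that show ?thesis by linarith
    qed
    have in_progression: "j \<in> progression r N (n + 1)" if "j mod N = r" "j \<le> n" for j r
    proof -
      have j: "j = r + N * (j div N)" using that(1) by (metis mod_mult_div_eq)
      then have "j div N \<le> n" using le[of r "j div N"] that(2) by simp
      then show ?thesis unfolding progression_def using j by (intro image_eqI[of _ _ "j div N"]) auto
    qed
    have inC: "j \<in> ?C" if j: "j mod N = 0" "1 \<le> j" "j \<le> n" for j
    proof -
      from j(1) obtain c where c: "j = N * c" by (auto elim: dvdE)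
      with j(2) obtain c' where c': "c = Suc c'" by (cases c) auto
      have "c' \<le> n" using le[of N c'] c c' j(3) by simp
      then show ?thesis unfolding progression_def using c c' by (intro image_eqI[of _ _ c']) auto
    qed
    show "(?A \<union> ?B \<union> ?C) \<inter> {..n} = {j\<in>{1..n}. j mod N \<in> {0, i, N - i}} \<inter> {..n}" (is "?L = ?R")
    proof
      show "?L \<subseteq> ?R"
      proof
        fix j assume j: "j \<in> ?L"
        then have "j mod N \<in> {0, i, N - i}" using modA modB modC by blast
        with j pos[of j] show "j \<in> ?R" by simp
      qed
      show "?R \<subseteq> ?L"
      proof
        fix j assume "j \<in> ?R"
        then have "1 \<le> j" "j \<le> n" "j mod N = 0 \<or> j mod N = i \<or> j mod N = N - i" by auto
        then show "j \<in> ?L" using in_progression[of j i] in_progression[of j "N - i"] inC[of j] by auto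
      qed
    qed
  qed auto
  finally show ?thesis .
qed

text \<open>The residues 0, 1 and 2 modulo 3 exhaust all numbers, so the pentagonal number theorem
  is the case N = 3, i = 1 of the triple product.\<close>

lemma euler_prod_eq_triple_prod: "euler_prod = triple_prod 1 3"
proof -
  have "eq_upto n euler_prod (triple_prod 1 3)" for n
  proof -
    have "{j\<in>{1..n}. j mod 3 \<in> {0, 1, 3 - 1}} = {1..n}" by auto
    then have "eq_upto n (triple_prod 1 3) (X_prod {1..n})"
      using triple_prod_eq_upto[of 1 3 n] by simp
    then show ?thesis
      using euler_prod_eq_upto[of n] eq_upto_sym eq_upto_trans by blast
  qed
  then show ?thesis unfolding fps_eq_iff using eq_uptoD by blast
qed

theorem pentagonal_number_theorem:
  assumes "n < pent K"
  shows "eq_upto n euler_prod (pentagonal_sum K)"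
proof -
  have tail: "eq_upto n (pentagonal_sum M) (pentagonal_sum K)" if "K \<le> M" for M
  proof -
    have "eq_upto n (pentagonal_sum M - pentagonal_sum K) (\<Sum>m=K..<M. 0)"
      unfolding pentagonal_sum_diff[OF that]
    proof (rule eq_upto_sum)
      fix m assume "m \<in> {K..<M}"
      then have "n < pent m" using assms pent_mono[of K m] by simp
      then have "eq_upto n (fps_X ^ pent m * ((- 1) ^ m * (1 - fps_X ^ (2 * m + 1)))) (0 :: rat fps)"
        by (simp add: eq_upto_def fps_X_power_mult_nth)
      then show "eq_upto n ((- 1) ^ m * fps_X ^ pent m * (1 - fps_X ^ (2 * m + 1))) (0 :: rat fps)"
        by (simp only: mult_ac)
    qed
    then show ?thesis by (simp add: eq_upto_def)
  qed
  define M where "M = n + K + 1"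
  have "eq_upto n euler_prod
      (\<Sum>k\<le>2 * M. (- 1) ^ (M + k) * fps_X ^ nat (triple_exp 3 1 (int k - int M)))"
    unfolding euler_prod_eq_triple_prod by (rule jacobi_triple_product) (auto simp: M_def)
  also have "(\<Sum>k\<le>2 * M. (- 1 :: rat fps) ^ (M + k) * fps_X ^ nat (triple_exp 3 1 (int k - int M)))
      = (\<Sum>l\<in>{- int M..int M}. fps_const ((- 1) powi l) * fps_X ^ nat (l * (3*l - 1) div 2))"
  proof (rule sum.reindex_bij_witness[of _ "\<lambda>l. nat (l + int M)" "\<lambda>k. int k - int M"])
    fix k assume "k \<in> {..2 * M}"
    have "triple_exp 3 1 m = m * (3 * m - 1) div 2" for m
    proof -
      have "2 * triple_exp 3 1 m = m * (3 * m - 1)"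
        unfolding two_triple_exp by (simp add: algebra_simps)
      then show ?thesis by simp
    qed
    then show "fps_const ((- 1) powi (int k - int M)) *
        fps_X ^ nat ((int k - int M) * (3 * (int k - int M) - 1) div 2)
      = (- 1 :: rat fps) ^ (M + k) * fps_X ^ nat (triple_exp 3 1 (int k - int M))"
      by (auto simp: minus_one_powi minus_one_power_iff simp flip: fps_const_neg)
  qed auto
  \<comment> \<open>The symmetric range has the additional term l = -M, of exponent
    \<open>pent M\<close> > n.\<close>
  also have "eq_upto n \<dots> (pentagonal_sum M)"
  proof -
    let ?f = "\<lambda>l. fps_const ((- 1) powi l) * fps_X ^ nat (l * (3*l - 1) div 2) :: rat fps"
    have "nat (- int M * (3 * (- int M) - 1) div 2) = pent M"
    proof -
      have "- int M * (3 * (- int M) - 1) = 2 * int (pent M)"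
        using arg_cong[OF two_pent[of M], of int] by (simp add: algebra_simps)
      then show ?thesis by simp
    qed
    moreover have "n < pent M" using pent_ge[of M] by (simp add: M_def)
    ultimately have "eq_upto n (?f (- int M)) 0"
      by (auto simp: eq_upto_def fps_X_power_nth)
    then have "eq_upto n (?f (- int M) + pentagonal_sum M) (0 + pentagonal_sum M)"
      by (intro eq_upto_add) auto
    moreover have "{- int M..int M} = insert (- int M) {- int M<..int M}" by auto
    ultimately show ?thesis by (simp add: pentagonal_sum_def)
  qed
  also have "eq_upto n (pentagonal_sum M) (pentagonal_sum K)"
    by (rule tail) (simp add: M_def)
  finally show ?thesis .
qed

section \<open>The generating functions of D and C, and C as a coefficient of a truncated
  tail\<close>

lemma qpoch_inf_triple: "qpoch_inf [fps_X ^ i, fps_X ^ (N - i), fps_X ^ N] (fps_X ^ N) = triple_prod i N"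
  by (simp add: qpoch_inf_def triple_prod_def X_poch_def mult.assoc)

lemma qpoch_inf_X: "qpoch_inf [fps_X] fps_X = euler_prod"
  by (simp add: qpoch_inf_def euler_prod_def X_poch_def)

definition theta_quotient :: "nat \<Rightarrow> nat \<Rightarrow> rat fps" where
  "theta_quotient i N = triple_prod i N * inverse euler_prod"

lemma D_gf_eq: "D_gf \<tau> d i = theta_quotient i (2 * d + 2 + \<tau>)"
  unfolding D_gf_def qpoch_inf_triple qpoch_inf_X theta_quotient_def
  by (rule fps_divide_unit) simp

lemma C_gf_eq:
  assumes "k \<ge> 1"
  shows "C_gf k i N = (- 1) ^ (k - 1) * (pentagonal_sum k * theta_quotient i N) + (- 1) ^ k * triple_prod i N"
proof -
  have "(1 :: rat fps) / euler_prod = inverse euler_prod"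
    by (simp add: fps_divide_unit)
  moreover have "(- 1 :: rat fps) ^ k = - ((- 1) ^ (k - 1))"
    using assms by (cases k) auto
  ultimately show ?thesis
    unfolding C_gf_def qpoch_inf_triple qpoch_inf_X pentagonal_sum_def[symmetric] theta_quotient_def
    by (simp add: algebra_simps)
qed

lemma fps_nth_minus_one_power_mult: "fps_nth ((- 1) ^ k * f) n = (- 1) ^ k * fps_nth f n"
  for f :: "'a::comm_ring_1 fps"
  by (cases "even k") auto

lemma C_eq_sum_D:
  assumes "k \<ge> 1" "0 < i" "2 * i < 2 * d + 2 + \<tau>"
  shows "C k i (2*d + 2 + \<tau>) n =
    (- 1) ^ (k - 1) * (\<Sum>l\<in>{- int k<..int k}. (- 1) powi l * D \<tau> d i (int n - l * (3*l - 1) div 2))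
    + (- 1) ^ k * (of_bool (int n \<in> P_even (int (2*d + 2 + \<tau>)) (int i))
                   - of_bool (int n \<in> P_odd (int (2*d + 2 + \<tau>)) (int i)))"
proof -
  have "fps_nth (pentagonal_sum k * theta_quotient i (2*d + 2 + \<tau>)) n
      = (\<Sum>l\<in>{- int k<..int k}. (- 1) powi l * D \<tau> d i (int n - l * (3*l - 1) div 2))"
    unfolding pentagonal_sum_def sum_distrib_right fps_sum_nth
  proof (rule sum.cong)
    fix l :: int
    have "0 \<le> l * (3 * l - 1)"
      unfolding zero_le_mult_iff by presburger
    then have "0 \<le> l * (3 * l - 1) div 2" by simp
    then show "fps_nth (fps_const ((- 1) powi l) * fps_X ^ nat (l * (3*l - 1) div 2)
        * theta_quotient i (2*d + 2 + \<tau>)) n = (- 1) powi l * D \<tau> d i (int n - l * (3*l - 1) div 2)"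
      by (auto simp: D_def D_gf_eq mult.assoc fps_X_power_mult_nth nat_diff_distrib')
  qed simp
  then show ?thesis
    unfolding C_def C_gf_eq[OF assms(1)] fps_add_nth fps_nth_minus_one_power_mult
      triple_prod_nth[OF assms(2,3)] by simp
qed

definition truncated_tail :: "nat \<Rightarrow> nat \<Rightarrow> rat fps" where
  "truncated_tail k K = (\<Sum>m=k..<K. (- 1) ^ (m - k) * fps_X ^ pent m * (1 - fps_X ^ (2 * m + 1)))"

text \<open>Writing the subtracted 1 as Euler's product over itself turns the bracket into the part
  of the pentagonal series that the truncation leaves out. The index K only has to be so large that
  its omitted terms lie beyond n.\<close>

lemma C_gf_eq_upto:
  assumes "1 \<le> k" "k \<le> K" "n < pent K"
  shows "eq_upto n (C_gf k i N) (truncated_tail k K * theta_quotient i N)"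
proof -
  have sg: "(- 1 :: rat fps) ^ k = - ((- 1) ^ (k - 1))"
    using assms(1) by (cases k) auto
  have inv: "inverse euler_prod * euler_prod = 1"
    by (rule inverse_mult_eq_1) simp
  have "C_gf k i N = (- 1) ^ k * ((euler_prod - pentagonal_sum k) * theta_quotient i N)"
  proof -
    have "euler_prod * theta_quotient i N = triple_prod i N"
      unfolding theta_quotient_def using inv by (simp add: mult_ac)
    then show ?thesis unfolding C_gf_eq[OF assms(1)] sg by (simp add: algebra_simps)
  qed
  also have "eq_upto n \<dots> ((- 1) ^ k * ((pentagonal_sum K - pentagonal_sum k) * theta_quotient i N))"
    by (intro eq_upto_mult eq_upto_diff pentagonal_number_theorem assms eq_upto_refl)
  also have "(- 1) ^ k * ((pentagonal_sum K - pentagonal_sum k) * theta_quotient i N)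
      = truncated_tail k K * theta_quotient i N"
  proof -
    have "(- 1) ^ k * (pentagonal_sum K - pentagonal_sum k) = truncated_tail k K"
      unfolding truncated_tail_def pentagonal_sum_diff[OF assms(2)] sum_distrib_left
    proof (rule sum.cong)
      fix m assume "m \<in> {k..<K}"
      then have "(- 1 :: rat fps) ^ (m - k) = (- 1) ^ k * (- 1) ^ m"
        by (auto simp: minus_one_power_iff)
      then show "(- 1) ^ k * ((- 1) ^ m * fps_X ^ pent m * (1 - fps_X ^ (2 * m + 1)))
        = (- 1 :: rat fps) ^ (m - k) * fps_X ^ pent m * (1 - fps_X ^ (2 * m + 1))"
        by (simp only: mult.assoc)
    qed simp
    then show ?thesis by (metis mult.assoc)
  qed
  finally show ?thesis .
qed

lemma truncated_tail_mult_nth_eq_0: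
  assumes "n < pent k"
  shows "fps_nth (truncated_tail k K * f) n = 0"
  unfolding truncated_tail_def sum_distrib_right fps_sum_nth
proof (rule sum.neutral, safe)
  fix m assume "m \<in> {k..<K}"
  then have "n < pent m" using assms pent_mono[of k m] by simp
  then have "fps_nth (fps_X ^ pent m * ((- 1) ^ (m - k) * (1 - fps_X ^ (2 * m + 1)) * f)) n = 0"
    by (simp only: fps_X_power_mult_nth) simp
  then show "fps_nth ((- 1) ^ (m - k) * fps_X ^ pent m * (1 - fps_X ^ (2 * m + 1)) * f) n = 0"
    by (simp only: mult_ac)
qed

definition admissible :: "nat \<Rightarrow> nat \<Rightarrow> nat \<Rightarrow> nat set" where
  "admissible N i n = {j\<in>{1..n}. j mod N \<notin> {0, i, N - i}}"

lemma theta_quotient_eq_upto: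
  assumes "0 < i" "2 * i < N"
  shows "eq_upto n (theta_quotient i N) (inverse (X_prod (admissible N i n)))"
proof -
  let ?F = "{j\<in>{1..n}. j mod N \<in> {0, i, N - i}}" and ?A = "admissible N i n"
  have "X_prod {1..n} = X_prod (?F \<union> ?A)"
    by (rule arg_cong[of _ _ X_prod]) (auto simp: admissible_def)
  also have "\<dots> = X_prod ?F * X_prod ?A"
    by (rule X_prod_Un) (auto simp: admissible_def)
  finally have split: "X_prod {1..n} = X_prod ?F * X_prod ?A" .
  have F0: "fps_nth (X_prod ?F) 0 \<noteq> 0" by (subst X_prod_0) auto
  have "eq_upto n (theta_quotient i N) (X_prod ?F * inverse (X_prod {1..n}))"
    unfolding theta_quotient_def
    by (intro eq_upto_mult triple_prod_eq_upto eq_upto_inverse euler_prod_eq_upto assms) auto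
  also have "\<dots> = inverse (X_prod ?A)"
    unfolding split using inverse_mult_eq_1[OF F0]
    by (simp add: fps_inverse_mult flip: mult.assoc) (simp add: mult_ac)
  finally show ?thesis .
qed

lemma C_eq_tail_nth:
  assumes "1 \<le> k" "k \<le> K" "n < pent K" "n \<le> M" "0 < i" "2 * i < N"
  shows "C k i N n = fps_nth (truncated_tail k K * inverse (X_prod (admissible N i M))) n"
proof -
  have "eq_upto n (C_gf k i N) (truncated_tail k K * theta_quotient i N)"
    by (rule C_gf_eq_upto) (use assms in auto)
  also have "eq_upto n \<dots> (truncated_tail k K * inverse (X_prod (admissible N i M)))"
    by (intro eq_upto_mult eq_upto_refl eq_upto_mono[OF theta_quotient_eq_upto] assms)
  finally show ?thesis by (simp add: C_def eq_uptoD)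
qed

lemma C_eq_0:
  assumes "1 \<le> k" "n < pent k"
  shows "C k i N n = 0"
proof -
  have "eq_upto n (C_gf k i N) (truncated_tail k k * theta_quotient i N)"
    using assms by (intro C_gf_eq_upto) auto
  then show ?thesis by (simp add: C_def eq_upto_def truncated_tail_def)
qed

text \<open>The pentagonal sum for k = 1 is 1 - q, so here the theta series is kept explicitly
  instead of being absorbed into a tail.\<close>

lemma C_1_nth:
  assumes "0 < i" "2 * i < N" "n \<le> M"
  shows "C 1 i N n = fps_nth ((1 - fps_X) * inverse (X_prod (admissible N i M))) n
    - (of_bool (int n \<in> P_even (int N) (int i)) - of_bool (int n \<in> P_odd (int N) (int i)))"
proof -
  have 1: "pentagonal_sum 1 = 1 - fps_X"
    using pentagonal_sum_Suc[of 0] by (simp add: pentagonal_sum_def)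
  have "eq_upto n ((1 - fps_X) * theta_quotient i N) ((1 - fps_X) * inverse (X_prod (admissible N i M)))"
    by (intro eq_upto_mult eq_upto_refl eq_upto_mono[OF theta_quotient_eq_upto] assms)
  then show ?thesis
    unfolding C_def C_gf_eq[OF order_refl] 1 using triple_prod_nth[OF assms(1,2), of n]
    by (simp add: eq_uptoD)
qed

section \<open>Alternating sums over nearly quadratic sequences\<close>


lemma two_int_pent: "2 * int (pent m) = 3 * int m * int m + int m"
  using arg_cong[OF two_pent[of m], of int] by (simp add: algebra_simps)

text \<open>Models the numbers of partitions into parts a, b, c, with L = a b c and s = a + b + c.
  The width 388 = 196 + 192 is that of the parts 2, 3, 7, and 956 = 2 * 388 + 180. The condition
  relating s and \<open>\<beta>\<close> is what the estimate of the last term requires at index 8.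
  The value at 1 is left free because 1 need not be a part.\<close>

locale quadratic_seq =
  fixes f :: "int \<Rightarrow> int" and L s lo hi \<beta> :: int
  assumes neg: "z < 0 \<Longrightarrow> f z = 0"
    and lower: "- s < z \<Longrightarrow> lo \<le> 8 * L * f z - (2 * z + s)\<^sup>2"
    and upper: "- s < z \<Longrightarrow> 8 * L * f z - (2 * z + s)\<^sup>2 \<le> hi"
    and L: "0 < L" and s: "6 \<le> s" "s \<le> 14" and lo: "lo \<le> 0" and hi: "0 \<le> hi"
    and \<beta>: "0 \<le> \<beta>" "36 * s \<le> \<beta> + 252" and width: "hi - lo \<le> 388" "2 * (hi - lo) + \<beta> \<le> 956"
    and pos: "0 \<le> z \<Longrightarrow> z \<noteq> 1 \<Longrightarrow> 0 < f z"
begin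

definition pent_diff :: "nat \<Rightarrow> int \<Rightarrow> int" where
  "pent_diff m n = f (n - int (pent m)) - f (n - int (pent m) - (2 * int m + 1))"

primrec alt_sum :: "nat \<Rightarrow> nat \<Rightarrow> int \<Rightarrow> int" where
  "alt_sum 0 k n = 0"
| "alt_sum (Suc c) k n = pent_diff k n - alt_sum c (Suc k) n"

text \<open>The solution of M(m) + M(m + 1) = (2 z + s)^2 - (2 y + s)^2 for z = n -
  \<open>pent m\<close> and y = z - (2 m + 1). Hence the alternating sum of these differences of
  squares telescopes to M(k) and a final term.\<close>

definition main_term :: "nat \<Rightarrow> int \<Rightarrow> int" where
  "main_term k n = 4 * int k * (2 * n + s - 3 * int k * int k + 2)"

lemma pent_diff_error:
  assumes "n - int (pent m) - (2 * int m + 1) > - s"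
  shows "\<bar>8 * L * pent_diff m n - (main_term m n + main_term (Suc m) n)\<bar> \<le> hi - lo"
proof -
  define z where "z = n - int (pent m)"
  define y where "y = z - (2 * int m + 1)"
  have "main_term m n + main_term (Suc m) n = (2 * z + s)\<^sup>2 - (2 * y + s)\<^sup>2"
  proof -
    have n: "2 * n = 2 * z + (3 * int m * int m + int m)"
      using two_int_pent[of m] by (simp add: z_def)
    show ?thesis unfolding main_term_def y_def n by (simp add: algebra_simps power2_eq_square)
  qed
  moreover have "8 * L * pent_diff m n = 8 * L * f z - 8 * L * f y"
    unfolding pent_diff_def y_def z_def by (simp add: right_diff_distrib)
  moreover have "- s < y" "- s < z" using assms by (auto simp: y_def z_def)
  ultimately show ?thesis using lower[of z] upper[of z] lower[of y] upper[of y] by linarith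
qed

text \<open>In the last block the second argument r - (2 K + 1) may be negative. If it is, its value
  is 0 and one square is compared with the main term. If it is not, the approximation holds for both
  arguments, and the next main term is small because n lies close to where it vanishes.\<close>

lemma last_error:
  assumes "8 \<le> K" "int (pent K) \<le> n" "n < int (pent (Suc K))"
  shows "\<bar>8 * L * pent_diff K n - main_term K n\<bar> \<le> 8 * int K * int K + 8 * int K + \<beta> + (hi - lo)"
proof -
  define k where "k = int K"
  define r where "r = n - int (pent K)"
  define x where "x = 2 * r + s"
  have k: "8 \<le> k" using assms(1) by (simp add: k_def)
  have r: "0 \<le> r" "r \<le> 3 * k + 1" using assms by (auto simp: r_def k_def pent_Suc)
  have n: "2 * n = 2 * r + (3 * k * k + k)"
    using two_int_pent[of K] by (simp add: r_def k_def)
  have sq: "8 * k \<le> k * k" using k by (intro mult_right_mono) auto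
  show ?thesis
  proof (cases "r \<le> 2 * k")
    case True
    have "8 * L * pent_diff K n = 8 * L * f r"
      unfolding pent_diff_def r_def[symmetric] k_def[symmetric] using True by (simp add: neg)
    moreover have "lo \<le> 8 * L * f r - x\<^sup>2" "8 * L * f r - x\<^sup>2 \<le> hi"
      unfolding x_def using lower[of r] upper[of r] r s by auto
    moreover have "main_term K n = 4 * k * (x + k + 2)"
      unfolding main_term_def k_def[symmetric] n x_def by (simp add: algebra_simps)
    moreover have "x\<^sup>2 - 4 * k * (x + k + 2) \<ge> - (8 * k * k + 8 * k)"
    proof -
      have "0 \<le> (x - 2 * k)\<^sup>2" by simp
      then show ?thesis by (simp add: algebra_simps power2_eq_square)
    qed
    moreover have "x\<^sup>2 - 4 * k * (x + k + 2) \<le> 8 * k * k + 8 * k"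
    proof -
      have x: "s \<le> x" "x \<le> 4 * k + s" using r True by (auto simp: x_def)
      have "(x - s) * (x - (4 * k + s)) \<le> 0" using x by (intro mult_nonneg_nonpos) auto
      then have "x\<^sup>2 - 4 * k * x \<le> 2 * (s * x) - s * (4 * k + s)"
        by (simp add: algebra_simps power2_eq_square)
      also have "s * x \<le> s * (4 * k + s)" using x s by (intro mult_left_mono) auto
      finally have "x\<^sup>2 - 4 * k * x \<le> s * (4 * k + s)" by simp
      also have "\<dots> \<le> 14 * (4 * k + 14)" using s k by (intro mult_mono) auto
      finally have x2: "x\<^sup>2 \<le> 4 * k * x + (56 * k + 196)" by simp
      have eq: "4 * k * (x + k + 2) = 4 * k * x + (4 * (k * k) + 8 * k)"
        by (simp add: algebra_simps)
      have "x\<^sup>2 - 4 * k * (x + k + 2) \<le> 8 * (k * k) + 8 * k"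
        unfolding eq using sq x2 k by linarith
      then show ?thesis by (simp only: mult.assoc)
    qed
    ultimately show ?thesis
      using \<beta> lo hi unfolding k_def[symmetric] by linarith
  next
    case False
    define y where "y = 2 * r - 5 * k - 1 + s"
    have "\<bar>8 * L * pent_diff K n - (main_term K n + main_term (Suc K) n)\<bar> \<le> hi - lo"
      by (rule pent_diff_error) (use False s in \<open>auto simp: r_def k_def\<close>)
    moreover have "main_term (Suc K) n = 4 * (k + 1) * y"
      unfolding main_term_def n y_def k_def by (simp add: algebra_simps n[unfolded k_def])
    moreover have "\<bar>4 * (k + 1) * y\<bar> \<le> 8 * k * k + 8 * k + \<beta>"
    proof -
      have "\<bar>y\<bar> \<le> k + 1 + s" using r False s k by (auto simp: y_def)
      then have "4 * (k + 1) * \<bar>y\<bar> \<le> 4 * (k + 1) * (k + 1 + s)" using k by (intro mult_left_mono) auto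
      \<comment> \<open>Four times this inequality bounds 4 s k by 4 k^2 + 32 s - 256; what remains
        to be shown is 36 s <= \<open>\<beta>\<close> + 252.\<close>
      moreover have "0 \<le> (k - 8) * (k + 8 - s)" using k s by (intro mult_nonneg_nonneg) auto
      ultimately have "4 * (k + 1) * \<bar>y\<bar> \<le> 8 * k * k + 8 * k + \<beta>"
        using \<beta> by (simp add: algebra_simps)
      then show ?thesis using k by (simp add: abs_mult)
    qed
    ultimately show ?thesis unfolding k_def[symmetric] by linarith
  qed
qed

text \<open>Each step passes from the main term at k to the one at k + 1 with opposite sign, at the
  price of one width \<open>hi - lo\<close>.\<close>

lemma alt_sum_error:
  assumes "8 \<le> k + c" "int (pent (k + c)) \<le> n" "n < int (pent (Suc (k + c)))"
  shows "\<bar>8 * L * alt_sum (Suc c) k n - main_term k n\<bar>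
    \<le> 8 * int (k + c) * int (k + c) + 8 * int (k + c) + \<beta> + (hi - lo) * (int c + 1)"
  using assms
proof (induction c arbitrary: k)
  case 0
  then show ?case using last_error[of k n] by simp
next
  case (Suc c)
  have "pent (Suc k) \<le> pent (k + Suc c)" by (rule pent_mono) simp
  then have "n - int (pent k) - (2 * int k + 1) > - s"
    using Suc.prems(2) s by (simp add: pent_Suc)
  then have "\<bar>8 * L * pent_diff k n - (main_term k n + main_term (Suc k) n)\<bar> \<le> hi - lo"
    by (rule pent_diff_error)
  moreover have "\<bar>8 * L * alt_sum (Suc c) (Suc k) n - main_term (Suc k) n\<bar>
    \<le> 8 * int (k + Suc c) * int (k + Suc c) + 8 * int (k + Suc c) + \<beta> + (hi - lo) * (int c + 1)"
    using Suc.IH[of "Suc k"] Suc.prems by simp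
  moreover have "8 * L * alt_sum (Suc (Suc c)) k n = 8 * L * pent_diff k n - 8 * L * alt_sum (Suc c) (Suc k) n"
    by (simp only: alt_sum.simps(2)[of "Suc c"] right_diff_distrib)
  moreover have "(hi - lo) * (int (Suc c) + 1) = (hi - lo) * (int c + 1) + (hi - lo)"
    by (simp add: algebra_simps)
  ultimately show ?case by linarith
qed

text \<open>The thresholds \<open>24, 13, 9, 8, 8\<close> solve the inequality for \<open>k = 2, \<dots>, 6\<close>.\<close>

lemma main_term_dominates:
  fixes k K :: int
  assumes "k + 1 \<le> K"
    and "7 \<le> k \<or> (k, K - 24) \<in> {2} \<times> {0..} \<or> (k, K - 13) \<in> {3} \<times> {0..}
      \<or> (k, K - 9) \<in> {4} \<times> {0..} \<or> (k, K - 8) \<in> {5, 6} \<times> {0..}"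
  shows "8 * K * K + 8 * K + 956 + 388 * (K - k - 1) < 4 * k * (3 * K * K + K + 8 - 3 * k * k)"
proof -
  \<comment> \<open>For fixed k the difference of the two sides is a quadratic polynomial in u = K -
    K0. The conditions make its value, linear coefficient and leading coefficient at K0 nonnegative,
    the value strictly positive.\<close>
  have *: ?thesis if "k = k0" "K0 \<le> K" "8 * (2 * K0 + 1) + 396 < 4 * k0 * (6 * K0 + 1)" "2 \<le> k0"
    "8 * K0 * K0 + 8 * K0 + 956 + 388 * (K0 - k0 - 1) < 4 * k0 * (3 * K0 * K0 + K0 + 8 - 3 * k0 * k0)"
    for k0 K0
  proof -
    define u where "u = K - K0"
    have u: "0 \<le> u" "K = K0 + u" using that by (auto simp: u_def)
    have "0 \<le> u * (4 * k0 * (6 * K0 + 1) - (8 * (2 * K0 + 1) + 396))"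
      by (rule mult_nonneg_nonneg[OF u(1)]) (use that(3) in simp)
    moreover have "0 \<le> (u * u) * (12 * k0 - 8)"
      by (rule mult_nonneg_nonneg) (use u that(4) in simp_all)
    ultimately show ?thesis using that(5) u(1) unfolding u(2) that(1) by (simp add: algebra_simps)
  qed
  show ?thesis
  proof (cases "7 \<le> k")
    case True
    \<comment> \<open>After the shift to the corner k = 7, K = 8 all coefficients of the difference
      of the two sides are nonnegative, with constant term 176.\<close>
    define v where "v = k - 7"
    define t where "t = K - k - 1"
    have vt: "0 \<le> v" "0 \<le> t" "k = 7 + v" "K = 8 + v + t" using True assms(1) by (auto simp: v_def t_def)
    have "0 < 176 + 20 * v * v + 12 * v * t * t + 76 * t * t + 24 * v * v * t + 304 * v + 848 * t + 348 * v * t"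
      using vt(1,2) by (intro add_pos_nonneg mult_nonneg_nonneg) simp_all
    then show ?thesis unfolding vt(3,4) by (simp add: algebra_simps)
  next
    case False
    with assms(2) consider "k = 2" "24 \<le> K" | "k = 3" "13 \<le> K" | "k = 4" "9 \<le> K"
      | "k = 5" "8 \<le> K" | "k = 6" "8 \<le> K" by auto
    then show ?thesis
    proof cases
      case 1
      then show ?thesis by (intro *[of 2 24]) auto
    next
      case 2
      then show ?thesis by (intro *[of 3 13]) auto
    next
      case 3
      then show ?thesis by (intro *[of 4 9]) auto
    next
      case 4
      then show ?thesis by (intro *[of 5 8]) auto
    next
      case 5
      then show ?thesis by (intro *[of 6 8]) auto
    qed
  qed
qed

lemma alt_sum_pos_far:
  assumes "1 \<le> c" "int (pent (k + c)) \<le> n" "n < int (pent (Suc (k + c)))"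
    and "7 \<le> k \<or> k = 2 \<and> 24 \<le> k + c \<or> k = 3 \<and> 13 \<le> k + c \<or> k = 4 \<and> 9 \<le> k + c
      \<or> k \<in> {5, 6} \<and> 8 \<le> k + c"
  shows "0 < alt_sum (Suc c) k n"
proof -
  define K where "K = int (k + c)"
  have "8 * K * K + 8 * K + 956 + 388 * (K - int k - 1)
      < 4 * int k * (3 * K * K + K + 8 - 3 * int k * int k)"
    by (rule main_term_dominates) (use assms in \<open>auto simp: K_def\<close>)
  \<comment> \<open>The 8 is 2 plus the least value 6 of s, and 2 n >= 3 K^2 + K.\<close>
  also have "\<dots> \<le> main_term k n"
    unfolding main_term_def
    using assms(2) s two_int_pent[of "k + c"] by (intro mult_left_mono) (auto simp: K_def)
  finally have "8 * K * K + 8 * K + 956 + 388 * (int c - 1) < main_term k n"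
    by (simp add: K_def)
  moreover have "(hi - lo) * (int c - 1) \<le> 388 * (int c - 1)"
    using width assms(1) by (intro mult_right_mono) auto
  moreover have "(hi - lo) * (int c + 1) = (hi - lo) * (int c - 1) + 2 * (hi - lo)"
    by (simp add: algebra_simps)
  moreover have "8 \<le> k + c" using assms by auto
  note alt_sum_error[OF this assms(2,3), folded K_def]
  ultimately have "0 < 8 * L * alt_sum (Suc c) k n" using width by linarith
  then show ?thesis using L by (simp add: zero_less_mult_iff)
qed

text \<open>Only one pentagonal block is present. As long as the subtracted value vanishes,
  positivity is that of f itself, which may fail at 1. Afterwards the squares differ by at least 30
  * 30, where 30 = 4 * 7 + 2, and this exceeds the width 388.\<close>

lemma alt_sum_pos_near:
  assumes "7 \<le> k" "int (pent k) \<le> n" "n < int (pent (Suc k))" "n \<noteq> int (pent k) + 1"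
  shows "0 < alt_sum 1 k n"
proof -
  define r where "r = n - int (pent k)"
  have r: "0 \<le> r" "r \<noteq> 1" using assms by (auto simp: r_def)
  have eq: "alt_sum 1 k n = f r - f (r - (2 * int k + 1))"
    by (simp add: pent_diff_def r_def)
  show ?thesis
  proof (cases "r \<le> 2 * int k")
    case True
    then show ?thesis using pos[OF r] unfolding eq by (simp add: neg)
  next
    case False
    define y where "y = r - (2 * int k + 1)"
    have y: "0 \<le> y" using False by (simp add: y_def)
    have "(2 * r + s)\<^sup>2 - (2 * y + s)\<^sup>2 = (4 * int k + 2) * (4 * y + (4 * int k + 2) + 2 * s)"
      unfolding y_def by (simp add: algebra_simps power2_eq_square)
    moreover have "(4 * int k + 2) * (4 * y + (4 * int k + 2) + 2 * s) \<ge> 30 * 30"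
      using assms(1) y s by (intro mult_mono) auto
    moreover have "8 * L * (f r - f y) = 8 * L * f r - 8 * L * f y"
      by (simp add: right_diff_distrib)
    ultimately have "0 < 8 * L * (f r - f y)"
      using lower[of r] upper[of y] r y s width by linarith
    then show ?thesis using L unfolding eq y_def by (simp add: zero_less_mult_iff)
  qed
qed

lemma alt_sum_add:
  assumes "n < int (pent (k + c))"
  shows "alt_sum (c + d) k n = alt_sum c k n"
  using assms
proof (induction c arbitrary: k)
  case 0
  then show ?case
  proof (induction d arbitrary: k)
    case (Suc d)
    have "pent_diff k n = 0" using Suc.prems unfolding pent_diff_def by (simp add: neg)
    moreover have "alt_sum (0 + d) (Suc k) n = alt_sum 0 (Suc k) n"
      by (rule Suc.IH) (use Suc.prems in \<open>simp add: pent_Suc\<close>)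
    ultimately show ?case by simp
  qed simp
next
  case (Suc c)
  then show ?case using Suc.IH[of "Suc k"] by simp
qed

theorem alt_sum_pos:
  assumes "int (pent k) \<le> n" "n < int (pent (k + c))"
    and "7 \<le> k \<and> n \<noteq> int (pent k) + 1 \<or> k = 2 \<and> int (pent 24) \<le> n \<or> k = 3 \<and> int (pent 13) \<le> n
      \<or> k = 4 \<and> int (pent 9) \<le> n \<or> k \<in> {5, 6} \<and> int (pent 8) \<le> n"
  shows "0 < alt_sum c k n"
proof -
  \<comment> \<open>The last index whose pentagonal number does not exceed n; all later blocks
    vanish.\<close>
  define K where "K = (LEAST K. n < int (pent (Suc K)))"
  have ex: "n < int (pent (Suc (k + c)))" using assms(2) by (simp add: pent_Suc)
  have K1: "n < int (pent (Suc K))"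
    unfolding K_def using ex by (rule LeastI)
  have K2: "m \<le> K" if "int (pent m) \<le> n" for m
  proof (rule ccontr)
    assume "\<not> m \<le> K"
    then have "pent (Suc K) \<le> pent m" by (intro pent_mono) simp
    with K1 that show False by linarith
  qed
  have "k \<le> K" by (rule K2[OF assms(1)])
  have K3: "int (pent K) \<le> n"
  proof (cases K)
    case 0
    then show ?thesis using assms(1) by simp
  next
    case (Suc K')
    then show ?thesis unfolding K_def using not_less_Least[of K' "\<lambda>K. n < int (pent (Suc K))"]
      by (metis K_def lessI not_less)
  qed
  have "K < k + c"
  proof (rule ccontr)
    assume "\<not> K < k + c"
    then have "pent (k + c) \<le> pent K" by (intro pent_mono) simp
    with K3 assms(2) show False by linarith
  qed
  define b where "b = K - k"
  have b: "K = k + b" using \<open>k \<le> K\<close> by (simp add: b_def)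
  have "alt_sum c k n = alt_sum (Suc b) k n"
  proof -
    have "alt_sum (Suc b + (c - Suc b)) k n = alt_sum (Suc b) k n"
      using K1 by (intro alt_sum_add) (simp add: b)
    then show ?thesis using \<open>K < k + c\<close> b by simp
  qed
  also have "\<dots> > 0"
  proof (cases "b = 0")
    case True
    with b assms(3) K2[of 24] K2[of 13] K2[of 9] K2[of 8] have "7 \<le> k" "n \<noteq> int (pent k) + 1" by auto
    then show ?thesis using alt_sum_pos_near[of k n] True K1 assms(1) b by simp
  next
    case False
    then show ?thesis
      by (intro alt_sum_pos_far) (use K1 K3 b assms(3) K2 in auto)
  qed
  finally show ?thesis .
qed

end

section \<open>Computing coefficients\<close>


definition ext :: "(nat \<Rightarrow> int) \<Rightarrow> int \<Rightarrow> int" where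
  "ext h z = (if z < 0 then 0 else h (nat z))"

text \<open>Coefficients of the quotient by 1 - q^a. The test 0 < a is what makes the recursion
  terminate.\<close>

fun div_seq :: "nat \<Rightarrow> (nat \<Rightarrow> int) \<Rightarrow> nat \<Rightarrow> int" where
  "div_seq a s n = s n + (if 0 < a \<and> a \<le> n then div_seq a s (n - a) else 0)"

declare div_seq.simps [simp del]

definition fps_of_seq :: "(nat \<Rightarrow> int) \<Rightarrow> rat fps" where
  "fps_of_seq s = Abs_fps (\<lambda>n. of_int (s n))"

lemma fps_of_seq_nth [simp]: "fps_nth (fps_of_seq s) n = of_int (s n)"
  by (simp add: fps_of_seq_def)

lemma fps_of_seq_div_seq:
  assumes "0 < a"
  shows "fps_of_seq (div_seq a s) = fps_of_seq s * inverse (1 - fps_X ^ a)"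
proof -
  have "fps_of_seq (div_seq a s) * (1 - fps_X ^ a) = fps_of_seq s"
  proof (rule fps_ext)
    fix n
    have "fps_nth (fps_of_seq (div_seq a s) * (1 - fps_X ^ a)) n
        = of_int (div_seq a s n) - (if n < a then 0 else of_int (div_seq a s (n - a)))"
      by (simp add: right_diff_distrib fps_X_power_mult_right_nth)
    also have "\<dots> = of_int (s n)"
      using assms by (subst (1) div_seq.simps) auto
    finally show "fps_nth (fps_of_seq (div_seq a s) * (1 - fps_X ^ a)) n = fps_nth (fps_of_seq s) n"
      by simp
  qed
  then have "fps_of_seq s * inverse (1 - fps_X ^ a)
      = fps_of_seq (div_seq a s) * ((1 - fps_X ^ a) * inverse (1 - fps_X ^ a))"
    by (simp only: mult.assoc[symmetric])
  also have "(1 - fps_X ^ a) * inverse (1 - fps_X ^ a) = (1 :: rat fps)"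
    by (rule inverse_mult_eq_1') (use assms in \<open>simp add: fps_X_power_nth\<close>)
  finally show ?thesis by simp
qed

definition part_seq :: "nat list \<Rightarrow> (nat \<Rightarrow> int) \<Rightarrow> nat \<Rightarrow> int" where
  "part_seq as s = foldr div_seq as s"

lemma part_seq_simps [simp]:
  "part_seq [] s = s" "part_seq (a # as) s = div_seq a (part_seq as s)"
  by (simp_all add: part_seq_def)

lemma fps_of_part_seq:
  assumes "distinct as" "0 \<notin> set as"
  shows "fps_of_seq (part_seq as s) = fps_of_seq s * inverse (X_prod (set as))"
  using assms
proof (induction as)
  case Nil
  then show ?case by (simp add: X_prod_def)
next
  case (Cons a as)
  have "inverse (X_prod (set (a # as))) = inverse (X_prod (set as)) * inverse (1 - fps_X ^ a)"
    using Cons.prems by (simp add: X_prod_def fps_inverse_mult mult.commute)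
  then show ?case using Cons by (simp add: fps_of_seq_div_seq mult.assoc)
qed

definition delta :: "nat \<Rightarrow> int" where
  "delta n = of_bool (n = 0)"

lemma fps_of_delta [simp]: "fps_of_seq delta = 1"
  by (rule fps_ext) (simp add: delta_def)

abbreviation parts :: "nat list \<Rightarrow> nat \<Rightarrow> int" where
  "parts as \<equiv> part_seq as delta"

lemma ext_div_seq:
  assumes "0 < a"
  shows "ext (div_seq a s) z = ext s z + ext (div_seq a s) (z - int a)"
proof (cases "z < 0")
  case False
  then show ?thesis
    using assms unfolding ext_def
    by (subst (1) div_seq.simps) (auto simp: nat_diff_distrib' zle_int nat_le_iff)
qed (simp add: ext_def)

lemma truncated_tail_Suc:
  "truncated_tail k (k + Suc c)
    = fps_X ^ pent k * (1 - fps_X ^ (2 * k + 1)) - truncated_tail (Suc k) (Suc k + c)"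
proof -
  have "truncated_tail k (k + Suc c) = fps_X ^ pent k * (1 - fps_X ^ (2 * k + 1))
     + (\<Sum>m=Suc k..<k + Suc c. (- 1) ^ (m - k) * fps_X ^ pent m * (1 - fps_X ^ (2 * m + 1)))"
    unfolding truncated_tail_def by (subst sum.atLeast_Suc_lessThan) auto
  also have "(\<Sum>m=Suc k..<k + Suc c. (- 1) ^ (m - k) * fps_X ^ pent m * (1 - fps_X ^ (2 * m + 1)))
     = (\<Sum>m=Suc k..<Suc k + c. - ((- 1) ^ (m - Suc k) * fps_X ^ pent m * (1 - fps_X ^ (2 * m + 1))) :: rat fps)"
  proof (rule sum.cong)
    fix m assume "m \<in> {Suc k..<Suc k + c}"
    then have "m - k = Suc (m - Suc k)" by auto
    then show "(- 1) ^ (m - k) * fps_X ^ pent m * (1 - fps_X ^ (2 * m + 1))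
      = - ((- 1) ^ (m - Suc k) * fps_X ^ pent m * (1 - fps_X ^ (2 * m + 1)) :: rat fps)" by simp
  qed simp
  finally show ?thesis by (simp add: truncated_tail_def sum_negf)
qed

lemma X_power_mult_fps_of_seq_nth:
  "fps_nth (fps_X ^ e * fps_of_seq h) n = of_int (ext h (int n - int e))"
  by (simp add: fps_X_power_mult_nth ext_def nat_diff_distrib')

lemma (in quadratic_seq) truncated_tail_mult_nth:
  assumes "f = ext h"
  shows "fps_nth (truncated_tail k (k + c) * fps_of_seq h) n = of_int (alt_sum c k (int n))"
proof (induction c arbitrary: k)
  case 0
  then show ?case by (simp add: truncated_tail_def)
next
  case (Suc c)
  have "truncated_tail k (k + Suc c) * fps_of_seq h
     = fps_X ^ pent k * fps_of_seq h - fps_X ^ (pent k + (2 * k + 1)) * fps_of_seq h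
       - truncated_tail (Suc k) (Suc k + c) * fps_of_seq h"
    unfolding truncated_tail_Suc power_add by (simp add: algebra_simps)
  then have "fps_nth (truncated_tail k (k + Suc c) * fps_of_seq h) n
     = of_int (ext h (int n - int (pent k))) - of_int (ext h (int n - int (pent k + (2 * k + 1))))
       - fps_nth (truncated_tail (Suc k) (Suc k + c) * fps_of_seq h) n"
    by (simp only: fps_sub_nth X_power_mult_fps_of_seq_nth)
  then show ?case
    unfolding Suc.IH assms[symmetric] by (simp add: pent_diff_def algebra_simps)
qed

section \<open>Evaluation of such quotients on coefficient lists\<close>

text \<open>The queue holds the last \<open>a\<close> values of the output.\<close>

fun div_list :: "int list \<Rightarrow> int list \<Rightarrow> int list" where
  "div_list (y # q) (x # xs) = (x + y) # div_list (q @ [x + y]) xs"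
| "div_list q xs = []"

text \<open>The invariant for the induction: entry j of the queue is the output at n - a + j. Since
  \<open>ext\<close> is 0 at negative arguments, the initial queue of zeros satisfies it at n =
  0.\<close>

lemma div_list_queue:
  assumes "0 < a" "length q = a" "\<And>j. j < a \<Longrightarrow> q ! j = ext (div_seq a s) (int n - int a + int j)"
  shows "div_list q (map s [n..<n + M]) = map (div_seq a s) [n..<n + M]"
  using assms(2-)
proof (induction M arbitrary: q n)
  case 0
  then show ?case by (cases q) auto
next
  case (Suc M)
  from Suc.prems(1) assms(1) obtain y q' where q: "q = y # q'" by (cases q) auto
  have "y = ext (div_seq a s) (int n - int a)"
    using Suc.prems(2)[of 0] assms(1) q by simp
  then have y: "s n + y = div_seq a s n"
    using ext_div_seq[OF assms(1), of s "int n"] by (simp add: ext_def)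
  have "div_list (q' @ [div_seq a s n]) (map s [Suc n..<Suc n + M]) = map (div_seq a s) [Suc n..<Suc n + M]"
  proof (rule Suc.IH)
    show "length (q' @ [div_seq a s n]) = a" using Suc.prems(1) q by simp
    fix j assume j: "j < a"
    show "(q' @ [div_seq a s n]) ! j = ext (div_seq a s) (int (Suc n) - int a + int j)"
    proof (cases "Suc j < a")
      case True
      then have "(q' @ [div_seq a s n]) ! j = q ! Suc j"
        using Suc.prems(1) q by (simp add: nth_append)
      then show ?thesis using Suc.prems(2)[OF True] by (simp add: algebra_simps)
    next
      case False
      then have "a = Suc j" using j by simp
      then show ?thesis using Suc.prems(1) q by (simp add: nth_append ext_def)
    qed
  qed
  moreover have "[n..<n + Suc M] = n # [Suc n..<Suc n + M]"
    by (simp add: upt_rec)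
  ultimately show ?case by (simp add: q y)
qed

definition part_list :: "nat list \<Rightarrow> int list \<Rightarrow> int list" where
  "part_list as xs = foldr (\<lambda>a. div_list (replicate a 0)) as xs"

lemma part_list_eq:
  assumes "0 \<notin> set as"
  shows "part_list as (map s [0..<M]) = map (part_seq as s) [0..<M]"
  using assms
proof (induction as)
  case (Cons a as)
  have "div_list (replicate a 0) (map (part_seq as s) [0..<0 + M]) = map (div_seq a (part_seq as s)) [0..<0 + M]"
    by (rule div_list_queue) (use Cons.prems in \<open>auto simp: ext_def\<close>)
  with Cons show ?case by (simp add: part_list_def part_seq_def)
qed (simp add: part_list_def)

lemma delta_list: "1 # replicate M 0 = map delta [0..<Suc M]"
  by (rule nth_equalityI) (auto simp: delta_def nth_Cons' simp del: upt_Suc)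

text \<open>One block lists the coefficients from q^(pent m) up to just before q^(pent (m + 1)): the
  two signs stand 2 m + 1 apart, and the block has length 3 m + 2.\<close>

fun tail_blocks :: "int \<Rightarrow> nat \<Rightarrow> nat \<Rightarrow> int list" where
  "tail_blocks e m 0 = []"
| "tail_blocks e m (Suc c)
    = e # replicate (2 * m) 0 @ (- e) # replicate m 0 @ tail_blocks (- e) (Suc m) c"

definition tail_list :: "nat \<Rightarrow> nat \<Rightarrow> int list" where
  "tail_list k c = replicate (pent k) 0 @ tail_blocks 1 k c"

definition list_seq :: "int list \<Rightarrow> nat \<Rightarrow> int" where
  "list_seq xs n = (if n < length xs then xs ! n else 0)"

lemma map_list_seq: "map (list_seq xs) [0..<length xs] = xs"
  by (rule nth_equalityI) (auto simp: list_seq_def)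

lemma fps_of_list_seq_append:
  "fps_of_seq (list_seq (xs @ ys)) = fps_of_seq (list_seq xs) + fps_X ^ length xs * fps_of_seq (list_seq ys)"
  by (rule fps_ext) (auto simp: list_seq_def nth_append fps_X_power_mult_nth)

lemma fps_of_list_seq_Cons:
  "fps_of_seq (list_seq (x # xs)) = fps_const (of_int x) + fps_X * fps_of_seq (list_seq xs)"
  by (rule fps_ext) (auto simp: list_seq_def nth_Cons')

lemma fps_of_list_seq_replicate [simp]: "fps_of_seq (list_seq (replicate m 0)) = 0"
  by (rule fps_ext) (auto simp: list_seq_def)

lemma fps_of_tail_blocks:
  "fps_X ^ pent m * fps_of_seq (list_seq (tail_blocks e m c))
    = fps_const (of_int e) * truncated_tail m (m + c)"
proof (induction c arbitrary: e m)
  case 0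
  have "fps_of_seq (list_seq []) = 0" by (rule fps_ext) (simp add: list_seq_def)
  then show ?case by (simp add: truncated_tail_def)
next
  case (Suc c)
  let ?E = "fps_const (of_int e) :: rat fps" and ?G = "fps_of_seq (list_seq (tail_blocks (- e) (Suc m) c))"
  have IH: "fps_X ^ pent (Suc m) * ?G = - (?E * truncated_tail (Suc m) (Suc m + c))"
    unfolding Suc.IH by (simp flip: fps_const_neg)
  have "fps_of_seq (list_seq (tail_blocks e m (Suc c)))
      = ?E + fps_X * (fps_X ^ (2 * m) * (- ?E + fps_X * (fps_X ^ m * ?G)))"
    by (simp add: fps_of_list_seq_append fps_of_list_seq_Cons flip: fps_const_neg)
  also have "\<dots> = ?E * (1 - fps_X ^ (2 * m + 1)) + fps_X ^ (3 * m + 2) * ?G"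
  proof -
    have "3 * m + 2 = Suc (2 * m + Suc m)" by simp
    then have "(fps_X :: rat fps) ^ (3 * m + 2) = fps_X * (fps_X ^ (2 * m) * (fps_X * fps_X ^ m))"
      by (simp only: power_Suc power_add)
    then show ?thesis by (simp add: algebra_simps flip: fps_const_neg)
  qed
  finally have blocks: "fps_of_seq (list_seq (tail_blocks e m (Suc c)))
      = ?E * (1 - fps_X ^ (2 * m + 1)) + fps_X ^ (3 * m + 2) * ?G" .
  have "fps_X ^ pent m * fps_of_seq (list_seq (tail_blocks e m (Suc c)))
      = ?E * (fps_X ^ pent m * (1 - fps_X ^ (2 * m + 1))) + fps_X ^ pent (Suc m) * ?G"
    unfolding blocks by (simp add: pent_Suc power_add algebra_simps)
  then show ?case unfolding IH truncated_tail_Suc by (simp add: right_diff_distrib)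
qed

lemma fps_of_tail_list: "fps_of_seq (list_seq (tail_list k c)) = truncated_tail k (k + c)"
  unfolding tail_list_def fps_of_list_seq_append using fps_of_tail_blocks[of k 1 c] by simp

lemma length_tail_blocks: "pent m + length (tail_blocks e m c) = pent (m + c)"
proof (induction c arbitrary: e m)
  case (Suc c)
  have "pent (Suc m) + length (tail_blocks (- e) (Suc m) c) = pent (Suc m + c)" by (rule Suc.IH)
  then show ?case by (simp add: pent_Suc)
qed simp

lemma length_tail_list [simp]: "length (tail_list k c) = pent (k + c)"
  by (simp add: tail_list_def length_tail_blocks)

lemma tail_parts_nth:
  assumes "distinct as" "0 \<notin> set as" "n < pent (k + c)"
  shows "fps_nth (truncated_tail k (k + c) * inverse (X_prod (set as))) n
    = of_int (part_list as (tail_list k c) ! n)"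
proof -
  have "part_list as (tail_list k c) = map (part_seq as (list_seq (tail_list k c))) [0..<pent (k + c)]"
    using part_list_eq[OF assms(2), of "list_seq (tail_list k c)" "pent (k + c)"]
      map_list_seq[of "tail_list k c"] by simp
  then have "part_list as (tail_list k c) ! n = part_seq as (list_seq (tail_list k c)) n"
    using assms(3) by simp
  then show ?thesis
    unfolding fps_of_tail_list[symmetric] fps_of_part_seq[OF assms(1,2), symmetric] by simp
qed

section \<open>Partitions into three pairwise coprime parts\<close>


lemma parts_list: "0 \<notin> set as \<Longrightarrow> part_list as (1 # replicate M 0) = map (parts as) [0..<Suc M]"
  unfolding delta_list by (rule part_list_eq)

text \<open>The recurrence is the expanded product (1 - q^a)(1 - q^b)(1 - q^c). Extension by 0 makes
  it valid at every integer, with the indicator of z = 0 as its only inhomogeneity.\<close>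

lemma ext_parts_three:
  assumes "0 < a" "0 < b" "0 < c"
  defines "p \<equiv> ext (parts [a, b, c])"
  shows "p z = p (z - int a) + p (z - int b) + p (z - int c) - p (z - int a - int b)
    - p (z - int a - int c) - p (z - int b - int c) + p (z - int a - int b - int c) + of_bool (z = 0)"
proof -
  define q r where "q = ext (parts [b, c])" and "r = ext (parts [c])"
  have p: "p z - p (z - int a) = q z" for z
    using ext_div_seq[OF assms(1), of "parts [b, c]" z] by (simp add: p_def q_def)
  have q: "q z - q (z - int b) = r z" for z
    using ext_div_seq[OF assms(2), of "parts [c]" z] by (simp add: q_def r_def)
  have r: "r z - r (z - int c) = of_bool (z = 0)"
    using ext_div_seq[OF assms(3), of delta z] by (auto simp: r_def ext_def delta_def)
  have comm: "z - int c - int a = z - int a - int c" "z - int c - int b = z - int b - int c"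
    "z - int b - int a = z - int a - int b" "z - int c - int b - int a = z - int a - int b - int c"
    "z - int b - int c - int a = z - int a - int b - int c"
    by simp_all
  show ?thesis
    using p[of z] p[of "z - int b"] p[of "z - int c"] p[of "z - int c - int b"]
      q[of z] q[of "z - int c"] r unfolding comm by linarith
qed

text \<open>The defect of \<open>parts [a, b, c]\<close> from being a quadratic polynomial is annihilated by the
  recurrence of \<open>parts [a, b, c]\<close>, so its periodicity has to be checked on \<open>a + b + c\<close>
  consecutive arguments only.\<close>

lemma parts_three_quasi_periodic:
  fixes a b c :: nat
  defines "p \<equiv> ext (parts [a, b, c])" and "s \<equiv> int (a + b + c)" and "L \<equiv> int (a * b * c)"
  assumes "0 < a" "0 < b" "0 < c"
    and base: "\<And>z. - s < z \<Longrightarrow> z \<le> 0 \<Longrightarrow> 2 * (p (z + L) - p z) = 2 * z + s + L"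
    and "- s < z"
  shows "2 * (p (z + L) - p z) = 2 * z + s + L"
  using assms(8)
proof (induction "nat (z + s)" arbitrary: z rule: less_induct)
  case less
  show ?case
  proof (cases "z \<le> 0")
    case True
    then show ?thesis using base less.prems by blast
  next
    case False
    have IH: "2 * (p (z - t + L) - p (z - t)) = 2 * (z - t) + s + L" if "0 < t" "t \<le> s" for t
      using that False by (intro less.hyps) auto
    have L: "0 < L" using assms by (simp add: L_def)
    have rec: "p y = p (y - int a) + p (y - int b) + p (y - int c) - p (y - int a - int b)
      - p (y - int a - int c) - p (y - int b - int c) + p (y - int a - int b - int c)" if "0 < y" for y
      using ext_parts_three[OF assms(4-6), of y] that by (simp add: p_def)
    have sh: "z + L - int a = z - int a + L" "z + L - int b = z - int b + L" "z + L - int c = z - int c + L"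
      "z - int a + L - int b = z - (int a + int b) + L" "z - int a + L - int c = z - (int a + int c) + L"
      "z - int b + L - int c = z - (int b + int c) + L"
      "z - (int a + int b) + L - int c = z - (int a + int b + int c) + L"
      "z - int a - int b = z - (int a + int b)" "z - int a - int c = z - (int a + int c)"
      "z - int b - int c = z - (int b + int c)"
      "z - (int a + int b) - int c = z - (int a + int b + int c)"
      by simp_all
    have "0 < z" "0 < z + L" using False L by auto
    from rec[OF this(1)] rec[OF this(2)] show ?thesis
      unfolding sh
      using IH[of "int a"] IH[of "int b"] IH[of "int c"] IH[of "int a + int b"] IH[of "int a + int c"]
        IH[of "int b + int c"] IH[of "int a + int b + int c"] assms(4-6)
      by (simp add: s_def)
  qed
qed

text \<open>Entry \<open>j\<close> of \<open>padded_parts\<close> belongs to the argument \<open>j + 1 - (a + b + c)\<close>.\<close>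

definition padded_parts :: "nat \<Rightarrow> nat \<Rightarrow> nat \<Rightarrow> int list" where
  "padded_parts a b c
    = replicate (a + b + c - 1) 0 @ part_list [a, b, c] (1 # replicate (a * b * c) 0)"

text \<open>The first condition covers the arguments -s < z <= 0, the initial values needed for the
  recurrence of order s. The second bounds the defect on L consecutive arguments starting at 1 - s,
  one full period.\<close>

definition quadratic_check :: "nat \<Rightarrow> nat \<Rightarrow> nat \<Rightarrow> int \<Rightarrow> int \<Rightarrow> bool" where
  "quadratic_check a b c lo hi \<longleftrightarrow>
    (let p = padded_parts a b c; s = int (a + b + c); L = int (a * b * c) in
      list_all (\<lambda>(j, x, y). 2 * (y - x) = 2 * (j + 1 - s) + s + L)
        (zip [0..s - 1] (zip p (drop (a * b * c) p))) \<and>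
      list_all (\<lambda>(j, x). let d = 8 * L * x - (2 * (j + 1 - s) + s)\<^sup>2 in lo \<le> d \<and> d \<le> hi)
        (zip [0..L - 1] p))"

lemma padded_parts_nth:
  assumes "0 < a" "0 < b" "0 < c" "j < a + b + c + a * b * c"
  shows "padded_parts a b c ! j = ext (parts [a, b, c]) (int j + 1 - int (a + b + c))"
proof -
  have pl: "part_list [a, b, c] (1 # replicate (a * b * c) 0) = map (parts [a, b, c]) [0..<Suc (a * b * c)]"
    using assms by (intro parts_list) auto
  show ?thesis
  proof (cases "j < a + b + c - 1")
    case True
    then show ?thesis by (simp add: padded_parts_def nth_append ext_def)
  next
    case False
    then have "padded_parts a b c ! j = parts [a, b, c] (j - (a + b + c - 1))"
      unfolding padded_parts_def pl using assms by (subst nth_append) (auto simp del: upt_Suc part_seq_simps)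
    moreover have "int (j - (a + b + c - 1)) = int j + 1 - int (a + b + c)"
      using False assms by auto
    ultimately show ?thesis
      by (metis ext_def nat_int of_nat_less_0_iff)
  qed
qed

lemma length_padded_parts:
  assumes "0 < a" "0 < b" "0 < c"
  shows "length (padded_parts a b c) = a + b + c + a * b * c"
proof -
  have pl: "part_list [a, b, c] (1 # replicate (a * b * c) 0) = map (parts [a, b, c]) [0..<Suc (a * b * c)]"
    using assms by (intro parts_list) auto
  show ?thesis unfolding padded_parts_def pl using assms by simp
qed

lemma padded_parts_nth':
  fixes a b c :: nat
  defines "s \<equiv> int (a + b + c)" and "L \<equiv> int (a * b * c)"
  assumes abc: "0 < a" "0 < b" "0 < c" and "- s < z" "z \<le> L"
  shows "padded_parts a b c ! nat (z + s - 1) = ext (parts [a, b, c]) z"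
proof -
  have "int (nat (z + s - 1)) = z + s - 1" using assms by simp
  moreover from this have "nat (z + s - 1) < a + b + c + a * b * c"
    using assms unfolding s_def L_def by linarith
  ultimately show ?thesis
    using padded_parts_nth[OF abc, of "nat (z + s - 1)"] by (simp add: s_def)
qed

lemma parts_three_periodic:
  fixes a b c :: nat
  defines "p \<equiv> ext (parts [a, b, c])" and "s \<equiv> int (a + b + c)" and "L \<equiv> int (a * b * c)"
  assumes abc: "0 < a" "0 < b" "0 < c" and check: "quadratic_check a b c lo hi" and "- s < z"
  shows "2 * (p (z + L) - p z) = 2 * z + s + L"
proof -
  note nth = padded_parts_nth'[OF abc, folded p_def s_def L_def]
  note len = length_padded_parts[OF abc]
  have L: "0 < L" using abc by (simp add: L_def)
  show ?thesis
    unfolding p_def s_def L_def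
  proof (rule parts_three_quasi_periodic[OF abc], fold p_def s_def L_def)
    fix z assume z: "- s < z" "z \<le> 0"
    define j where "j = nat (z + s - 1)"
    have j: "int j = z + s - 1" "j < a + b + c" using z by (auto simp: j_def s_def)
    have "padded_parts a b c ! j = p z" using nth[of z] z L by (simp add: j_def)
    moreover have "padded_parts a b c ! (a * b * c + j) = p (z + L)"
    proof -
      have "z + L + s - 1 = int (a * b * c + j)" using j(1) by (simp add: L_def)
      then have "nat (z + L + s - 1) = a * b * c + j" by (simp only: nat_int)
      then show ?thesis using nth[of "z + L"] z L by simp
    qed
    moreover have "2 * (padded_parts a b c ! (a * b * c + j) - padded_parts a b c ! j)
        = 2 * (int j + 1 - s) + s + L"
      using check j(2) unfolding quadratic_check_def Let_def list_all_length
      by (auto simp: len s_def L_def add.commute)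
    ultimately show "2 * (p (z + L) - p z) = 2 * z + s + L" using j by simp
  qed (use assms(8) in \<open>simp add: s_def\<close>)
qed

text \<open>The increment of p over a shift by L is exactly that of (2 z + s)^2 / (8 L), so the
  defect has period L and the bounds extend from one period to all z > -s.\<close>

lemma parts_three_quadratic:
  fixes a b c :: nat
  defines "p \<equiv> ext (parts [a, b, c])" and "s \<equiv> int (a + b + c)" and "L \<equiv> int (a * b * c)"
  assumes abc: "0 < a" "0 < b" "0 < c" and check: "quadratic_check a b c lo hi" and "- s < z"
  shows "lo \<le> 8 * L * p z - (2 * z + s)\<^sup>2 \<and> 8 * L * p z - (2 * z + s)\<^sup>2 \<le> hi"
proof -
  note nth = padded_parts_nth'[OF abc, folded p_def s_def L_def]
  note len = length_padded_parts[OF abc]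
  have L: "0 < L" using abc by (simp add: L_def)
  note per = parts_three_periodic[OF abc check, folded p_def s_def L_def]
  show ?thesis
    using assms(8)
  proof (induction "nat (z + s)" arbitrary: z rule: less_induct)
    case less
    show ?case
    proof (cases "z + s - 1 < L")
      case True
      define j where "j = nat (z + s - 1)"
      have j: "int j = z + s - 1" "int j < L" using less.prems True by (auto simp: j_def)
      have "padded_parts a b c ! j = p z"
      proof -
        have "1 \<le> s" using abc by (simp add: s_def)
        then show ?thesis using nth[of z] less.prems True by (simp add: j_def)
      qed
      moreover have "(let d = 8 * L * (padded_parts a b c ! j) - (2 * (int j + 1 - s) + s)\<^sup>2 in lo \<le> d \<and> d \<le> hi)"
      proof -
        let ?zs = "zip [0..L - 1] (padded_parts a b c)"
        have "j < a * b * c" using j(2) unfolding L_def by (simp only: of_nat_less_iff)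
        then have jlt: "j < length ?zs" by (simp add: len L_def del: of_nat_mult)
        moreover have "[0..L - 1] ! j = int j" using j(2) by (subst nth_upto) auto
        ultimately have "?zs ! j = (int j, padded_parts a b c ! j)" by simp
        moreover have "list_all (\<lambda>(j, x). let d = 8 * L * x - (2 * (j + 1 - s) + s)\<^sup>2 in lo \<le> d \<and> d \<le> hi) ?zs"
          using check unfolding quadratic_check_def s_def L_def Let_def by blast
        ultimately show ?thesis using jlt unfolding list_all_length by force
      qed
      ultimately show ?thesis using j by (simp add: Let_def)
    next
      case False
      define y where "y = z - L"
      have y: "- s < y" "z = y + L" using False by (auto simp: y_def)
      have "8 * L * p z = 8 * L * p y + 4 * L * (2 * (p (y + L) - p y))"
        unfolding y(2) by (simp add: algebra_simps)
      also have "\<dots> = 8 * L * p y + 4 * L * (2 * y + s + L)"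
        by (simp only: per[OF y(1)])
      finally have "8 * L * p z - (2 * z + s)\<^sup>2 = 8 * L * p y - (2 * y + s)\<^sup>2"
        unfolding y(2) by (simp add: algebra_simps power2_eq_square)
      moreover have "lo \<le> 8 * L * p y - (2 * y + s)\<^sup>2 \<and> 8 * L * p y - (2 * y + s)\<^sup>2 \<le> hi"
        by (rule less.hyps) (use y L in auto)
      ultimately show ?thesis by simp
    qed
  qed
qed

lemma quadratic_seq_parts:
  fixes a b c :: nat
  assumes "0 < a" "0 < b" "0 < c" and "quadratic_check a b c lo hi"
    and "6 \<le> a + b + c" "a + b + c \<le> 14" "lo \<le> 0" "0 \<le> hi" "hi - lo \<le> 388" "0 \<le> \<beta>"
    and "36 * int (a + b + c) \<le> \<beta> + 252" "2 * (hi - lo) + \<beta> \<le> 956"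
    and small: "list_all (\<lambda>x. 0 < x) (drop 2 (part_list [a, b, c] (1 # replicate 10 0)))"
  shows "quadratic_seq (ext (parts [a, b, c])) (int (a * b * c)) (int (a + b + c)) lo hi \<beta>"
proof
  note quad = parts_three_quadratic[OF assms(1-4)]
  show "0 < ext (parts [a, b, c]) z" if "0 \<le> z" "z \<noteq> 1" for z
  proof (cases "z \<le> 10")
    case True
    have pl: "part_list [a, b, c] (1 # replicate 10 0) = map (parts [a, b, c]) [0..<Suc 10]"
      using assms by (intro parts_list) auto
    show ?thesis
    proof (cases "z = 0")
      case True
      then show ?thesis using assms(1-3) by (simp add: ext_def div_seq.simps[of _ _ 0] delta_def)
    next
      case False
      define j where "j = nat (z - 2)"
      have j: "j < 9" "nat z = 2 + j" using that True False by (auto simp: j_def)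
      then have "0 < parts [a, b, c] (2 + j)"
        using small unfolding pl list_all_length by (simp del: upt_Suc part_seq_simps)
      then show ?thesis using that j(2) by (simp add: ext_def del: part_seq_simps)
    qed
  next
    case False
    \<comment> \<open>26 is 2 * 10 + 6, and its square exceeds the width 388, so the quadratic bound
      alone gives positivity beyond the tabulated values.\<close>
    have "26\<^sup>2 \<le> (2 * z + int (a + b + c))\<^sup>2" using False assms(5) by (intro power_mono) auto
    moreover have "lo \<le> 8 * int (a * b * c) * ext (parts [a, b, c]) z - (2 * z + int (a + b + c))\<^sup>2"
      using quad[of z] False by linarith
    ultimately have "0 < 8 * int (a * b * c) * ext (parts [a, b, c]) z" using assms(7-9) by simp
    then show ?thesis by (rule zero_less_mult_pos) (use assms(1-3) in simp)
  qed
qed (use assms parts_three_quadratic[OF assms(1-4)] in \<open>auto simp: ext_def simp del: part_seq_simps\<close>)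

section \<open>Truncations at \<open>k \<ge> 2\<close>\<close>


abbreviation tail_coeff :: "nat \<Rightarrow> nat \<Rightarrow> nat set \<Rightarrow> nat \<Rightarrow> rat" where
  "tail_coeff k c A n \<equiv> fps_nth (truncated_tail k (k + c) * inverse (X_prod A)) n"

lemma inverse_X_prod_insert:
  assumes "finite A" "a \<notin> A"
  shows "inverse (X_prod (insert a A)) = inverse (X_prod A) * inverse (1 - fps_X ^ a)"
  using assms by (simp add: X_prod_def fps_inverse_mult mult.commute)

lemma mult_inverse_one_minus_X_power_nth:
  fixes F :: "'a::field fps"
  assumes "0 < a"
  shows "fps_nth (F * inverse (1 - fps_X ^ a)) n
    = fps_nth F n + (if a \<le> n then fps_nth (F * inverse (1 - fps_X ^ a)) (n - a) else 0)"
proof -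
  let ?G = "F * inverse (1 - fps_X ^ a)"
  have "?G * (1 - fps_X ^ a) = F * (inverse (1 - fps_X ^ a) * (1 - fps_X ^ a))"
    by (simp only: mult.assoc)
  also have "inverse (1 - fps_X ^ a) * (1 - fps_X ^ a) = (1 :: 'a fps)"
    by (rule inverse_mult_eq_1) (use assms in \<open>simp add: fps_X_power_nth\<close>)
  finally have "F = ?G - ?G * fps_X ^ a" by (simp add: right_diff_distrib)
  then have "fps_nth F n = fps_nth (?G - ?G * fps_X ^ a) n" by (rule arg_cong)
  then show ?thesis by (simp add: fps_X_power_mult_right_nth)
qed

lemma fps_nth_mult_inverse_one_minus_ge:
  fixes F :: "'a::linordered_field fps"
  assumes "0 < a" "\<And>m. m \<le> n \<Longrightarrow> 0 \<le> fps_nth F m"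
  shows "fps_nth F n \<le> fps_nth (F * inverse (1 - fps_X ^ a)) n"
proof -
  have "0 \<le> fps_nth (F * inverse (1 - fps_X ^ a)) m" if "m \<le> n" for m
    using that
  proof (induction m rule: less_induct)
    case (less m)
    then show ?case
      using assms by (subst mult_inverse_one_minus_X_power_nth) auto
  qed
  then show ?thesis
    by (subst mult_inverse_one_minus_X_power_nth[OF assms(1), of F n]) simp
qed

text \<open>A new part adds a shifted copy of the new series, which is nonnegative by induction on
  the exponent. Nonnegativity is therefore needed at all smaller exponents as well, not only at
  n.\<close>

lemma fps_nth_mult_inverse_X_prod_ge:
  assumes "finite B" "0 \<notin> B" "A \<subseteq> B" "\<And>m. m \<le> n \<Longrightarrow> 0 \<le> fps_nth (F * inverse (X_prod A)) m"
  shows "fps_nth (F * inverse (X_prod A)) n \<le> fps_nth (F * inverse (X_prod B)) n"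
proof -
  have fin: "finite (B - A)" using assms by simp
  have "fps_nth (F * inverse (X_prod A)) m \<le> fps_nth (F * inverse (X_prod (A \<union> S))) m"
    if "finite S" "S \<subseteq> B - A" "m \<le> n" for S m
    using that
  proof (induction S arbitrary: m rule: finite_induct)
    case (insert b S)
    have "A \<union> insert b S = insert b (A \<union> S)" by auto
    moreover have "b \<notin> A \<union> S" "finite (A \<union> S)"
      using insert assms by (auto intro: finite_subset)
    ultimately have eq: "F * inverse (X_prod (A \<union> insert b S))
        = F * inverse (X_prod (A \<union> S)) * inverse (1 - fps_X ^ b)"
      by (simp add: inverse_X_prod_insert mult.assoc)
    have "0 < b" using insert.prems assms by (cases b) auto
    moreover have "0 \<le> fps_nth (F * inverse (X_prod (A \<union> S))) l" if "l \<le> m" for l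
      using insert.IH[of l] insert.prems that assms(4)[of l] by auto
    ultimately have "fps_nth (F * inverse (X_prod (A \<union> S))) m \<le> fps_nth (F * inverse (X_prod (A \<union> insert b S))) m"
      unfolding eq by (rule fps_nth_mult_inverse_one_minus_ge)
    then show ?case using insert.IH[of m] insert.prems by auto
  qed simp
  from this[OF fin order_refl order_refl] show ?thesis
    using assms(3) by (simp add: Un_absorb1)
qed

fun pos_except :: "int list \<Rightarrow> int \<Rightarrow> int list \<Rightarrow> bool" where
  "pos_except zs i [] \<longleftrightarrow> True"
| "pos_except zs i (x # xs) \<longleftrightarrow> (if i \<in> set zs then x = 0 else 0 < x) \<and> pos_except zs (i + 1) xs"

lemma pos_except_nth:
  assumes "pos_except zs i xs" "j < length xs"
  shows "if i + int j \<in> set zs then xs ! j = 0 else 0 < xs ! j"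
  using assms
proof (induction zs i xs arbitrary: j rule: pos_except.induct)
  case (2 zs i x xs)
  show ?case
  proof (cases j)
    case (Suc j')
    with 2 show ?thesis by (simp add: add.assoc)
  qed (use 2 in simp)
qed simp

text \<open>The offsets in \<open>zs\<close> are counted from \<open>pent k\<close> and mark
  coefficients that are exactly 0. Demanding 0 there, rather than nothing, keeps the series
  nonnegative, as inheritance requires.\<close>

definition tail_check :: "nat \<Rightarrow> nat \<Rightarrow> int list \<Rightarrow> nat list \<Rightarrow> bool" where
  "tail_check k c zs as \<longleftrightarrow> pos_except zs 0 (drop (pent k) (part_list as (tail_list k c)))"

lemma length_part_list:
  assumes "0 \<notin> set as"
  shows "length (part_list as xs) = length xs"
  using part_list_eq[OF assms, of "list_seq xs" "length xs"] by (simp add: map_list_seq)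

lemma tail_checkD:
  assumes "tail_check k c zs as" "distinct as" "0 \<notin> set as" "pent k \<le> n" "n < pent (k + c)"
  shows "if int (n - pent k) \<in> set zs then tail_coeff k c (set as) n = 0 else 0 < tail_coeff k c (set as) n"
proof -
  let ?xs = "part_list as (tail_list k c)"
  have "n - pent k < length (drop (pent k) ?xs)"
    using assms(4,5) by (simp add: length_part_list[OF assms(3)])
  then have "if 0 + int (n - pent k) \<in> set zs then drop (pent k) ?xs ! (n - pent k) = 0
      else 0 < drop (pent k) ?xs ! (n - pent k)"
    using assms(1) unfolding tail_check_def by (intro pos_except_nth)
  moreover have "drop (pent k) ?xs ! (n - pent k) = ?xs ! n"
    using assms(4,5) by (simp add: length_part_list[OF assms(3)])
  ultimately show ?thesis
    unfolding tail_parts_nth[OF assms(2,3,5)] by (simp split: if_splits)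
qed

lemma truncated_tail_coeff_cong:
  assumes "n < pent (k + c)" "n < pent (k + c')"
  shows "tail_coeff k c A n = tail_coeff k c' A n"
proof -
  have "eq_upto n (truncated_tail k (k + c)) (truncated_tail k (k + c'))"
    if "c \<le> c'" "n < pent (k + c)" for c c'
  proof -
    have "truncated_tail k (k + c') = truncated_tail k (k + c)
        + (\<Sum>m=k + c..<k + c'. (- 1) ^ (m - k) * fps_X ^ pent m * (1 - fps_X ^ (2 * m + 1)))"
      unfolding truncated_tail_def using that(1) by (subst sum.atLeastLessThan_concat) auto
    moreover have "eq_upto n
        (\<Sum>m=k + c..<k + c'. (- 1) ^ (m - k) * fps_X ^ pent m * (1 - fps_X ^ (2 * m + 1)))
        (\<Sum>m=k + c..<k + c'. 0 :: rat fps)"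
    proof (rule eq_upto_sum)
      fix m assume "m \<in> {k + c..<k + c'}"
      then have "n < pent m" using that(2) pent_mono[of "k + c" m] by simp
      then have "eq_upto n (fps_X ^ pent m * ((- 1) ^ (m - k) * (1 - fps_X ^ (2 * m + 1)))) (0 :: rat fps)"
        by (simp add: eq_upto_def fps_X_power_mult_nth)
      then show "eq_upto n ((- 1) ^ (m - k) * fps_X ^ pent m * (1 - fps_X ^ (2 * m + 1))) (0 :: rat fps)"
        by (simp only: mult_ac)
    qed
    ultimately show ?thesis by (simp add: eq_upto_def)
  qed
  then have "eq_upto n (truncated_tail k (k + c)) (truncated_tail k (k + c'))"
    using assms by (cases "c \<le> c'") (auto intro: eq_upto_sym)
  then have "eq_upto n (truncated_tail k (k + c) * inverse (X_prod A)) (truncated_tail k (k + c') * inverse (X_prod A))"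
    by (intro eq_upto_mult) auto
  then show ?thesis by (simp add: eq_uptoD)
qed

text \<open>Both q^(2k+1) and the next pentagonal block come too late to matter, so the coefficient
  is the number of partitions of 1. This is the source of the infinite family of zeros for i =
  1.\<close>

lemma tail_coeff_at_pent_add_1:
  assumes "0 \<notin> A" "finite A" "1 \<le> k" "0 < c"
  shows "tail_coeff k c A (pent k + 1) = of_bool (1 \<in> A)"
proof -
  obtain c' where c: "c = Suc c'" using assms(4) by (cases c) auto
  have G: "fps_nth (inverse (X_prod A)) 1 = of_bool (1 \<in> A)"
  proof -
    have "eq_upto 1 (X_prod A) (X_prod (A \<inter> {1}))"
      using assms by (intro X_prod_eq_upto) (auto, (metis le_Suc_eq le_zero_eq)+)
    then have "eq_upto 1 (inverse (X_prod A)) (inverse (X_prod (A \<inter> {1})))"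
      by (rule eq_upto_inverse) (use assms in \<open>simp add: X_prod_0\<close>)
    then have "fps_nth (inverse (X_prod A)) 1 = fps_nth (inverse (X_prod (A \<inter> {1}))) 1"
      by (simp add: eq_upto_def)
    also have "\<dots> = of_bool (1 \<in> A)"
    proof (cases "1 \<in> A")
      case True
      then have "A \<inter> {1} = {1}" by auto
      moreover have "fps_nth (1 * inverse (1 - fps_X ^ 1)) (0 :: nat) = (1 :: rat)"
        by (subst mult_inverse_one_minus_X_power_nth) auto
      then have "fps_nth (1 * inverse (1 - fps_X ^ 1)) (1 :: nat) = (1 :: rat)"
        by (subst mult_inverse_one_minus_X_power_nth) auto
      ultimately show ?thesis using True by (simp add: X_prod_def)
    qed (simp add: X_prod_def)
    finally show ?thesis .
  qed
  have "tail_coeff k c A (pent k + 1)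
      = fps_nth (fps_X ^ pent k * ((1 - fps_X ^ (2 * k + 1)) * inverse (X_prod A))) (pent k + 1)
        - fps_nth (truncated_tail (Suc k) (Suc k + c') * inverse (X_prod A)) (pent k + 1)"
    unfolding c truncated_tail_Suc by (simp add: left_diff_distrib mult.assoc)
  also have "fps_nth (truncated_tail (Suc k) (Suc k + c') * inverse (X_prod A)) (pent k + 1) = 0"
    by (rule truncated_tail_mult_nth_eq_0) (simp add: pent_Suc)
  also have "fps_nth (fps_X ^ pent k * ((1 - fps_X ^ (2 * k + 1)) * inverse (X_prod A))) (pent k + 1)
      = fps_nth ((1 - fps_X ^ (2 * k + 1)) * inverse (X_prod A)) 1"
    by (subst fps_X_power_mult_nth) auto
  also have "\<dots> = of_bool (1 \<in> A)"
    unfolding left_diff_distrib fps_sub_nth fps_X_power_mult_nth mult_1 G using assms(3) by simp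
  finally show ?thesis by simp
qed

lemma three_parts_tail_coeff:
  fixes a b c :: nat
  assumes "quadratic_seq (ext (parts [a, b, c])) L s lo hi \<beta>"
    and "distinct [a, b, c]" "0 \<notin> {a, b, c}" and "int (pent k) \<le> int n" "n < pent (k + d)"
    and "7 \<le> k \<and> n \<noteq> pent k + 1 \<or> k = 2 \<and> pent 24 \<le> n \<or> k = 3 \<and> pent 13 \<le> n
      \<or> k = 4 \<and> pent 9 \<le> n \<or> k \<in> {5, 6} \<and> pent 8 \<le> n"
  shows "0 < tail_coeff k d {a, b, c} n"
proof -
  interpret quadratic_seq "ext (parts [a, b, c])" L s lo hi \<beta> by fact
  have "inverse (X_prod {a, b, c}) = fps_of_seq (parts [a, b, c])"
    using fps_of_part_seq[of "[a, b, c]" delta] assms(2,3) by simp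
  then have "tail_coeff k d {a, b, c} n = of_int (alt_sum d k (int n))"
    using truncated_tail_mult_nth[OF refl] by simp
  moreover have "0 < alt_sum d k (int n)"
    by (rule alt_sum_pos) (use assms(4-6) in auto)
  ultimately show ?thesis by simp
qed

text \<open>\<open>es\<close> is needed for \<open>k = 2\<close> only: the three parts alone do not suffice then for all bases.\<close>

definition base_check :: "nat list \<Rightarrow> nat list \<Rightarrow> int list \<Rightarrow> int list \<Rightarrow> bool" where
  "base_check as es zs2 zs \<longleftrightarrow> tail_check 2 22 zs2 (as @ es) \<and> tail_check 3 10 zs as \<and> tail_check 4 5 zs as
    \<and> tail_check 5 3 zs as \<and> tail_check 6 2 zs as"

text \<open>The tables in \<open>base_check\<close> reach up to \<open>pent\<close> of 24, 13, 9, 8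
  and 8 for k = 2, ..., 6, exactly where the estimate for three parts takes over. For k >= 7 only
  the exponent \<open>pent k + 1\<close> escapes the estimate, and it is known in closed
  form.\<close>

theorem tail_coeff_pos:
  fixes a b c :: nat
  assumes quad: "quadratic_seq (ext (parts [a, b, c])) L s lo hi \<beta>"
    and dist: "distinct ([a, b, c] @ es)" "0 \<notin> set ([a, b, c] @ es)" "length es \<le> 1"
    and check: "base_check [a, b, c] es zs2 zs"
    and B: "finite B" "0 \<notin> B" "set ([a, b, c] @ es) \<subseteq> B"
    and n: "2 \<le> k" "pent k \<le> n" "n < pent (k + d)"
    and zs: "int (n - pent k) \<notin> set (if k = 2 then zs2 else zs)" "1 \<in> {a, b, c} \<or> n \<noteq> pent k + 1"
  shows "0 < tail_coeff k d B n"
proof -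
  define A where "A = (if k = 2 then set ([a, b, c] @ es) else {a, b, c})"
  have pents: "pent 2 = 7" "pent 24 = 876" "pent 13 = 260" "pent 9 = 126" "pent 8 = 100"
    "pent 3 = 15" "pent 4 = 26" "pent 5 = 40" "pent 6 = 57"
    by (simp_all add: pent_def)
  \<comment> \<open>Weak positivity at every exponent is what inheritance by \<open>B\<close>
    consumes; strict positivity is claimed off the listed zeros.\<close>
  define ok where "ok d' n \<longleftrightarrow> 0 \<le> tail_coeff k d' A n \<and>
      (int (n - pent k) \<notin> set (if k = 2 then zs2 else zs) \<and> (1 \<in> {a, b, c} \<or> n \<noteq> pent k + 1)
        \<longrightarrow> 0 < tail_coeff k d' A n)" for d' n
  have ok: "ok d' n" if "n < pent (k + d')" "pent k \<le> n" for n d'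
  proof (cases "k = 2")
    case k: True
    have A: "A = set ([a, b, c] @ es)" using k by (simp add: A_def)
    show ?thesis
      using that
    proof (induction n rule: less_induct)
      case (less n)
      show ?case
      proof (cases "n < pent 24")
        case True
        have "if int (n - pent 2) \<in> set zs2 then tail_coeff 2 22 A n = 0 else 0 < tail_coeff 2 22 A n"
          unfolding A by (rule tail_checkD) (use dist check less k True in \<open>auto simp: base_check_def pents\<close>)
        moreover have "tail_coeff 2 22 A n = tail_coeff k d' A n"
          unfolding k by (rule truncated_tail_coeff_cong) (use True less k in auto)
        ultimately show ?thesis using k unfolding ok_def by (auto split: if_splits)
      next
        case False
        have pos3: "0 < tail_coeff k d' {a, b, c} n"
          by (rule three_parts_tail_coeff[OF quad]) (use dist less k False in auto)
        have "0 < tail_coeff k d' A n"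
        proof (cases es)
          case Nil
          then show ?thesis using pos3 A by simp
        next
          case (Cons e es')
          then have es: "es = [e]" using dist(3) by simp
          have e: "0 < e" "e \<notin> {a, b, c}" using dist es by auto
          have finite_abc: "finite {a, b, c}" by simp
          have Ae: "A = insert e {a, b, c}" using A es by auto
          \<comment> \<open>The estimate covers the three parts only. The fourth part adds the
            series itself at n - e, nonnegative by induction or by vanishing below
            \<open>pent k\<close>.\<close>
          have "tail_coeff k d' A n = tail_coeff k d' {a, b, c} n + (if e \<le> n then tail_coeff k d' A (n - e) else 0)"
            unfolding Ae inverse_X_prod_insert[OF finite_abc e(2)] mult.assoc[symmetric]
            by (rule mult_inverse_one_minus_X_power_nth[OF e(1)])
          moreover have "0 \<le> tail_coeff k d' A (n - e)" if "e \<le> n"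
          proof (cases "pent k \<le> n - e")
            case True
            then show ?thesis using less.IH[of "n - e"] e less.prems that unfolding ok_def by auto
          next
            case False
            then show ?thesis by (simp add: truncated_tail_mult_nth_eq_0)
          qed
          ultimately show ?thesis using pos3 by auto
        qed
        then show ?thesis unfolding ok_def by simp
      qed
    qed
  next
    case k: False
    have A: "A = {a, b, c}" using k by (simp add: A_def)
    note n = that
    have fin: "0 \<le> tail_coeff k d' A n \<and> (int (n - pent k) \<notin> set zs \<longrightarrow> 0 < tail_coeff k d' A n)"
      if "tail_check k c' zs [a, b, c]" "n < pent (k + c')" for c'
    proof -
      have "if int (n - pent k) \<in> set zs then tail_coeff k c' A n = 0 else 0 < tail_coeff k c' A n"
        using tail_checkD[OF that(1), of n] dist n that A by auto
      moreover have "tail_coeff k c' A n = tail_coeff k d' A n"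
        by (rule truncated_tail_coeff_cong) (use that n in auto)
      ultimately show ?thesis by (auto split: if_splits)
    qed
    have far: "ok d' n" if "7 \<le> k \<and> n \<noteq> pent k + 1 \<or> k = 2 \<and> pent 24 \<le> n \<or> k = 3 \<and> pent 13 \<le> n
      \<or> k = 4 \<and> pent 9 \<le> n \<or> k \<in> {5, 6} \<and> pent 8 \<le> n"
      using three_parts_tail_coeff[OF quad _ _ _ n(1) that] dist n A unfolding ok_def by auto
    consider "k = 3" | "k = 4" | "k = 5" | "k = 6" | "7 \<le> k" using \<open>2 \<le> k\<close> k by linarith
    then show ?thesis
    proof cases
      case 1
      then show ?thesis using fin[of 10] far check unfolding ok_def by (cases "n < pent 13") (auto simp: base_check_def pents)
    next
      case 2
      then show ?thesis using fin[of 5] far check unfolding ok_def by (cases "n < pent 9") (auto simp: base_check_def pents)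
    next
      case 3
      then show ?thesis using fin[of 3] far check unfolding ok_def by (cases "n < pent 8") (auto simp: base_check_def pents)
    next
      case 4
      then show ?thesis using fin[of 2] far check unfolding ok_def by (cases "n < pent 8") (auto simp: base_check_def pents)
    next
      case 5
      show ?thesis
      proof (cases "n = pent k + 1")
        case True
        have "0 < d'" using n by (cases d') auto
        then have "tail_coeff k d' A n = of_bool (1 \<in> A)"
          unfolding True by (intro tail_coeff_at_pent_add_1) (use dist A 5 in auto)
        then show ?thesis using True A unfolding ok_def by auto
      next
        case False
        then show ?thesis using far 5 by auto
      qed
    qed
  qed
  have "0 < tail_coeff k d A n" using ok[of n d] n zs unfolding ok_def by blast
  also have "\<dots> \<le> tail_coeff k d B n"
  proof (rule fps_nth_mult_inverse_X_prod_ge)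
    show "A \<subseteq> B" using B(3) by (auto simp: A_def)
    fix m assume "m \<le> n"
    then show "0 \<le> tail_coeff k d A m"
      using ok[of m d] n unfolding ok_def by (cases "pent k \<le> m") (auto simp: truncated_tail_mult_nth_eq_0)
  qed fact+
  finally show ?thesis .
qed

section \<open>The eight bases\<close>

definition suitable_base :: "nat \<Rightarrow> nat \<Rightarrow> nat \<Rightarrow> nat list \<Rightarrow> int list \<Rightarrow> int list \<Rightarrow> bool" where
  "suitable_base a b c es zs2 zs \<longleftrightarrow>
    (\<exists>L s lo hi \<beta>. quadratic_seq (ext (parts [a, b, c])) L s lo hi \<beta>)
    \<and> distinct ([a, b, c] @ es) \<and> 0 \<notin> set ([a, b, c] @ es) \<and> length es \<le> 1
    \<and> base_check [a, b, c] es zs2 zs"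

lemma suitable_baseI:
  fixes a b c :: nat
  assumes "0 < a" "0 < b" "0 < c" and "quadratic_check a b c lo hi"
    and "6 \<le> a + b + c" "a + b + c \<le> 14" "lo \<le> 0" "0 \<le> hi" "hi - lo \<le> 388" "0 \<le> \<beta>"
    and "36 * int (a + b + c) \<le> \<beta> + 252" "2 * (hi - lo) + \<beta> \<le> 956"
    and "list_all (\<lambda>x. 0 < x) (drop 2 (part_list [a, b, c] (1 # replicate 10 0)))"
    and "distinct ([a, b, c] @ es)" "0 \<notin> set es" "length es \<le> 1"
    and "base_check [a, b, c] es zs2 zs"
  shows "suitable_base a b c es zs2 zs"
proof -
  have "\<exists>L s lo hi \<beta>. quadratic_seq (ext (parts [a, b, c])) L s lo hi \<beta>"
    using quadratic_seq_parts[OF assms(1-13)] by blast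
  then show ?thesis unfolding suitable_base_def using assms(1-3,14-17) by auto
qed

text \<open>In all eight cases \<open>lo\<close> and \<open>hi\<close> enclose the defect. The value
  180 = 36 * 12 - 252 of \<open>\<beta>\<close> serves every base with sum at most 12; only 1, 4, 9
  with sum 14 needs 252.\<close>

lemma suitable_base_1_2_3: "suitable_base 1 2 3 [] [] []"
  by (rule suitable_baseI[where lo = "-16" and hi = 12 and \<beta> = 180]) (simp; fail | code_simp)+

lemma suitable_base_1_2_5: "suitable_base 1 2 5 [] [] []"
  by (rule suitable_baseI[where lo = "-36" and hi = 16 and \<beta> = 180]) (simp; fail | code_simp)+

lemma suitable_base_1_2_7: "suitable_base 1 2 7 [] [] []"
  by (rule suitable_baseI[where lo = "-64" and hi = 28 and \<beta> = 180]) (simp; fail | code_simp)+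

lemma suitable_base_1_3_4: "suitable_base 1 3 4 [] [] []"
  by (rule suitable_baseI[where lo = "-48" and hi = 32 and \<beta> = 180]) (simp; fail | code_simp)+

lemma suitable_base_1_3_5: "suitable_base 1 3 5 [] [] []"
  by (rule suitable_baseI[where lo = "-49" and hi = 39 and \<beta> = 180]) (simp; fail | code_simp)+

lemma suitable_base_1_4_9: "suitable_base 1 4 9 [6] [] []"
  by (rule suitable_baseI[where lo = "-208" and hi = 128 and \<beta> = 252]) (simp; fail | code_simp)+

lemma suitable_base_2_3_5: "suitable_base 2 3 5 [4] [1] [1]"
  by (rule suitable_baseI[where lo = "-144" and hi = 140 and \<beta> = 180]) (simp; fail | code_simp)+

text \<open>Used for i = 1, N = 5. The offset 1 reflects the missing part 1, and the offset 5 for k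
  = 2 is the exponent 7 + 5 = 12 of the exceptional zero.\<close>

lemma suitable_base_2_3_7: "suitable_base 2 3 7 [8] [1, 5] [1]"
  by (rule suitable_baseI[where lo = "-196" and hi = 192 and \<beta> = 180]) (simp; fail | code_simp)+

lemma finite_admissible [simp]: "finite (admissible N i n)"
  by (simp add: admissible_def)

lemma zero_notin_admissible [simp]: "0 \<notin> admissible N i n"
  by (simp add: admissible_def)

text \<open>No base contains a part above 9. Admitting parts up to n + 9 keeps the whole base
  available even when n is small, without changing the coefficient at n.\<close>

lemma C_pos_of_base:
  assumes "suitable_base a b c es zs2 zs" "set ([a, b, c] @ es) \<subseteq> admissible N i 9"
    and "2 \<le> k" "pent k \<le> n" "0 < i" "2 * i < N"
    and "int (n - pent k) \<notin> set (if k = 2 then zs2 else zs)" "1 \<in> {a, b, c} \<or> n \<noteq> pent k + 1"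
  shows "0 < C k i N n"
proof -
  have n: "n < pent (k + (n + 1))" using pent_ge[of "k + (n + 1)"] by simp
  have "C k i N n = tail_coeff k (n + 1) (admissible N i (n + 9)) n"
    by (rule C_eq_tail_nth) (use assms n in auto)
  moreover have "0 < tail_coeff k (n + 1) (admissible N i (n + 9)) n"
  proof -
    obtain L s lo hi \<beta> where "quadratic_seq (ext (parts [a, b, c])) L s lo hi \<beta>"
      "distinct ([a, b, c] @ es)" "0 \<notin> set ([a, b, c] @ es)" "length es \<le> 1"
      "base_check [a, b, c] es zs2 zs"
      using assms(1) unfolding suitable_base_def by blast
    moreover have "admissible N i 9 \<subseteq> admissible N i (n + 9)" by (auto simp: admissible_def)
    then have "set ([a, b, c] @ es) \<subseteq> admissible N i (n + 9)" using assms(2) by blast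
    ultimately show ?thesis
      by (rule tail_coeff_pos[OF _ _ _ _ _ finite_admissible zero_notin_admissible _ assms(3,4) n assms(7,8)])
  qed
  ultimately show ?thesis by simp
qed

lemma C_at_pent_add_1:
  assumes "1 \<le> k" "3 \<le> N"
  shows "C k 1 N (pent k + 1) = 0"
proof -
  let ?n = "pent k + 1"
  have n: "?n < pent (k + 1)" using assms(1) by (simp add: pent_Suc)
  have "C k 1 N ?n = tail_coeff k 1 (admissible N 1 ?n) ?n"
    by (rule C_eq_tail_nth) (use assms n in auto)
  also have "\<dots> = of_bool (1 \<in> admissible N 1 ?n)"
    by (rule tail_coeff_at_pent_add_1) (use assms in auto)
  also have "\<dots> = 0" using assms by (simp add: admissible_def)
  finally show ?thesis .
qed

lemma C_2_1_5_12: "C 2 1 5 12 = 0"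
proof -
  have "admissible 5 1 12 = set (filter (\<lambda>j. j mod 5 \<notin> {0, 1, 4}) [1..<13])"
    by (auto simp: admissible_def)
  also have "\<dots> = set [2, 3, 7, 8, 12]" by code_simp
  finally have A: "admissible 5 1 12 = set [2, 3, 7, 8, 12]" .
  have "C 2 1 5 12 = tail_coeff 2 2 (admissible 5 1 12) 12"
    by (rule C_eq_tail_nth) (auto simp: pent_def)
  also have "\<dots> = of_int (part_list [2, 3, 7, 8, 12] (tail_list 2 2) ! 12)"
    unfolding A by (rule tail_parts_nth) (auto simp: pent_def)
  also have "part_list [2, 3, 7, 8, 12] (tail_list 2 2) ! 12 = 0"
    by code_simp
  finally show ?thesis by simp
qed

text \<open>Each case selects a base that avoids 0, i and -i modulo N. For i = 1, N = 6 every
  allowed part is divisible by 2 or 3, so three pairwise coprime parts do not exist; in the main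
  theorem i = 1 forces N to be odd.\<close>

theorem C_pos_of_ge_2:
  assumes "2 \<le> k" "pent k \<le> n" "0 < i" "2 * i < N" "5 \<le> N" "i = 1 \<Longrightarrow> N \<noteq> 6"
    and "i = 1 \<Longrightarrow> n \<noteq> pent k + 1" "\<not> (k = 2 \<and> i = 1 \<and> N = 5 \<and> n = 12)"
  shows "0 < C k i N n"
proof -
  note base = C_pos_of_base[OF _ _ assms(1-4)]
  have mem: "j \<in> admissible N i 9" if "1 \<le> j" "j < i \<or> i < j \<and> j < N - i \<or> N - i < j \<and> j < N" "j \<le> 9" for j
  proof -
    have "j < N" using that(2) assms(4) by linarith
    then have "j mod N = j" by simp
    then show ?thesis using that assms(4) by (auto simp: admissible_def)
  qed
  have "4 \<le> i \<or> i = 3 \<and> N = 8 \<or> i = 3 \<and> N \<noteq> 8 \<or> i = 2 \<and> N = 5 \<or> i = 2 \<and> N = 6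
    \<or> i = 2 \<and> 7 \<le> N \<or> i = 1 \<and> N = 5 \<or> i = 1 \<and> 7 \<le> N"
    using assms(3-6) by presburger
  then consider "4 \<le> i" | "i = 3" "N = 8" | "i = 3" "N \<noteq> 8" | "i = 2" "N = 5" | "i = 2" "N = 6"
    | "i = 2" "7 \<le> N" | "i = 1" "N = 5" | "i = 1" "7 \<le> N" by blast
  then show ?thesis
  proof cases
    case 1
    have "1 \<in> admissible N i 9" "2 \<in> admissible N i 9" "3 \<in> admissible N i 9"
      by (intro mem; use 1 assms(4) in auto)+
    then show ?thesis
      by (intro base[OF suitable_base_1_2_3]) (use 1 assms(7) in auto)
  next
    case 2
    show ?thesis
      by (rule base[OF suitable_base_1_2_7]) (use 2 in \<open>auto simp: admissible_def\<close>)
  next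
    case 3
    then have "N = 7 \<or> 9 \<le> N" using assms(4) by linarith
    then have "5 \<in> admissible N i 9" using 3 by (intro mem) auto
    then show ?thesis
      by (intro base[OF suitable_base_1_2_5]) (use mem[of 1] mem[of 2] 3 assms(4) in auto)
  next
    case 4
    show ?thesis
      by (rule base[OF suitable_base_1_4_9]) (use 4 in \<open>auto simp: admissible_def\<close>)
  next
    case 5
    show ?thesis
      by (rule base[OF suitable_base_1_3_5]) (use 5 in \<open>auto simp: admissible_def\<close>)
  next
    case 6
    have "1 \<in> admissible N i 9" "3 \<in> admissible N i 9" "4 \<in> admissible N i 9"
      by (intro mem; use 6 assms(4) in auto)+
    then show ?thesis
      by (intro base[OF suitable_base_1_3_4]) (use 6 assms(7) in auto)
  next
    case 7
    have "pent 2 = 7" by (simp add: pent_def)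
    then show ?thesis
      by (intro base[OF suitable_base_2_3_7]) (use 7 assms in \<open>auto simp: admissible_def\<close>)
  next
    case 8
    have "2 \<in> admissible N i 9" "3 \<in> admissible N i 9" "4 \<in> admissible N i 9" "5 \<in> admissible N i 9"
      by (intro mem; use 8 assms(4) in auto)+
    then show ?thesis
      by (intro base[OF suitable_base_2_3_5]) (use 8 assms(7) in auto)
  qed
qed

section \<open>Truncation at \<open>k = 1\<close>\<close>


definition seq_coeff :: "(nat \<Rightarrow> int) \<Rightarrow> nat list \<Rightarrow> nat \<Rightarrow> rat" where
  "seq_coeff s as n = fps_nth (fps_of_seq s * inverse (X_prod (set as))) n"

lemma seq_coeff_eq_list:
  assumes "distinct as" "0 \<notin> set as" "n < M"
  shows "seq_coeff s as n = of_int (part_list as (map s [0..<M]) ! n)"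
  unfolding seq_coeff_def part_list_eq[OF assms(2)] fps_of_part_seq[OF assms(1,2), symmetric]
  using assms(3) by simp

definition window_check :: "(nat \<Rightarrow> int) \<Rightarrow> int \<Rightarrow> nat \<Rightarrow> nat list \<Rightarrow> bool" where
  "window_check s t n0 as \<longleftrightarrow> list_all (\<lambda>x. t \<le> x) (drop n0 (part_list as (map s [0..<n0 + hd as])))"

text \<open>The coefficient at n is the one at n - a plus a coefficient without the part a. If the
  latter are nonnegative from \<open>n0\<close> on, a lower bound on a consecutive exponents
  persists for ever; this is why the window is as long as the first part.\<close>

lemma seq_coeff_ge:
  assumes "distinct (a # as)" "0 \<notin> set (a # as)" "window_check s t n0 (a # as)"
    and "\<And>m. n0 \<le> m \<Longrightarrow> 0 \<le> seq_coeff s as m" and "n0 \<le> n"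
  shows "of_int t \<le> seq_coeff s (a # as) n"
  using assms(5)
proof (induction n rule: less_induct)
  case (less n)
  show ?case
  proof (cases "n < n0 + a")
    case True
    let ?xs = "part_list (a # as) (map s [0..<n0 + a])"
    have len: "length ?xs = n0 + a" using length_part_list[OF assms(2)] by simp
    then have "drop n0 ?xs ! (n - n0) = ?xs ! n" "n - n0 < length (drop n0 ?xs)"
      using less.prems True by auto
    then have "t \<le> ?xs ! n"
      using assms(3) unfolding window_check_def list_all_length list.sel by metis
    then show ?thesis using seq_coeff_eq_list[OF assms(1,2) True, of s] by simp
  next
    case False
    have a: "0 < a" using assms(2) by simp
    have "fps_of_seq s * inverse (X_prod (set (a # as)))
        = fps_of_seq s * inverse (X_prod (set as)) * inverse (1 - fps_X ^ a)"
      using assms(1) by (simp add: inverse_X_prod_insert mult.assoc)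
    then have "seq_coeff s (a # as) n = seq_coeff s as n + seq_coeff s (a # as) (n - a)"
      unfolding seq_coeff_def using False
      by (simp only:) (subst mult_inverse_one_minus_X_power_nth[OF a], simp)
    moreover have "0 \<le> seq_coeff s as n" using assms(4) less.prems by simp
    moreover have "of_int t \<le> seq_coeff s (a # as) (n - a)"
      by (rule less.IH) (use False a in auto)
    ultimately show ?thesis by simp
  qed
qed

fun chain_check :: "(nat \<Rightarrow> int) \<Rightarrow> nat \<Rightarrow> nat list \<Rightarrow> nat list \<Rightarrow> bool" where
  "chain_check s n0 [] bs \<longleftrightarrow> True"
| "chain_check s n0 (a # as) bs \<longleftrightarrow> chain_check s n0 as bs \<and> window_check s 0 n0 (a # as @ bs)"

lemma chain_seq_coeff_nonneg:
  assumes "distinct (as @ bs)" "0 \<notin> set (as @ bs)" "chain_check s n0 as bs"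
    and "\<And>m. n0 \<le> m \<Longrightarrow> 0 \<le> seq_coeff s bs m" and "n0 \<le> n"
  shows "0 \<le> seq_coeff s (as @ bs) n"
  using assms(1-3,5)
proof (induction as arbitrary: n)
  case (Cons a as)
  have "of_int 0 \<le> seq_coeff s (a # (as @ bs)) n"
    by (rule seq_coeff_ge) (use Cons in auto)
  then show ?case by simp
qed (use assms(4) in simp)

definition nabla :: "nat \<Rightarrow> int" where
  "nabla n = (if n = 0 then 1 else if n = 1 then - 1 else 0)"

lemma fps_of_nabla: "fps_of_seq nabla = 1 - fps_X"
  by (rule fps_ext) (auto simp: nabla_def)

lemma seq_coeff_delta_nonneg:
  assumes "0 \<notin> set as"
  shows "0 \<le> seq_coeff delta as n"
proof -
  have "0 \<le> fps_nth (1 * inverse (X_prod {})) n" by (simp add: X_prod_def)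
  also have "\<dots> \<le> fps_nth (1 * inverse (X_prod (set as))) n"
    by (rule fps_nth_mult_inverse_X_prod_ge) (use assms in \<open>auto simp: X_prod_def\<close>)
  finally show ?thesis by (simp add: seq_coeff_def)
qed

lemma parts_nabla:
  assumes "distinct as" "0 \<notin> set as"
  shows "seq_coeff nabla as n = of_int (ext (parts as) (int n) - ext (parts as) (int n - 1))"
proof -
  have "fps_of_seq nabla * inverse (X_prod (set as)) = fps_of_seq (parts as) - fps_X ^ 1 * fps_of_seq (parts as)"
    unfolding fps_of_nabla fps_of_part_seq[OF assms] by (simp add: algebra_simps)
  then have "seq_coeff nabla as n = fps_nth (fps_of_seq (parts as)) n - fps_nth (fps_X ^ 1 * fps_of_seq (parts as)) n"
    unfolding seq_coeff_def by (simp only: fps_sub_nth)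
  then show ?thesis
    unfolding X_power_mult_fps_of_seq_nth by (simp add: ext_def)
qed

text \<open>Quasi-periodicity with a linear increment means that the first difference of the
  partition numbers grows by exactly 1 over a shift by a b c. Hence one period decides the
  sign.\<close>

lemma three_parts_nabla_nonneg:
  fixes a b c :: nat
  assumes "distinct [a, b, c]" "0 \<notin> {a, b, c}" "quadratic_check a b c lo hi"
    and "list_all (\<lambda>x. 0 \<le> x) (drop 2 (part_list [a, b, c] (map nabla [0..<2 + a * b * c])))"
    and "2 \<le> n"
  shows "0 \<le> seq_coeff nabla [a, b, c] n"
  using assms(5)
proof (induction n rule: less_induct)
  case (less n)
  define L where "L = a * b * c"
  have abc: "0 < a" "0 < b" "0 < c" using assms(2) by auto
  then have L: "0 < L" by (simp add: L_def)
  have dist: "0 \<notin> set [a, b, c]" using assms(2) by simp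
  show ?case
  proof (cases "n < 2 + L")
    case True
    define xs where "xs = part_list [a, b, c] (map nabla [0..<2 + L])"
    have len: "length xs = 2 + L" unfolding xs_def length_part_list[OF dist] by simp
    have n: "2 + (n - 2) = n" using less.prems by simp
    have "n - 2 < length (drop 2 xs)" using len less.prems True by simp
    then have "0 \<le> drop 2 xs ! (n - 2)"
      using assms(4) unfolding L_def[symmetric] xs_def[symmetric] list_all_length by blast
    also have "drop 2 xs ! (n - 2) = xs ! n"
      using len n nth_drop[of 2 xs "n - 2"] by simp
    finally show ?thesis
      using seq_coeff_eq_list[OF assms(1) dist True, of nabla] unfolding xs_def[symmetric] by simp
  next
    case False
    define p where "p = ext (parts [a, b, c])"
    note per = parts_three_periodic[OF abc assms(3), folded p_def L_def]
    define m where "m = n - L"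
    have m: "2 \<le> m" "n = m + L" using False by (auto simp: m_def)
    have "2 * (p (int m + int L) - p (int m)) = 2 * int m + int (a + b + c) + int L"
      by (rule per) (use abc in auto)
    moreover have "2 * (p (int m - 1 + int L) - p (int m - 1)) = 2 * (int m - 1) + int (a + b + c) + int L"
      by (rule per) (use abc m in auto)
    ultimately have "p (int n) - p (int n - 1) = p (int m) - p (int m - 1) + 1"
      unfolding m(2) by (simp add: algebra_simps)
    then have "seq_coeff nabla [a, b, c] n = seq_coeff nabla [a, b, c] m + 1"
      unfolding parts_nabla[OF assms(1) dist] p_def[symmetric] by simp
    moreover have "0 \<le> seq_coeff nabla [a, b, c] m"
      by (rule less.IH) (use m L in auto)
    ultimately show ?thesis by simp
  qed
qed

text \<open>Without the part \<open>1\<close>, the coefficient of \<open>q\<close> in \<open>(1 - q)/\<Prod>(1 - q\<^sup>a)\<close> is \<open>-1\<close>. A new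
  part \<open>b\<close> propagates this loss to the exponent \<open>b + 1\<close>, where it is paid for by assumption.\<close>

lemma nabla_coeff_mono:
  assumes "finite B" "A \<subseteq> B" "0 \<notin> B" "1 \<notin> B"
  defines "v \<equiv> \<lambda>S n. fps_nth (fps_of_seq nabla * inverse (X_prod S)) n"
  assumes nonneg: "\<And>n. n \<noteq> 1 \<Longrightarrow> 0 \<le> v A n" and one: "v A 1 = - 1"
    and pay: "\<And>b. b \<in> B - A \<Longrightarrow> 1 \<le> v A (b + 1)"
  shows "v A n - of_bool (1 \<le> n \<and> n - 1 \<in> B - A) \<le> v B n"
proof -
  have fin: "finite (B - A)" using assms by simp
  have "v A n - of_bool (1 \<le> n \<and> n - 1 \<in> S) \<le> v (A \<union> S) n" if "finite S" "S \<subseteq> B - A" for S n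
    using that
  proof (induction S arbitrary: n rule: finite_induct)
    case (insert b S)
    have b: "2 \<le> b"
    proof -
      have "b \<in> B" using insert.prems by auto
      then have "b \<noteq> 0 \<and> b \<noteq> 1" using assms(3,4) by metis
      then show ?thesis by linarith
    qed
    have fresh: "b \<notin> A \<union> S" "finite (A \<union> S)"
      using insert assms(1,2) by (auto intro: finite_subset)
    have step: "v (A \<union> insert b S) n = v (A \<union> S) n + (if b \<le> n then v (A \<union> insert b S) (n - b) else 0)" for n
    proof -
      have eq: "fps_of_seq nabla * inverse (X_prod (A \<union> insert b S))
          = fps_of_seq nabla * inverse (X_prod (A \<union> S)) * inverse (1 - fps_X ^ b)"
        using fresh by (simp add: inverse_X_prod_insert mult.assoc)
      show ?thesis unfolding v_def eq
        by (rule mult_inverse_one_minus_X_power_nth) (use b in simp)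
    qed
    have IH: "v A n - of_bool (1 \<le> n \<and> n - 1 \<in> S) \<le> v (A \<union> S) n" for n
      using insert by auto
    show ?case
    proof (induction n rule: less_induct)
      case (less n)
      show ?case
      proof (cases "n = b + 1")
        case True
        \<comment> \<open>At n = b + 1 the copied coefficient is the one at exponent 1, which is
          still at least -1. This is the loss recorded by the indicator.\<close>
        have "v (A \<union> insert b S) 1 = v (A \<union> S) 1" using step[of 1] b by simp
        moreover have "v A 1 - of_bool ((0 :: nat) \<in> S) \<le> v (A \<union> S) 1" using IH[of 1] by simp
        moreover have "0 \<notin> S" using insert.prems assms(3) by auto
        ultimately have "- 1 \<le> v (A \<union> insert b S) 1" using one by simp
        moreover have "v A n \<le> v (A \<union> S) n" using IH[of n] fresh True by simp
        ultimately show ?thesis using step[of n] True by simp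
      next
        case False
        have "0 \<le> (if b \<le> n then v (A \<union> insert b S) (n - b) else 0)"
        proof (cases "b \<le> n")
          case True
          have ne: "n - b \<noteq> 1" using True False by simp
          have "v A (n - b) - of_bool (1 \<le> n - b \<and> n - b - 1 \<in> insert b S) \<le> v (A \<union> insert b S) (n - b)"
            by (rule less.IH) (use True b in auto)
          \<comment> \<open>A loss may already have occurred at n - b, but then n - b - 1 is a new
            part and \<open>pay\<close> provides a coefficient of at least 1.\<close>
          moreover have "of_bool (1 \<le> n - b \<and> n - b - 1 \<in> insert b S) \<le> v A (n - b)"
          proof (cases "1 \<le> n - b \<and> n - b - 1 \<in> insert b S")
            case pay': True
            then have mem: "n - b - 1 \<in> B - A" using insert.prems by auto
            have "n - b - 1 + 1 = n - b" using pay' by linarith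
            then have "1 \<le> v A (n - b)" using pay[OF mem] by (simp only:)
            then show ?thesis by simp
          next
            case False
            then show ?thesis unfolding of_bool_def using nonneg[OF ne] by (simp only: if_False)
          qed
          ultimately show ?thesis using True by simp
        qed simp
        moreover have "(of_bool (1 \<le> n \<and> n - 1 \<in> S) :: rat) \<le> of_bool (1 \<le> n \<and> n - 1 \<in> insert b S)"
          by simp
        ultimately show ?thesis using step[of n] IH[of n] by linarith
      qed
    qed
  qed (use assms in simp)
  from this[OF fin order_refl] show ?thesis using assms(2) by (simp add: Un_absorb1)
qed

section \<open>Theta coefficients and the case k = 1, i >= 2\<close>

definition theta_coeff :: "nat \<Rightarrow> nat \<Rightarrow> nat \<Rightarrow> rat" where
  "theta_coeff N i n = of_bool (int n \<in> P_even (int N) (int i)) - of_bool (int n \<in> P_odd (int N) (int i))"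

lemma C_1_eq:
  assumes "0 < i" "2 * i < N" "n \<le> M"
  shows "C 1 i N n = fps_nth (fps_of_seq nabla * inverse (X_prod (admissible N i M))) n - theta_coeff N i n"
  unfolding theta_coeff_def fps_of_nabla by (rule C_1_nth[OF assms])

text \<open>The smallest positive exponent with even index is that of m = 2. Below it the theta
  coefficient is at most 0, so subtracting it does no harm.\<close>

lemma P_even_ge:
  assumes "2 * i < N" "0 < n" "int n \<in> P_even (int N) (int i)"
  shows "N + 2 * i \<le> n"
proof -
  obtain m where m: "even m" "triple_exp N i m = int n"
    using assms(3) unfolding P_even_triple_exp by auto
  have "m \<noteq> 0" using m(2) assms(2) by (auto simp: triple_exp_def)
  with m(1) have "m = 2 \<or> m = - 2 \<or> 4 \<le> \<bar>m\<bar>" by presburger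
  then consider "m = 2" | "m = - 2" | "4 \<le> \<bar>m\<bar>" by blast
  then have "int N + 2 * int i \<le> triple_exp N i m"
  proof cases
    case 3
    have "int N * 3 \<le> int N * (\<bar>m\<bar> - 1)" using 3 by (intro mult_left_mono) auto
    also have "\<dots> \<le> triple_exp N i m" using assms(1) by (intro triple_exp_ge) auto
    finally show ?thesis using assms(1) by simp
  qed (use assms(1) in \<open>auto simp: triple_exp_def\<close>)
  with m(2) show ?thesis by linarith
qed

lemma P_odd_ge:
  assumes "i < N" "n \<noteq> i" "int n \<in> P_odd (int N) (int i)"
  shows "N - i \<le> n"
proof -
  obtain m where m: "odd m" "triple_exp N i m = int n"
    using assms(3) unfolding P_odd_triple_exp by auto
  have "m \<noteq> 1" using m(2) assms(2) by (auto simp: triple_exp_def)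
  with m(1) have "m = - 1 \<or> 2 \<le> \<bar>m\<bar>" by presburger
  then consider "m = - 1" | "2 \<le> \<bar>m\<bar>" by blast
  then have "int N - int i \<le> triple_exp N i m"
  proof cases
    case 2
    have "int N * 1 \<le> int N * (\<bar>m\<bar> - 1)" using 2 by (intro mult_left_mono) auto
    also have "\<dots> \<le> triple_exp N i m" using assms(1) by (intro triple_exp_ge) auto
    finally show ?thesis by simp
  qed (auto simp: triple_exp_def)
  with m(2) show ?thesis by linarith
qed

lemma P_odd_mem:
  assumes "i < N" "n = i \<or> n = N - i"
  shows "int n \<in> P_odd (int N) (int i)"
proof -
  have "triple_exp N i 1 = int i" "triple_exp N i (- 1) = int (N - i)"
    using assms(1) by (auto simp: triple_exp_def)
  then have "triple_exp N i (if n = i then 1 else - 1) = int n" using assms(2) by auto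
  moreover have "odd (if n = i then 1 else - 1 :: int)" by simp
  ultimately show ?thesis unfolding P_odd_triple_exp mem_Collect_eq
    by (intro exI[of _ "if n = i then 1 else - 1"]) auto
qed

lemma theta_coeff_le_1: "theta_coeff N i n \<le> 1"
  by (simp add: theta_coeff_def)

text \<open>An executable version for exponents below 6 N: these force N (|m| - 1) < 6 N, hence |m|
  <= 6.\<close>

definition theta_int :: "nat \<Rightarrow> nat \<Rightarrow> nat \<Rightarrow> int" where
  "theta_int N i n = sum_list (map (\<lambda>m. if triple_exp N i m = int n then if even m then 1 else - 1 else 0) [-6..6])"

lemma theta_coeff_eq_int:
  assumes "0 < i" "2 * i < N" "n < 6 * N"
  shows "theta_coeff N i n = of_int (theta_int N i n)"
proof -
  let ?f = "\<lambda>m. if triple_exp N i m = int n then if even m then 1 else - 1 else 0 :: int"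
  have bound: "m \<in> {-6..6}" if "triple_exp N i m = int n" for m
  proof -
    have "int N * (\<bar>m\<bar> - 1) \<le> int n" using triple_exp_ge[of i N m] that assms by simp
    also have "\<dots> < int N * 6" using assms(3) by simp
    finally have "\<bar>m\<bar> - 1 < 6" by (simp only: mult_less_cancel_left)
    then show ?thesis by auto
  qed
  have sum: "theta_int N i n = (\<Sum>m\<in>{-6..6}. ?f m)"
    unfolding theta_int_def set_upto[symmetric] by (rule sum_list_distinct_conv_sum_set) (rule distinct_upto)
  show ?thesis
  proof (cases "\<exists>m. triple_exp N i m = int n")
    case True
    then obtain m where m: "triple_exp N i m = int n" by blast
    have uniq: "m' = m" if "triple_exp N i m' = int n" for m'
      using triple_exp_inj[OF assms(1,2)] that m by simp
    have "(\<Sum>m\<in>{-6..6}. ?f m) = (\<Sum>m\<in>{m}. ?f m)"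
      by (rule sum.mono_neutral_right) (use bound[OF m] uniq in auto)
    also have "\<dots> = (if even m then 1 else - 1)" using m by simp
    finally have "theta_int N i n = (if even m then 1 else - 1)" unfolding sum .
    moreover have "int n \<in> P_even (int N) (int i) \<longleftrightarrow> even m" "int n \<in> P_odd (int N) (int i) \<longleftrightarrow> odd m"
      unfolding P_even_triple_exp P_odd_triple_exp mem_Collect_eq using m uniq by metis+
    ultimately show ?thesis by (simp add: theta_coeff_def)
  next
    case False
    then have "int n \<notin> P_even (int N) (int i)" "int n \<notin> P_odd (int N) (int i)"
      unfolding P_even_triple_exp P_odd_triple_exp mem_Collect_eq by metis+
    with False show ?thesis unfolding sum theta_coeff_def by simp
  qed
qed

definition admissible_list :: "nat \<Rightarrow> nat \<Rightarrow> nat \<Rightarrow> nat list" where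
  "admissible_list N i L = filter (\<lambda>j. j mod N \<noteq> 0 \<and> j mod N \<noteq> i \<and> j mod N \<noteq> N - i) [1..<L]"

definition C_1_list :: "nat \<Rightarrow> nat \<Rightarrow> nat \<Rightarrow> int list" where
  "C_1_list i N L = map2 (-) (part_list (admissible_list N i L) (map nabla [0..<L])) (map (theta_int N i) [0..<L])"

lemma C_1_eq_list:
  assumes "0 < i" "2 * i < N" "n < L" "L \<le> 6 * N"
  shows "C 1 i N n = of_int (C_1_list i N L ! n)"
proof -
  let ?as = "admissible_list N i L"
  have as: "distinct ?as" "0 \<notin> set ?as" "set ?as = admissible N i (L - 1)"
    using assms(3) by (auto simp: admissible_list_def admissible_def)
  have "C 1 i N n = seq_coeff nabla ?as n - theta_coeff N i n"
    unfolding seq_coeff_def as(3) by (rule C_1_eq) (use assms in auto)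
  also have "\<dots> = of_int (part_list ?as (map nabla [0..<L]) ! n) - of_int (theta_int N i n)"
    using seq_coeff_eq_list[OF as(1,2) assms(3)] theta_coeff_eq_int[OF assms(1,2)] assms(3,4) by simp
  finally show ?thesis
    unfolding C_1_list_def using assms(3) length_part_list[OF as(2), of "map nabla [0..<L]"] by simp
qed

fun pos_unless :: "nat list \<Rightarrow> nat \<Rightarrow> int list \<Rightarrow> bool" where
  "pos_unless zs i [] \<longleftrightarrow> True"
| "pos_unless zs i (x # xs) \<longleftrightarrow> (i \<in> set zs \<or> 0 < x) \<and> pos_unless zs (Suc i) xs"

lemma pos_unless_nth:
  assumes "pos_unless zs i xs" "j < length xs" "i + j \<notin> set zs"
  shows "0 < xs ! j"
  using assms
proof (induction zs i xs arbitrary: j rule: pos_unless.induct)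
  case (2 zs i x xs)
  show ?case
  proof (cases j)
    case (Suc j')
    with 2 show ?thesis by simp
  qed (use 2 in simp)
qed simp

lemma C_1_pos_small:
  assumes "pos_unless zs 0 (C_1_list i N L)" "0 < i" "2 * i < N" "n < L" "L \<le> 6 * N" "n \<notin> set zs"
  shows "0 < C 1 i N n"
proof -
  have "0 \<notin> set (admissible_list N i L)" by (auto simp: admissible_list_def)
  then have "length (C_1_list i N L) = L"
    by (simp add: C_1_list_def length_part_list)
  then have "0 < C_1_list i N L ! n"
    using pos_unless_nth[OF assms(1), of n] assms(4,6) by simp
  then show ?thesis unfolding C_1_eq_list[OF assms(2-5)] by simp
qed

text \<open>For i >= 2 the part 1 is allowed and cancels the factor 1 - q. What remains counts
  partitions into the other parts, and this count can only grow with the set of parts.\<close>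

lemma C_1_ge_parts:
  assumes "2 \<le> i" "2 * i < N" "distinct as" "set as \<subseteq> admissible N i 14" "1 \<notin> set as"
  shows "seq_coeff delta as n - theta_coeff N i n \<le> C 1 i N n"
proof -
  let ?B = "admissible N i (n + 14)"
  have one: "1 \<in> ?B" using assms(1,2) by (auto simp: admissible_def)
  have "fps_of_seq nabla * inverse (X_prod ?B) = 1 * inverse (X_prod (?B - {1}))"
  proof -
    have "X_prod ?B = (1 - fps_X) * X_prod (?B - {1})"
      unfolding X_prod_def using one by (subst prod.remove[of _ 1]) auto
    then show ?thesis
      unfolding fps_of_nabla using inverse_mult_eq_1'[of "1 - fps_X :: rat fps"]
      by (simp add: fps_inverse_mult flip: mult.assoc)
  qed
  then have "C 1 i N n = fps_nth (1 * inverse (X_prod (?B - {1}))) n - theta_coeff N i n"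
    using C_1_eq[of i N n "n + 14"] assms(1,2) by simp
  moreover have "fps_nth (1 * inverse (X_prod (set as))) n \<le> fps_nth (1 * inverse (X_prod (?B - {1}))) n"
  proof (rule fps_nth_mult_inverse_X_prod_ge)
    have "admissible N i 14 \<subseteq> ?B" by (auto simp: admissible_def)
    then show "set as \<subseteq> ?B - {1}" using assms(4,5) by auto
    have "0 \<notin> set as" using assms(4) zero_notin_admissible by blast
    then show "0 \<le> fps_nth (1 * inverse (X_prod (set as))) m" for m
      using seq_coeff_delta_nonneg[of as m] by (simp add: seq_coeff_def)
  qed auto
  ultimately show ?thesis by (simp add: seq_coeff_def)
qed

text \<open>From \<open>n0\<close> on, coefficients of at least 2 beat a theta coefficient of at
  most 1. Below \<open>n0\<close> the theta coefficient is at most 0, and at i and N - i it is -1;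
  so at these two exponents the partition count itself may vanish.\<close>

lemma C_1_pos_of_base:
  assumes "2 \<le> i" "2 * i < N" "distinct (a # as)" "set (a # as) \<subseteq> admissible N i 14" "1 \<notin> set (a # as)"
    and "window_check delta 2 n0 (a # as)"
    and "pos_unless zs 0 (part_list (a # as) (map delta [0..<n0]))" "set zs \<subseteq> {1, i, N - i}" "n0 \<le> N + 2 * i"
    and "2 \<le> n"
  shows "0 < C 1 i N n"
proof -
  have z: "0 \<notin> set (a # as)" using assms(4) zero_notin_admissible by blast
  have ge: "seq_coeff delta (a # as) n - theta_coeff N i n \<le> C 1 i N n"
    by (rule C_1_ge_parts[OF assms(1-5)])
  show ?thesis
  proof (cases "n0 \<le> n")
    case True
    have "of_int 2 \<le> seq_coeff delta (a # as) n"
      by (rule seq_coeff_ge[OF assms(3) z assms(6) _ True]) (use z in \<open>auto intro: seq_coeff_delta_nonneg\<close>)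
    then show ?thesis using ge theta_coeff_le_1[of N i n] by simp
  next
    case False
    have "int n \<notin> P_even (int N) (int i)" using P_even_ge[OF assms(2), of n] False assms(9,10) by auto
    then have theta: "theta_coeff N i n = - of_bool (int n \<in> P_odd (int N) (int i))"
      by (simp add: theta_coeff_def)
    show ?thesis
    proof (cases "n = i \<or> n = N - i")
      case True
      have "theta_coeff N i n = - 1"
        unfolding theta using P_odd_mem[OF _ True] assms(2) by simp
      then show ?thesis using ge seq_coeff_delta_nonneg[OF z, of n] by simp
    next
      case no: False
      have "0 < part_list (a # as) (map delta [0..<n0]) ! n"
        by (rule pos_unless_nth[OF assms(7)])
          (use False no assms(8,10) length_part_list[OF z, of "map delta [0..<n0]"] in auto)
      then have "1 \<le> seq_coeff delta (a # as) n"
        using seq_coeff_eq_list[OF assms(3) z, of n n0 delta] False by simp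
      moreover have "theta_coeff N i n \<le> 0" unfolding theta by simp
      ultimately show ?thesis using ge by linarith
    qed
  qed
qed

theorem C_1_pos_of_ge_2:
  assumes "2 \<le> i" "2 * i < N" "2 \<le> n" "\<not> (i = 2 \<and> N = 5)"
  shows "0 < C 1 i N n"
proof -
  have mem: "j \<in> admissible N i 14" if "1 \<le> j" "j < i \<or> i < j \<and> j < N - i \<or> N - i < j \<and> j < N" "j \<le> 14" for j
  proof -
    have "j < N" using that(2) assms(2) by linarith
    then have "j mod N = j" by simp
    then show ?thesis using that assms(2) by (auto simp: admissible_def)
  qed
  have "4 \<le> i \<or> i = 3 \<and> N = 7 \<or> i = 3 \<and> N = 8 \<or> i = 3 \<and> 9 \<le> N \<or> i = 2 \<and> N = 6 \<or> i = 2 \<and> N = 7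
    \<or> i = 2 \<and> 8 \<le> N"
    using assms by presburger
  then consider "4 \<le> i" | "i = 3" "N = 7" | "i = 3" "N = 8" | "i = 3" "9 \<le> N" | "i = 2" "N = 6"
    | "i = 2" "N = 7" | "i = 2" "8 \<le> N" by blast
  then show ?thesis
  proof cases
    case 1
    have "2 \<in> admissible N i 14" "3 \<in> admissible N i 14"
      by (intro mem; use 1 assms(2) in auto)+
    moreover have "window_check delta 2 8 [2, 3]" "pos_unless [1] 0 (part_list [2, 3] (map delta [0..<8]))"
      by code_simp+
    ultimately show ?thesis
      by (intro C_1_pos_of_base[OF assms(1,2), of 2 "[3]" 8 "[1]"]) (use 1 assms in auto)
  next
    case 2
    have "window_check delta 2 13 [2, 5, 6]" "pos_unless [1, 3] 0 (part_list [2, 5, 6] (map delta [0..<13]))"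
      by code_simp+
    then show ?thesis
      by (intro C_1_pos_of_base[OF assms(1,2), of 2 "[5, 6]" 13 "[1, 3]"])
        (use 2 assms in \<open>auto simp: admissible_def\<close>)
  next
    case 3
    have "window_check delta 2 14 [2, 4, 7]" "pos_unless [1, 3, 5] 0 (part_list [2, 4, 7] (map delta [0..<14]))"
      by code_simp+
    then show ?thesis
      by (intro C_1_pos_of_base[OF assms(1,2), of 2 "[4, 7]" 14 "[1, 3, 5]"])
        (use 3 assms in \<open>auto simp: admissible_def\<close>)
  next
    case 4
    have "2 \<in> admissible N i 14" "5 \<in> admissible N i 14"
      by (intro mem; use 4 in auto)+
    moreover have "window_check delta 2 14 [2, 5]" "pos_unless [1, 3] 0 (part_list [2, 5] (map delta [0..<14]))"
      by code_simp+
    ultimately show ?thesis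
      by (intro C_1_pos_of_base[OF assms(1,2), of 2 "[5]" 14 "[1, 3]"]) (use 4 assms in auto)
  next
    case 5
    have "window_check delta 2 10 [3, 5, 7, 9, 11]"
      "pos_unless [1, 2, 4] 0 (part_list [3, 5, 7, 9, 11] (map delta [0..<10]))"
      by code_simp+
    then show ?thesis
      by (intro C_1_pos_of_base[OF assms(1,2), of 3 "[5, 7, 9, 11]" 10 "[1, 2, 4]"])
        (use 5 assms in \<open>auto simp: admissible_def\<close>)
  next
    case 6
    have "window_check delta 2 11 [3, 4, 6, 8]"
      "pos_unless [1, 2, 5] 0 (part_list [3, 4, 6, 8] (map delta [0..<11]))"
      by code_simp+
    then show ?thesis
      by (intro C_1_pos_of_base[OF assms(1,2), of 3 "[4, 6, 8]" 11 "[1, 2, 5]"])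
        (use 6 assms in \<open>auto simp: admissible_def\<close>)
  next
    case 7
    have "3 \<in> admissible N i 14" "4 \<in> admissible N i 14" "5 \<in> admissible N i 14"
      by (intro mem; use 7 in auto)+
    moreover have "window_check delta 2 11 [3, 4, 5]"
      "pos_unless [1, 2] 0 (part_list [3, 4, 5] (map delta [0..<11]))"
      by code_simp+
    ultimately show ?thesis
      by (intro C_1_pos_of_base[OF assms(1,2), of 3 "[4, 5]" 11 "[1, 2]"]) (use 7 assms in auto)
  qed
qed

text \<open>The coefficients are known to be at least 2 only from 14 on, beyond N + 2 i = 9 where
  theta may become positive. The smaller exponents are therefore computed with theta
  included.\<close>

theorem C_1_2_5_pos:
  assumes "2 \<le> n" "n \<notin> {5, 7, 9, 11}"
  shows "0 < C 1 2 5 n"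
proof (cases "n < 14")
  case True
  have "pos_unless [0, 1, 5, 7, 9, 11] 0 (C_1_list 2 5 14)" by code_simp
  then show ?thesis by (rule C_1_pos_small) (use True assms in auto)
next
  case False
  have z: "0 \<notin> set [4, 6, 9, 11, 14 :: nat]" by simp
  have "window_check delta 2 14 [4, 6, 9, 11, 14]" by code_simp
  then have "of_int 2 \<le> seq_coeff delta [4, 6, 9, 11, 14] n"
    by (rule seq_coeff_ge[rotated 2]) (use False in \<open>auto intro: seq_coeff_delta_nonneg\<close>)
  moreover have "seq_coeff delta [4, 6, 9, 11, 14] n - theta_coeff 5 2 n \<le> C 1 2 5 n"
    by (rule C_1_ge_parts) (auto simp: admissible_def)
  ultimately show ?thesis using theta_coeff_le_1[of 5 2 n] by simp
qed

section \<open>The case k = 1, i = 1\<close>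

lemma C_1_1_pos_far:
  assumes "2 < N" "distinct as" "set as \<subseteq> admissible N 1 13"
    and nonneg: "\<And>m. m \<noteq> 1 \<Longrightarrow> 0 \<le> seq_coeff nabla as m"
    and pay: "\<And>b. b \<in> admissible N 1 (n + 13) - set as \<Longrightarrow> 1 \<le> seq_coeff nabla as (b + 1)"
    and far: "3 \<le> seq_coeff nabla as n"
  shows "0 < C 1 1 N n"
proof -
  let ?B = "admissible N 1 (n + 13)"
  have one: "1 \<notin> ?B" using assms(1) by (simp add: admissible_def)
  have sub: "set as \<subseteq> ?B" using assms(3) by (auto simp: admissible_def)
  have z: "0 \<notin> set as" using assms(3) zero_notin_admissible by blast
  have "1 \<notin> set as" using one sub by blast
  then have "1 < a" if "a \<in> set as" for a
    using that z by (cases "a = 0 \<or> a = 1") auto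
  then have "eq_upto 1 (X_prod (set as)) (X_prod {})"
    by (intro X_prod_eq_upto) force+
  then have "eq_upto 1 (inverse (X_prod (set as))) (inverse (X_prod {}))"
    by (rule eq_upto_inverse) (use z in \<open>simp add: X_prod_0\<close>)
  then have "eq_upto 1 (fps_of_seq nabla * inverse (X_prod (set as))) (fps_of_seq nabla * 1)"
    by (intro eq_upto_mult) (auto simp: X_prod_def)
  then have "fps_nth (fps_of_seq nabla * inverse (X_prod (set as))) 1 = fps_nth (fps_of_seq nabla * 1) 1"
    by (rule eq_uptoD) simp
  then have v1: "seq_coeff nabla as 1 = - 1"
    unfolding seq_coeff_def by (simp only: mult_1_right fps_of_seq_nth) (simp add: nabla_def)
  have "seq_coeff nabla as n - of_bool (1 \<le> n \<and> n - 1 \<in> ?B - set as)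
      \<le> fps_nth (fps_of_seq nabla * inverse (X_prod ?B)) n"
    unfolding seq_coeff_def
    by (rule nabla_coeff_mono)
      (use sub one nonneg v1 pay in \<open>simp_all add: seq_coeff_def\<close>)
  moreover have "of_bool (1 \<le> n \<and> n - 1 \<in> ?B - set as) \<le> (1 :: rat)" by simp
  moreover have "C 1 1 N n = fps_nth (fps_of_seq nabla * inverse (X_prod ?B)) n - theta_coeff N 1 n"
    by (rule C_1_eq) (use assms(1) in auto)
  ultimately show ?thesis using far theta_coeff_le_1[of N 1 n] by linarith
qed

text \<open>The numbers \<open>n2\<close> and \<open>n0\<close> bound the exponents from which on the coefficients are at
  least \<open>1\<close> and at least \<open>3\<close>.\<close>

definition nabla_check :: "nat \<Rightarrow> nat list \<Rightarrow> nat \<Rightarrow> nat \<Rightarrow> nat \<Rightarrow> bool" where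
  "nabla_check a as c n2 n0 \<longleftrightarrow>
    list_all (\<lambda>x. 0 \<le> x) (drop 2 (part_list [2, 3, c] (map nabla [0..<2 + 2 * 3 * c])))
    \<and> chain_check nabla n0 as [2, 3, c] \<and> window_check nabla 3 n0 (a # as @ [2, 3, c])
    \<and> (let xs = part_list (a # as @ [2, 3, c]) (map nabla [0..<n0]) in
        0 \<le> hd xs \<and> list_all (\<lambda>x. 0 \<le> x) (drop 2 xs) \<and> list_all (\<lambda>x. 1 \<le> x) (drop n2 xs))"

text \<open>Nonnegativity starts from the parts 2, 3, c by periodicity, survives the adjunction of
  \<open>as\<close> by window checks, and the part a finally yields the bound 3. Every new part must
  be so large that the coefficient paying for its loss lies at \<open>n2\<close> or later.\<close>

lemma C_1_1_pos_of_check: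
  fixes a c :: nat and as :: "nat list"
  defines "bs \<equiv> a # as @ [2, 3, c]"
  assumes "2 < N" "distinct bs" "set bs \<subseteq> admissible N 1 13" "quadratic_check 2 3 c lo hi"
    and check: "nabla_check a as c n2 n0" and "2 \<le> n0" "n0 \<le> n"
    and new: "\<And>b. b \<in> admissible N 1 (n + 13) - set bs \<Longrightarrow> n2 \<le> b + 1"
  shows "0 < C 1 1 N n"
proof -
  have z: "0 \<notin> set bs" using assms(4) zero_notin_admissible by blast
  have base: "0 \<le> seq_coeff nabla [2, 3, c] m" if "2 \<le> m" for m
    by (rule three_parts_nabla_nonneg[OF _ _ assms(5) _ that])
      (use check assms(3) z in \<open>auto simp: nabla_check_def bs_def simp del: upt_Suc\<close>)
  have chain: "0 \<le> seq_coeff nabla (as @ [2, 3, c]) m" if "n0 \<le> m" for m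
    by (rule chain_seq_coeff_nonneg[OF _ _ _ _ that])
      (use check assms(3,7) z base in \<open>auto simp: nabla_check_def bs_def\<close>)
  have far: "3 \<le> seq_coeff nabla bs m" if "n0 \<le> m" for m
  proof -
    have "of_int 3 \<le> seq_coeff nabla (a # as @ [2, 3, c]) m"
      by (rule seq_coeff_ge[OF _ _ _ chain that])
        (use check assms(3) z in \<open>auto simp: nabla_check_def bs_def\<close>)
    then show ?thesis by (simp add: bs_def)
  qed
  define xs where "xs = part_list bs (map nabla [0..<n0])"
  have len: "length xs = n0" unfolding xs_def length_part_list[OF z] by simp
  have xs: "0 \<le> hd xs" "list_all (\<lambda>x. 0 \<le> x) (drop 2 xs)" "list_all (\<lambda>x. 1 \<le> x) (drop n2 xs)"
    using check unfolding nabla_check_def xs_def bs_def Let_def by blast+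
  have nth: "seq_coeff nabla bs m = of_int (xs ! m)" if "m < n0" for m
    unfolding xs_def by (rule seq_coeff_eq_list[OF assms(3) z that])
  have drop_nth: "P (xs ! m)" if "list_all P (drop j xs)" "j \<le> m" "m < n0" for P j m
  proof -
    have "m - j < length (drop j xs)" using that len by simp
    then have "P (drop j xs ! (m - j))" using that(1) unfolding list_all_length by blast
    then show ?thesis using that len by simp
  qed
  show ?thesis
  proof (rule C_1_1_pos_far[OF assms(2,3,4)])
    show "0 \<le> seq_coeff nabla bs m" if "m \<noteq> 1" for m
    proof (cases "n0 \<le> m")
      case True
      then show ?thesis using far[of m] by simp
    next
      case False
      then have m: "m < n0" by simp
      show ?thesis
      proof (cases "m = 0")
        case True
        then show ?thesis using nth[OF m] xs(1) len m by (cases xs) auto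
      next
        case False
        then have "0 \<le> xs ! m" using that by (intro drop_nth[OF xs(2) _ m]) simp
        then show ?thesis using nth[OF m] by simp
      qed
    qed
    show "1 \<le> seq_coeff nabla bs (b + 1)" if "b \<in> admissible N 1 (n + 13) - set bs" for b
    proof (cases "n0 \<le> b + 1")
      case True
      then show ?thesis using far[of "b + 1"] by simp
    next
      case False
      then have b: "b + 1 < n0" by simp
      have "1 \<le> xs ! (b + 1)" by (rule drop_nth[OF xs(3) new[OF that] b])
      then show ?thesis using nth[OF b] by simp
    qed
    show "3 \<le> seq_coeff nabla bs n" by (rule far) fact
  qed
qed

text \<open>For N >= 15 neither the forbidden residues nor theta are felt between 2 and 13, apart
  from the missing part 1. One table thus serves all these N.\<close>

lemma C_1_1_eq_list:
  assumes "15 \<le> N" "2 \<le> n" "n < 14"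
  shows "C 1 1 N n = of_int (part_list [2..<14] (map nabla [0..<14]) ! n)"
proof -
  have A: "admissible N 1 13 = set [2..<14]"
    unfolding set_upt using assms(1) by (auto simp: admissible_def)
  have "int n \<notin> P_even (int N) (int 1)" using P_even_ge[of 1 N n] assms by auto
  moreover have "int n \<notin> P_odd (int N) (int 1)" using P_odd_ge[of 1 N n] assms by auto
  ultimately have "theta_coeff N 1 n = 0" by (simp add: theta_coeff_def)
  then have "C 1 1 N n = seq_coeff nabla [2..<14] n"
    using C_1_eq[of 1 N n 13] assms unfolding A seq_coeff_def by simp
  also have "\<dots> = of_int (part_list [2..<14] (map nabla [0..<14]) ! n)"
    by (rule seq_coeff_eq_list) (use assms(3) in auto)
  finally show ?thesis .
qed

lemma quadratic_check_2_3: "quadratic_check 2 3 5 (-144) 140" "quadratic_check 2 3 7 (-196) 192"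
  by code_simp+

theorem C_1_1_pos:
  assumes "5 \<le> N" "odd N" "2 \<le> n" "n \<notin> {3, 5, 7}" "N = 5 \<Longrightarrow> n \<notin> {9, 11, 13}" "N = 7 \<Longrightarrow> n \<noteq> 9"
  shows "0 < C 1 1 N n"
proof -
  have big: "0 < C 1 1 N n" if "11 \<le> N" "14 \<le> n"
  proof -
    \<comment> \<open>The parts are 2 to 9; a new part is at least 10, which gives \<open>n2\<close>
      = 11.\<close>
    have *: "nabla_check 9 [8, 7, 6, 4] 5 11 14" by code_simp
    show ?thesis
    proof (rule C_1_1_pos_of_check[OF _ _ _ quadratic_check_2_3(1) *])
      fix b assume b: "b \<in> admissible N 1 (n + 13) - set (9 # [8, 7, 6, 4] @ [2, 3, 5])"
      have "b \<noteq> 1" using b that by (auto simp: admissible_def)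
      moreover have "1 \<le> b" "b \<notin> {2, 3, 4, 5, 6, 7, 8, 9}" using b by (auto simp: admissible_def)
      ultimately show "11 \<le> b + 1" by auto
    qed (use that in \<open>auto simp: admissible_def\<close>)
  qed
  have "N = 5 \<or> N = 7 \<or> N = 9 \<or> N = 11 \<or> N = 13 \<or> 15 \<le> N"
    using assms(1,2) by presburger
  then consider "N = 5" | "N = 7" | "N = 9" | "N = 11" | "N = 13" | "15 \<le> N" by blast
  then show ?thesis
  proof cases
    case 1
    show ?thesis
    proof (cases "n < 26")
      case True
      have "pos_unless [0, 1, 3, 5, 7, 9, 11, 13] 0 (C_1_list 1 5 26)" by code_simp
      then show ?thesis unfolding 1 by (rule C_1_pos_small) (use True assms 1 in auto)
    next
      case False
      \<comment> \<open>The parts are all those congruent to 2 or 3 modulo 5 up to 13. The next one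
        is 17, which gives \<open>n2\<close> = 18; 7 replaces the forbidden 5 as third coprime
        part.\<close>
      have *: "nabla_check 13 [12, 8] 7 18 26" by code_simp
      show ?thesis
      proof (rule C_1_1_pos_of_check[OF _ _ _ quadratic_check_2_3(2) *])
        fix b assume "b \<in> admissible N 1 (n + 13) - set (13 # [12, 8] @ [2, 3, 7])"
        then have "1 \<le> b" "b mod 5 \<noteq> 0" "b mod 5 \<noteq> 1" "b mod 5 \<noteq> 4" "b \<notin> {2, 3, 7, 8, 12, 13}"
          using 1 by (auto simp: admissible_def)
        then show "18 \<le> b + 1" by auto presburger
      qed (use 1 False in \<open>auto simp: admissible_def\<close>)
    qed
  next
    case 2
    show ?thesis
    proof (cases "n < 14")
      case True
      have "pos_unless [0, 1, 3, 5, 7, 9] 0 (C_1_list 1 7 14)" by code_simp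
      then show ?thesis unfolding 2 by (rule C_1_pos_small) (use True assms 2 in auto)
    next
      case False
      have *: "nabla_check 12 [11, 10, 9, 4] 5 14 14" by code_simp
      show ?thesis
      proof (rule C_1_1_pos_of_check[OF _ _ _ quadratic_check_2_3(1) *])
        fix b assume "b \<in> admissible N 1 (n + 13) - set (12 # [11, 10, 9, 4] @ [2, 3, 5])"
        then have "1 \<le> b" "b mod 7 \<noteq> 0" "b mod 7 \<noteq> 1" "b mod 7 \<noteq> 6" "b \<notin> {2, 3, 4, 5, 9, 10, 11, 12}"
          using 2 by (auto simp: admissible_def)
        then show "14 \<le> b + 1" by auto presburger
      qed (use 2 False in \<open>auto simp: admissible_def\<close>)
    qed
  next
    case 3
    show ?thesis
    proof (cases "n < 14")
      case True
      have "pos_unless [0, 1, 3, 5, 7] 0 (C_1_list 1 9 14)" by code_simp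
      then show ?thesis unfolding 3 by (rule C_1_pos_small) (use True assms 3 in auto)
    next
      case False
      have *: "nabla_check 7 [6, 4] 5 12 14" by code_simp
      show ?thesis
      proof (rule C_1_1_pos_of_check[OF _ _ _ quadratic_check_2_3(1) *])
        fix b assume "b \<in> admissible N 1 (n + 13) - set (7 # [6, 4] @ [2, 3, 5])"
        then have "1 \<le> b" "b mod 9 \<noteq> 0" "b mod 9 \<noteq> 1" "b mod 9 \<noteq> 8" "b \<notin> {2, 3, 4, 5, 6, 7}"
          using 3 by (auto simp: admissible_def)
        then show "12 \<le> b + 1" by auto presburger
      qed (use 3 False in \<open>auto simp: admissible_def\<close>)
    qed
  next
    case 4
    show ?thesis
    proof (cases "n < 14")
      case True
      have "pos_unless [0, 1, 3, 5, 7] 0 (C_1_list 1 11 14)" by code_simp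
      then show ?thesis unfolding 4 by (rule C_1_pos_small) (use True assms 4 in auto)
    qed (use big 4 in simp)
  next
    case 5
    show ?thesis
    proof (cases "n < 14")
      case True
      have "pos_unless [0, 1, 3, 5, 7] 0 (C_1_list 1 13 14)" by code_simp
      then show ?thesis unfolding 5 by (rule C_1_pos_small) (use True assms 5 in auto)
    qed (use big 5 in simp)
  next
    case 6
    show ?thesis
    proof (cases "n < 14")
      case True
      have "pos_unless [0, 1, 3, 5, 7] 0 (part_list [2..<14] (map nabla [0..<14]))" by code_simp
      moreover have "n < length (part_list [2..<14] (map nabla [0..<14]))"
        using True length_part_list[of "[2..<14]" "map nabla [0..<14]"] by simp
      ultimately have "0 < part_list [2..<14] (map nabla [0..<14]) ! n"
        by (rule pos_unless_nth) (use assms in auto)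
      then show ?thesis using C_1_1_eq_list[OF 6 assms(3) True] by simp
    qed (use big 6 in simp)
  qed
qed

section \<open>Exceptional values and assembly\<close>

lemma C_1_value:
  assumes "C_1_list i N L ! n = v" "0 < i" "2 * i < N" "n < L" "L \<le> 6 * N"
  shows "C 1 i N n = of_int v"
  using C_1_eq_list[OF assms(2-5)] assms(1) by simp

lemma C_1_exceptional_values:
  "C 1 2 5 5 = 0" "C 1 2 5 7 = 0" "C 1 2 5 9 = 0" "C 1 2 5 11 = 0"
  "C 1 1 5 7 = - 1" "C 1 1 5 13 = - 1" "C 1 1 5 9 = 0" "C 1 1 5 11 = 0" "C 1 1 7 9 = 0"
proof -
  have "C_1_list 2 5 14 ! 5 = 0" "C_1_list 2 5 14 ! 7 = 0" "C_1_list 2 5 14 ! 9 = 0" "C_1_list 2 5 14 ! 11 = 0"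
    "C_1_list 1 5 14 ! 7 = - 1" "C_1_list 1 5 14 ! 13 = - 1" "C_1_list 1 5 14 ! 9 = 0"
    "C_1_list 1 5 14 ! 11 = 0" "C_1_list 1 7 14 ! 9 = 0"
    by code_simp+
  from this[THEN C_1_value] show "C 1 2 5 5 = 0" "C 1 2 5 7 = 0" "C 1 2 5 9 = 0" "C 1 2 5 11 = 0"
    "C 1 1 5 7 = - 1" "C 1 1 5 13 = - 1" "C 1 1 5 9 = 0" "C 1 1 5 11 = 0" "C 1 1 7 9 = 0"
    by simp_all
qed

lemma C_1_1_eq_0:
  assumes "5 \<le> N" "odd N" "n = 5 \<or> n = 7 \<and> N \<noteq> 5"
  shows "C 1 1 N n = 0"
proof -
  have small: "C_1_list 1 5 8 ! 5 = 0" "C_1_list 1 7 8 ! 5 = 0" "C_1_list 1 7 8 ! 7 = 0"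
    "C_1_list 1 9 8 ! 5 = 0" "C_1_list 1 9 8 ! 7 = 0" "C_1_list 1 11 8 ! 5 = 0" "C_1_list 1 11 8 ! 7 = 0"
    "C_1_list 1 13 8 ! 5 = 0" "C_1_list 1 13 8 ! 7 = 0"
    by code_simp+
  have large: "part_list [2..<14] (map nabla [0..<14]) ! 5 = 0" "part_list [2..<14] (map nabla [0..<14]) ! 7 = 0"
    by code_simp+
  have "N = 5 \<or> N = 7 \<or> N = 9 \<or> N = 11 \<or> N = 13 \<or> 15 \<le> N"
    using assms(1,2) by presburger
  then consider "N \<in> {5, 7, 9, 11, 13}" | "15 \<le> N" by blast
  then show ?thesis
  proof cases
    case 1
    then have "C_1_list 1 N 8 ! n = 0" using small assms(3) by auto
    then have "C 1 1 N n = of_int 0" by (rule C_1_value) (use assms in auto)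
    then show ?thesis by simp
  next
    case 2
    then have "C 1 1 N n = of_int (part_list [2..<14] (map nabla [0..<14]) ! n)"
      by (rule C_1_1_eq_list) (use assms(3) in auto)
    then show ?thesis using large assms(3) by (auto simp del: upt_Suc)
  qed
qed

lemma C_sign:
  fixes \<tau> d i k n :: nat
  defines "N \<equiv> 2*d + 2 + \<tau>"
  assumes \<tau>: "\<tau> \<in> {0, 1}" and d: "d \<ge> 1" and i: "2 - \<tau> \<le> i" "i \<le> d + \<tau>" and k: "k \<ge> 1"
    and n: "pent k \<le> n"
  shows "if (k, i, N, n) \<in> exc_minus_one then C k i N n = - 1
    else if (k, i, N, n) \<in> exc_zero then C k i N n = 0 else C k i N n > 0"
proof -
  \<comment> \<open>N = 4 cannot occur: for \<open>\<tau>\<close> = 0 the condition 2 <= i <= d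
    forces d >= 2.\<close>
  have N: "0 < i" "2 * i < N" "5 \<le> N" using \<tau> d i by (auto simp: N_def)
  have odd: "\<tau> = 1" "odd N" if "i = 1" using \<tau> i that by (auto simp: N_def)
  consider (minus_one) "(k, i, N, n) \<in> exc_minus_one"
    | (zero) "(k, i, N, n) \<notin> exc_minus_one" "(k, i, N, n) \<in> exc_zero"
    | (pos) "(k, i, N, n) \<notin> exc_minus_one" "(k, i, N, n) \<notin> exc_zero" by blast
  then show ?thesis
  proof cases
    case minus_one
    then have "C k i N n = - 1" by (auto simp: exc_minus_one_def C_1_exceptional_values simp del: One_nat_def)
    then show ?thesis using minus_one by simp
  next
    case zero
    have "C k i N n = 0"
    proof -
      have "(k, i, N, n) \<in> {(1,2,5,5), (1,2,5,7), (1,2,5,9), (1,2,5,11), (1,1,5,9), (1,1,5,11), (1,1,7,9)}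
          \<or> (k, i, N, n) = (2,1,5,12) \<or> (k = 1 \<and> i = 1 \<and> (n = 5 \<or> n = 7 \<and> N \<noteq> 5))
          \<or> (i = 1 \<and> n = pent k + 1)"
        using zero(2) unfolding exc_zero_def pent_def Un_iff mem_Collect_eq insert_iff empty_iff prod.inject
        by (elim disjE exE conjE; simp)
      then consider "(k, i, N, n) \<in> {(1,2,5,5), (1,2,5,7), (1,2,5,9), (1,2,5,11), (1,1,5,9), (1,1,5,11), (1,1,7,9)}"
        | "(k, i, N, n) = (2,1,5,12)"
        | "k = 1" "i = 1" "n = 5 \<or> n = 7 \<and> N \<noteq> 5"
        | "i = 1" "n = pent k + 1"
        by argo
      then show ?thesis
      proof cases
        case 1
        then show ?thesis by (auto simp: C_1_exceptional_values simp del: One_nat_def)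
      next
        case 2
        then show ?thesis by (simp add: C_2_1_5_12 del: One_nat_def)
      next
        case 3
        then show ?thesis using C_1_1_eq_0[of N n] N odd by simp
      next
        case 4
        then show ?thesis using C_at_pent_add_1[of k N] k N by simp
      qed
    qed
    then show ?thesis using zero by simp
  next
    case pos
    \<comment> \<open>The infinite family of zeros is indexed by d with N = 2 d + 3; it applies
      since i = 1 forces \<open>\<tau>\<close> = 1. For k = 1 it is what excludes n = 3.\<close>
    have shift: "\<not> (i = 1 \<and> n = pent k + 1)"
    proof
      assume "i = 1 \<and> n = pent k + 1"
      then have "(k, i, N, n) \<in> exc_zero"
        using odd d k unfolding exc_zero_def N_def pent_def by auto
      with pos show False by simp
    qed
    have "0 < C k i N n"
    proof (cases "k = 1")
      case True
      have n2: "2 \<le> n" using n True by (simp add: pent_def)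
      show ?thesis
      proof (cases "i = 1")
        case i1: True
        have "n \<noteq> 3" using shift i1 True by (auto simp: pent_def)
        moreover have "n \<noteq> 5"
          using pos(2) i1 True odd d unfolding exc_zero_def N_def by auto
        moreover have "n \<noteq> 7"
        proof
          assume "n = 7"
          show False
          proof (cases "d = 1")
            case True
            then show False using pos(1) \<open>k = 1\<close> i1 odd \<open>n = 7\<close> unfolding exc_minus_one_def N_def by auto
          next
            case False
            then show False using pos(2) \<open>k = 1\<close> i1 odd d \<open>n = 7\<close> unfolding exc_zero_def N_def by auto
          qed
        qed
        moreover have "n \<notin> {9, 11, 13}" if "N = 5"
          using pos True i1 that unfolding exc_zero_def exc_minus_one_def by auto
        moreover have "n \<noteq> 9" if "N = 7"
          using pos True i1 that unfolding exc_zero_def by auto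
        ultimately have "0 < C 1 1 N n"
          using C_1_1_pos[OF N(3) odd(2)[OF i1] n2] by blast
        then show ?thesis using True i1 by simp
      next
        case False
        then have i2: "2 \<le> i" using N(1) by simp
        show ?thesis
        proof (cases "i = 2 \<and> N = 5")
          case special: True
          then have "n \<notin> {5, 7, 9, 11}" using pos True unfolding exc_zero_def by auto
          then show ?thesis using C_1_2_5_pos[OF n2] special True by simp
        next
          case False
          then show ?thesis using C_1_pos_of_ge_2[OF i2 N(2) n2] True by simp
        qed
      qed
    next
      case False
      show ?thesis
      proof (rule C_pos_of_ge_2)
        show "2 \<le> k" using k False by simp
        show "N \<noteq> 6" if "i = 1" using odd(2)[OF that] by auto
        show "n \<noteq> pent k + 1" if "i = 1" using shift that by blast
        show "\<not> (k = 2 \<and> i = 1 \<and> N = 5 \<and> n = 12)" using pos unfolding exc_zero_def by auto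
      qed (use N n in auto)
    qed
    then show ?thesis using pos by simp
  qed
qed

theorem theorem2p1:
  fixes \<tau> d i k :: nat
  assumes "\<tau> \<in> {0, 1}" and "d \<ge> 1"
    and "2 - \<tau> \<le> i" and "i \<le> d + \<tau>" and "k \<ge> 1"
  shows "(\<forall>n. C k i (2*d + 2 + \<tau>) n =
            (- 1) ^ (k - 1) * (\<Sum>l\<in>{- int k<..int k}. (- 1) powi l * D \<tau> d i (int n - l * (3*l - 1) div 2))
            + (- 1) ^ k * (of_bool (int n \<in> P_even (int (2*d + 2 + \<tau>)) (int i))
                           - of_bool (int n \<in> P_odd (int (2*d + 2 + \<tau>)) (int i))))
       \<and> (\<forall>n. n < k * (3*k + 1) div 2 \<longrightarrow> C k i (2*d + 2 + \<tau>) n = 0)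
       \<and> (\<forall>n. n \<ge> k * (3*k + 1) div 2 \<longrightarrow>
            (if (k, i, 2*d + 2 + \<tau>, n) \<in> exc_minus_one then C k i (2*d + 2 + \<tau>) n = - 1
             else if (k, i, 2*d + 2 + \<tau>, n) \<in> exc_zero then C k i (2*d + 2 + \<tau>) n = 0
             else C k i (2*d + 2 + \<tau>) n > 0))"
proof -
  have i: "0 < i" "2 * i < 2*d + 2 + \<tau>" using assms(1-4) by auto
  show ?thesis
  proof (intro conjI allI impI)
    fix n
    show "C k i (2*d + 2 + \<tau>) n =
        (- 1) ^ (k - 1) * (\<Sum>l\<in>{- int k<..int k}. (- 1) powi l * D \<tau> d i (int n - l * (3*l - 1) div 2))
        + (- 1) ^ k * (of_bool (int n \<in> P_even (int (2*d + 2 + \<tau>)) (int i))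
                       - of_bool (int n \<in> P_odd (int (2*d + 2 + \<tau>)) (int i)))"
      by (rule C_eq_sum_D[OF assms(5) i])
  next
    fix n
    assume "n < k * (3*k + 1) div 2"
    then show "C k i (2*d + 2 + \<tau>) n = 0"
      by (intro C_eq_0[OF assms(5)]) (simp add: pent_def)
  next
    fix n
    assume "n \<ge> k * (3*k + 1) div 2"
    then show "if (k, i, 2*d + 2 + \<tau>, n) \<in> exc_minus_one then C k i (2*d + 2 + \<tau>) n = - 1
        else if (k, i, 2*d + 2 + \<tau>, n) \<in> exc_zero then C k i (2*d + 2 + \<tau>) n = 0
        else C k i (2*d + 2 + \<tau>) n > 0"
      by (intro C_sign[OF assms]) (simp add: pent_def)
  qed
qed

end
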